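(* Let $A=(a_{ij})$ be a $d\times n$ integer matrix of rank $d$ whose column vectors $a_1,\ldots,a_n$ generate $\mathbf{Z}^d$ and none of which is zero. Then the holonomic rank of the $\mathcal{A}$-hypergeometric differential-difference system $\boldsymbol{H}_A$ equals the normalized volume $\operatorname{vol}(A)$.
   Context: Let $\boldsymbol{D}=\mathbf{C}\langle x_1,\ldots,x_n,s_1,\ldots,s_d,\partial_1,\ldots,\partial_n,S_1^{\pm1},\ldots,S_d^{\pm1}\rangle$ with relations $S_is_i=(s_i+1)S_i$, $S_i^{-1}s_i=(s_i-1)S_i^{-1}$, $S_iS_i^{-1}=1$, $\partial_ix_i=x_i\partial_i+1$, and all other pairs of generators commuting. $\boldsymbol{H}_A$ is the left ideal of $\boldsymbol{D}$ generated by $\sum_{j=1}^n a_{ij}x_j\partial_j - s_i$ ($i=1,\ldots,d$) and $\partial_j-\prod_{i=1}^d S_i^{-a_{ij}}$ ($j=1,\ldots,n$). Let $\mathbf{U}=\mathbf{C}(s_1,\ldots,s_d,x_1,\ldots,x_n)\langle S_1^{\pm1},\ldots,S_d^{\pm1},\partial_1,\ldots,\partial_n\rangle$ with $\partial_ic=c\partial_i+\partial c/\partial x_i$ and $S_i^{\pm1}c(s,x)=c(s_1,\ldots,s_i\pm1,\ldots,s_d,x)S_i^{\pm1}$ for rational functions $c$. The holonomic rank of a left ideal $I\subseteq\boldsymbol{D}$ is $\operatorname{rank}(I)=\dim_{\mathbf{C}(s,x)}\mathbf{U}/\mathbf{U}I$. The normalized volume $\operatorname{vol}(A)$ is the volume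 of the convex hull of the origin and $a_1,\ldots,a_n$ in $\mathbf{R}^d$, normalized so that $\operatorname{conv}\{0,e_1,\ldots,e_d\}$ has volume $1$. *)

theory Defs
  imports "HOL-Analysis.Analysis" "HOL-Library.Poly_Mapping" "HOL-Computational_Algebra.Fraction_Field"
begin

section \<open>Variables s_1..s_d (indexed by 'd) and x_1..x_n (indexed by 'n)\<close>

datatype ('d, 'n) hvar = SV 'd | XV 'n

instantiation hvar :: (linorder, linorder) linorder
begin
fun less_eq_hvar :: "('a, 'b) hvar \<Rightarrow> ('a, 'b) hvar \<Rightarrow> bool" where
  "less_eq_hvar (SV a) (SV b) = (a \<le> b)"
| "less_eq_hvar (SV a) (XV b) = True"
| "less_eq_hvar (XV a) (SV b) = False"
| "less_eq_hvar (XV a) (XV b) = (a \<le> b)"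
definition less_hvar :: "('a, 'b) hvar \<Rightarrow> ('a, 'b) hvar \<Rightarrow> bool" where
  "less_hvar u v = (u \<le> v \<and> \<not> v \<le> u)"
instance
proof
  fix x y z :: "('a, 'b) hvar"
  show "(x < y) = (x \<le> y \<and> \<not> y \<le> x)" by (simp add: less_hvar_def)
  show "x \<le> x" by (cases x) auto
  show "x \<le> y \<Longrightarrow> y \<le> z \<Longrightarrow> x \<le> z"
    by (cases x; cases y; cases z) (auto intro: order_trans)
  show "x \<le> y \<Longrightarrow> y \<le> x \<Longrightarrow> x = y"
    by (cases x; cases y) auto
  show "x \<le> y \<or> y \<le> x" by (cases x; cases y) auto
qed
end

type_synonym ('d, 'n) cpoly = "(('d, 'n) hvar \<Rightarrow>\<^sub>0 nat) \<Rightarrow>\<^sub>0 complex"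
type_synonym ('d, 'n) crat = "('d, 'n) cpoly fract"

definition pvar :: "('d, 'n) hvar \<Rightarrow> ('d, 'n) cpoly" where
  "pvar v = Poly_Mapping.single (Poly_Mapping.single v 1) 1"

definition pderiv_x :: "'n \<Rightarrow> ('d, 'n) cpoly \<Rightarrow> ('d, 'n) cpoly" where
  "pderiv_x j p = Abs_poly_mapping (\<lambda>\<mu> :: ('d, 'n) hvar \<Rightarrow>\<^sub>0 nat.
     of_nat (Poly_Mapping.lookup \<mu> (XV j) + 1) * Poly_Mapping.lookup p (\<mu> + Poly_Mapping.single (XV j) 1))"

definition shift_subst :: "('d \<Rightarrow> int) \<Rightarrow> ('d, 'n) hvar \<Rightarrow> ('d, 'n) cpoly" where
  "shift_subst m v = (case v of SV i \<Rightarrow> pvar (SV i) + of_int (m i) | XV j \<Rightarrow> pvar (XV j))"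

definition pshift :: "('d \<Rightarrow> int) \<Rightarrow> ('d, 'n) cpoly \<Rightarrow> ('d, 'n) cpoly" where
  "pshift m p = (\<Sum>\<mu>\<in>Poly_Mapping.keys p. Poly_Mapping.single 0 (Poly_Mapping.lookup p \<mu>) *
                    (\<Prod>v\<in>Poly_Mapping.keys \<mu>. shift_subst m v ^ Poly_Mapping.lookup \<mu> v))"

text \<open>Extensions to rational functions (independent of the chosen representative).\<close>
definition kshift :: "('d \<Rightarrow> int) \<Rightarrow> ('d::linorder, 'n::linorder) crat \<Rightarrow> ('d::linorder, 'n::linorder) crat" where
  "kshift m q = (SOME r. \<exists>a b. b \<noteq> 0 \<and> q = Fract a b \<and> r = Fract (pshift m a) (pshift m b))"

definition kderiv :: "'n \<Rightarrow> ('d::linorder, 'n::linorder) crat \<Rightarrow> ('d::linorder, 'n::linorder) crat" where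
  "kderiv j q = (SOME r. \<exists>a b. b \<noteq> 0 \<and> q = Fract a b \<and>
                    r = Fract (pderiv_x j a * b - a * pderiv_x j b) (b * b))"

text \<open>An element of U is written uniquely as a finite sum
  \<open>\<Sum> c_{m,k}(s,x) S^m \<partial>^k\<close> with coefficients on the left,
  m \<in> Z^d, k \<in> N^n; it is represented by the finitely supported map (m,k) \<mapsto> c_{m,k}.\<close>
type_synonym ('d, 'n) Uop = "(('d \<Rightarrow> int) \<times> ('n \<Rightarrow> nat)) \<Rightarrow>\<^sub>0 ('d, 'n) crat"

definition unitvec :: "'a \<Rightarrow> 'a \<Rightarrow> 'b::zero_neq_one" where
  "unitvec i = (\<lambda>i'. if i' = i then 1 else 0)"

definition U_scale :: "('d::linorder, 'n::linorder) crat \<Rightarrow> ('d::linorder, 'n::linorder) Uop \<Rightarrow> ('d::linorder, 'n::linorder) Uop" where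
  "U_scale c u = Poly_Mapping.map (\<lambda>a. c * a) u"

text \<open>Left multiplication by S_i^e (e = 1 or e = -1):
  S_i^e (c S^m \<partial>^k) = c(s_i + e) S^{m + e e_i} \<partial>^k.\<close>
definition U_Smul :: "'d \<Rightarrow> int \<Rightarrow> ('d::linorder, 'n::linorder) Uop \<Rightarrow> ('d::linorder, 'n::linorder) Uop" where
  "U_Smul i e u = Abs_poly_mapping (\<lambda>(m, k).
      kshift (\<lambda>i'. e * unitvec i i') (Poly_Mapping.lookup u (\<lambda>i'. m i' - e * unitvec i i', k)))"

text \<open>Left multiplication by \<partial>_j:
  \<partial>_j (c S^m \<partial>^k) = (\<partial>c/\<partial>x_j) S^m \<partial>^k + c S^m \<partial>^{k + e_j}.\<close>
definition U_Dmul :: "'n \<Rightarrow> ('d::linorder, 'n::linorder) Uop \<Rightarrow> ('d::linorder, 'n::linorder) Uop" where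
  "U_Dmul j u = Abs_poly_mapping (\<lambda>(m, k).
      kderiv j (Poly_Mapping.lookup u (m, k)) +
      (if k j > 0 then Poly_Mapping.lookup u (m, \<lambda>j'. k j' - unitvec j j') else 0))"

text \<open>The left ideal U G of U generated by a set G: since U is generated as a ring by
  C(s,x), S_i^{\<pm>1} and \<partial>_j, it is the smallest set containing G and 0 that is closed
  under addition and under left multiplication by these generators.\<close>
inductive_set U_left_ideal :: "('d::linorder, 'n::linorder) Uop set \<Rightarrow> ('d::linorder, 'n::linorder) Uop set" for G where
  gen: "g \<in> G \<Longrightarrow> g \<in> U_left_ideal G"
| zero: "0 \<in> U_left_ideal G"
| add: "u \<in> U_left_ideal G \<Longrightarrow> v \<in> U_left_ideal G \<Longrightarrow> u + v \<in> U_left_ideal G"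
| scale: "u \<in> U_left_ideal G \<Longrightarrow> U_scale c u \<in> U_left_ideal G"
| Smul: "u \<in> U_left_ideal G \<Longrightarrow> e \<in> {1, -1} \<Longrightarrow> U_Smul i e u \<in> U_left_ideal G"
| Dmul: "u \<in> U_left_ideal G \<Longrightarrow> U_Dmul j u \<in> U_left_ideal G"

definition quot_dim_eq :: "('d::linorder, 'n::linorder) Uop set \<Rightarrow> nat \<Rightarrow> bool" where
  "quot_dim_eq W r \<longleftrightarrow> (\<exists>v :: nat \<Rightarrow> ('d::linorder, 'n::linorder) Uop.
      (\<forall>u. \<exists>c :: nat \<Rightarrow> ('d::linorder, 'n::linorder) crat. u - (\<Sum>t<r. U_scale (c t) (v t)) \<in> W) \<and>
      (\<forall>c :: nat \<Rightarrow> ('d::linorder, 'n::linorder) crat. (\<Sum>t<r. U_scale (c t) (v t)) \<in> W \<longrightarrow> (\<forall>t<r. c t = 0)))"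

definition kvar :: "('d, 'n) hvar \<Rightarrow> ('d::linorder, 'n::linorder) crat" where
  "kvar v = Fract (pvar v) 1"

definition euler_op :: "int^('n::{finite,linorder})^('d::{finite,linorder}) \<Rightarrow> 'd \<Rightarrow> ('d, 'n) Uop" where
  "euler_op A i = (\<Sum>j\<in>UNIV. Poly_Mapping.single (\<lambda>_. 0, unitvec j) (of_int (A$i$j) * kvar (XV j)))
                 - Poly_Mapping.single (\<lambda>_. 0, \<lambda>_. 0) (kvar (SV i))"

definition box_op :: "int^('n::{finite,linorder})^('d::{finite,linorder}) \<Rightarrow> 'n \<Rightarrow> ('d, 'n) Uop" where
  "box_op A j = Poly_Mapping.single (\<lambda>_. 0, unitvec j) 1
               - Poly_Mapping.single (\<lambda>i. - A$i$j, \<lambda>_. 0) 1"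

definition H_A_gens :: "int^('n::{finite,linorder})^('d::{finite,linorder}) \<Rightarrow> ('d, 'n) Uop set" where
  "H_A_gens A = range (euler_op A) \<union> range (box_op A)"

definition U_H_A :: "int^('n::{finite,linorder})^('d::{finite,linorder}) \<Rightarrow> ('d, 'n) Uop set" where
  "U_H_A A = U_left_ideal (H_A_gens A)"

definition col_real :: "int^'n^'d \<Rightarrow> 'n \<Rightarrow> real^'d" where
  "col_real A j = (\<chi> i. real_of_int (A$i$j))"

definition normalized_volume :: "int^'n^'d \<Rightarrow> real" where
  "normalized_volume A = fact CARD('d) *
      measure lebesgue (convex hull (insert 0 (range (col_real A))))"

end

theory Submission
  imports Defs "HOL-Computational_Algebra.Formal_Laurent_Series"
begin

unbundle no Formal_Power_Series.fps_syntax

text \<open>Write \<open>K = C(s, x)\<close>. Modulo the operators \<open>\<partial>_j - S^(-a_j)\<close> the module \<open>U / U H_A\<close> becomes the space of Laurent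
polynomials over \<open>K\<close> in \<open>y = S^(-1)\<close> modulo the \<open>K\<close>-span of \<open>\<Sum>_j a_ij x_j y^(m + a_j) - (s_i - m_i) y^m\<close>, so its
dual consists of the functions \<open>\<phi>\<close> on \<open>Z^d\<close> with \<open>\<Sum>_j a_ij x_j \<phi>(m + a_j) = (s_i - m_i) \<phi>(m)\<close>.
Choose a generic weight \<open>\<omega>\<close> close to a multiple of \<open>(1, ..., 1)\<close>. It induces a triangulation of the cone over the
columns, refining the faces of the polytope away from the origin, and, by giving \<open>x_j\<close> the order \<open>\<omega>_j\<close>, a
valuation on \<open>K\<close>. After a generic translation \<open>v\<close> no lattice point lies on a wall; the standard points
are those whose translate lies in the fundamental parallelepiped of its cone. Comparing the valuation of
\<open>\<phi>(m)\<close> with the piecewise linear height of \<open>m + v\<close> shows that a solution vanishing on the standard points is zero.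
Conversely each standard point carries a Gamma-series solution whose leading term sits at that point,
and the same comparison shows that the standard monomials are linearly independent. Their number is the sum of the
volumes of the parallelepipeds, that is, \<open>d!\<close> times the volume of the polytope.\<close>

section \<open>Polynomials, rational functions and their shifts and derivatives\<close>

text \<open>The two halves of the count need different value fields. Functionals on the quotient
  take values in K and only admit a descent argument; explicit solutions are infinite series and
  live in Laurent series over K, where x_j becomes x_j t^(\<omega>_j). Pulling the order in t back
  along this embedding of K gives the valuation on K, so one valuation excludes solutions in the
  first half and compares leading terms in the second. Pairing with a series is semilinear over the
  embedding and therefore still annihilates the ideal. The descent must run over a finite set, and
  this dictates the weight: it has to be so close to a constant that moving along a column raises
  the degree by at most one. Resonance never occurs, because s is transcendental and a nonzero
  linear form in s plus a constant cannot vanish in K. The translation puts every translated lattice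
  point of the cone generated by the columns into an open simplicial cone, so boundary cases do not
  arise.\<close>

definition monom_eval :: "('v \<Rightarrow> 'r::comm_ring_1) \<Rightarrow> ('v \<Rightarrow>\<^sub>0 nat) \<Rightarrow> 'r" where
  "monom_eval X \<mu> = (\<Prod>v\<in>Poly_Mapping.keys \<mu>. X v ^ Poly_Mapping.lookup \<mu> v)"

definition poly_eval ::
    "(complex \<Rightarrow> 'r::comm_ring_1) \<Rightarrow> ('v \<Rightarrow> 'r) \<Rightarrow> (('v \<Rightarrow>\<^sub>0 nat) \<Rightarrow>\<^sub>0 complex) \<Rightarrow> 'r" where
  "poly_eval C X p = (\<Sum>\<mu>\<in>Poly_Mapping.keys p. C (Poly_Mapping.lookup p \<mu>) * monom_eval X \<mu>)"

text \<open>Shifts, constants, passage to fractions and the weight embedding are all unital ring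
  homomorphisms; a common predicate yields their algebraic rules from one lemma.\<close>

definition ring_map :: "('a::comm_ring_1 \<Rightarrow> 'b::comm_ring_1) \<Rightarrow> bool" where
  "ring_map h \<longleftrightarrow> h 1 = 1 \<and> (\<forall>a b. h (a + b) = h a + h b) \<and> (\<forall>a b. h (a * b) = h a * h b)"

lemma ring_map_simps:
  assumes "ring_map h"
  shows "h 0 = 0" "h 1 = 1" "h (a + b) = h a + h b" "h (a * b) = h a * h b"
    "h (- a) = - h a" "h (a - b) = h a - h b" "h (sum f S) = (\<Sum>s\<in>S. h (f s))"
    "h (prod f S) = (\<Prod>s\<in>S. h (f s))" "h (a ^ n) = h a ^ n" "h (of_nat n) = of_nat n"
    "h (of_int z) = of_int z"
proof -
  have add: "h (a + b) = h a + h b" and mult: "h (a * b) = h a * h b" and one: "h 1 = 1" for a b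
    using assms by (auto simp: ring_map_def)
  have zero: "h 0 = 0" using add[of 0 0] by simp
  have uminus: "h (- a) = - h a" for a
    using add[of a "- a"] zero by (simp add: eq_neg_iff_add_eq_0 add.commute)
  show "h 0 = 0" "h 1 = 1" "h (a + b) = h a + h b" "h (a * b) = h a * h b" "h (- a) = - h a"
    by (fact zero one add mult uminus)+
  show "h (a - b) = h a - h b" using add[of a "- b"] uminus[of b] by simp
  show "h (sum f S) = (\<Sum>s\<in>S. h (f s))" by (induct S rule: infinite_finite_induct) (auto simp: zero add)
  show "h (prod f S) = (\<Prod>s\<in>S. h (f s))" by (induct S rule: infinite_finite_induct) (auto simp: one mult)
  show "h (a ^ n) = h a ^ n" by (induct n) (auto simp: one mult)
  have nat: "h (of_nat n) = of_nat n" for n by (induct n) (auto simp: one zero add)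
  then show "h (of_nat n) = of_nat n" .
  show "h (of_int z) = of_int z"
    by (cases z) (simp_all add: nat uminus one add del: of_nat_Suc)
qed

lemma monom_eval_superset:
  assumes "finite S" "Poly_Mapping.keys \<mu> \<subseteq> S"
  shows "monom_eval X \<mu> = (\<Prod>v\<in>S. X v ^ Poly_Mapping.lookup \<mu> v)"
  unfolding monom_eval_def using assms
  by (intro prod.mono_neutral_left) (auto simp: in_keys_iff)

lemma monom_eval_add: "monom_eval X (\<mu> + \<nu>) = monom_eval X \<mu> * monom_eval X \<nu>"
proof -
  let ?S = "Poly_Mapping.keys \<mu> \<union> Poly_Mapping.keys \<nu>"
  have "Poly_Mapping.keys (\<mu> + \<nu>) \<subseteq> ?S" by (rule Poly_Mapping.keys_add)
  then show ?thesis
    by (simp add: monom_eval_superset[where S = ?S] lookup_add power_add prod.distrib)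
qed

lemma monom_eval_0 [simp]: "monom_eval X 0 = 1"
  by (simp add: monom_eval_def)

lemma monom_eval_single: "monom_eval X (Poly_Mapping.single v n) = X v ^ n"
  by (cases "n = 0") (auto simp: monom_eval_def)

lemma poly_mapping_sum_singles:
  "p = (\<Sum>\<mu>\<in>Poly_Mapping.keys p. Poly_Mapping.single \<mu> (Poly_Mapping.lookup p \<mu>))"
proof (rule poly_mapping_eqI)
  fix \<nu>
  show "Poly_Mapping.lookup p \<nu> = Poly_Mapping.lookup (\<Sum>\<mu>\<in>Poly_Mapping.keys p. Poly_Mapping.single \<mu> (Poly_Mapping.lookup p \<mu>)) \<nu>"
    by (simp add: lookup_sum lookup_single when_def not_in_keys_iff_lookup_eq_zero)
qed

context
  fixes C :: "complex \<Rightarrow> 'r::comm_ring_1"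
  assumes C: "ring_map C"
begin

lemma poly_eval_add: "poly_eval C X (p + q) = poly_eval C X p + poly_eval C X q"
  unfolding poly_eval_def
  by (rule setsum_keys_plus_distrib) (auto simp: ring_map_simps[OF C] algebra_simps)

lemma poly_eval_0 [simp]: "poly_eval C X 0 = 0"
  by (simp add: poly_eval_def)

lemma poly_eval_sum: "poly_eval C X (sum f S) = (\<Sum>s\<in>S. poly_eval C X (f s))"
  by (induct S rule: infinite_finite_induct) (auto simp: poly_eval_add)

lemma poly_eval_single: "poly_eval C X (Poly_Mapping.single \<mu> c) = C c * monom_eval X \<mu>"
  by (cases "c = 0") (auto simp: poly_eval_def ring_map_simps[OF C])

lemma poly_eval_mult: "poly_eval C X (p * q) = poly_eval C X p * poly_eval C X q"
proof -
  let ?s = "\<lambda>p \<mu>. Poly_Mapping.single \<mu> (Poly_Mapping.lookup p \<mu>)"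
  have "p * q = (\<Sum>\<mu>\<in>Poly_Mapping.keys p. ?s p \<mu>) * (\<Sum>\<nu>\<in>Poly_Mapping.keys q. ?s q \<nu>)"
    by (simp add: poly_mapping_sum_singles[symmetric])
  then have "poly_eval C X (p * q) = (\<Sum>\<mu>\<in>Poly_Mapping.keys p. \<Sum>\<nu>\<in>Poly_Mapping.keys q.
      poly_eval C X (?s p \<mu>) * poly_eval C X (?s q \<nu>))"
    by (simp add: sum_product poly_eval_sum mult_single poly_eval_single monom_eval_add
        ring_map_simps[OF C] mult_ac)
  also have "\<dots> = poly_eval C X (\<Sum>\<mu>\<in>Poly_Mapping.keys p. ?s p \<mu>) * poly_eval C X (\<Sum>\<nu>\<in>Poly_Mapping.keys q. ?s q \<nu>)"
    by (simp add: sum_product poly_eval_sum)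
  finally show ?thesis by (simp add: poly_mapping_sum_singles[symmetric])
qed

lemma ring_map_poly_eval: "ring_map (poly_eval C X)"
  unfolding ring_map_def
  by (auto simp: poly_eval_add poly_eval_mult poly_eval_single[of X 0 1, simplified] ring_map_simps[OF C])

end

lemma poly_eval_const: "ring_map C \<Longrightarrow> poly_eval C X (Poly_Mapping.single 0 c) = C c"
  by (simp add: poly_eval_single)

lemma poly_eval_pvar: "ring_map C \<Longrightarrow> poly_eval C X (pvar v) = X v"
  by (simp add: pvar_def poly_eval_single monom_eval_single ring_map_simps)

lemma ring_map_single: "ring_map (\<lambda>c::'a::comm_ring_1. Poly_Mapping.single (0::'b::comm_monoid_add) c)"
  by (simp add: ring_map_def single_add mult_single)

lemma ring_map_comp: "ring_map g \<Longrightarrow> ring_map h \<Longrightarrow> ring_map (\<lambda>x. g (h x))"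
  by (simp add: ring_map_def)

lemma monom_eval_pvar: "monom_eval pvar \<mu> = Poly_Mapping.single \<mu> 1"
proof -
  have pow: "pvar v ^ n = Poly_Mapping.single (Poly_Mapping.single v n) 1" for v :: "('d, 'n) hvar" and n
    by (induct n) (auto simp: pvar_def mult_single single_add[symmetric])
  have prd: "(\<Prod>v\<in>S. Poly_Mapping.single (f v) (1::complex)) = Poly_Mapping.single (sum f S) 1"
    if "finite S" for S and f :: "('d, 'n) hvar \<Rightarrow> ('d, 'n) hvar \<Rightarrow>\<^sub>0 nat"
    using that by induct (auto simp: mult_single)
  show ?thesis
    unfolding monom_eval_def pow
    by (subst prd) (auto simp: poly_mapping_sum_singles[symmetric])
qed

lemma poly_eval_id: "poly_eval (Poly_Mapping.single 0) pvar p = p"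
  by (subst (3) poly_mapping_sum_singles) (simp add: poly_eval_def monom_eval_pvar mult_single)

lemma ring_map_poly_eval_commute:
  assumes "ring_map h"
  shows "h (poly_eval C X p) = poly_eval (\<lambda>c. h (C c)) (\<lambda>v. h (X v)) p"
  by (simp add: poly_eval_def monom_eval_def ring_map_simps[OF assms])

lemma pshift_eq_poly_eval: "pshift m p = poly_eval (Poly_Mapping.single 0) (shift_subst m) p"
  by (simp add: pshift_def poly_eval_def monom_eval_def)

lemma ring_map_pshift: "ring_map (pshift m)"
  unfolding pshift_eq_poly_eval[abs_def] by (intro ring_map_poly_eval ring_map_single)

lemma pshift_pvar: "pshift m (pvar v) = shift_subst m v"
  unfolding pshift_eq_poly_eval by (simp add: poly_eval_pvar ring_map_single)

lemma pshift_const: "pshift m (Poly_Mapping.single 0 c) = Poly_Mapping.single 0 c"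
  unfolding pshift_eq_poly_eval by (simp add: poly_eval_const ring_map_single)

text \<open>The composite is a ring map fixing constants and variables. The resulting injectivity of
  \<open>pshift\<close> is what allows it to act on denominators.\<close>

lemma pshift_uminus_pshift: "pshift (\<lambda>i. - m i) (pshift m p) = p"
proof -
  have "pshift (\<lambda>i. - m i) (shift_subst m v) = pvar v" for v
    by (cases v) (auto simp: shift_subst_def ring_map_simps[OF ring_map_pshift] pshift_pvar)
  then have *: "(\<lambda>v. pshift (\<lambda>i. - m i) (shift_subst m v)) = pvar" by blast
  show ?thesis
    unfolding pshift_eq_poly_eval[of m]
    by (simp only: ring_map_poly_eval_commute[OF ring_map_pshift] pshift_const poly_eval_id *)
qed

lemma pshift_eq_0_iff [simp]: "pshift m p = 0 \<longleftrightarrow> p = 0"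
  by (metis pshift_uminus_pshift ring_map_pshift ring_map_simps(1))

section \<open>Extension of injective ring maps to the fraction field\<close>

lemma ring_map_Fract: "ring_map (\<lambda>a. Fract a 1)"
  by (simp add: ring_map_def One_fract_def)

text \<open>Same choice pattern as \<open>kshift\<close>, for an arbitrary map into a field. Shifts
  and the weight embedding are both instances, so independence of the representative is proved once
  for both.\<close>

definition fract_lift :: "('a::idom \<Rightarrow> 'b::field) \<Rightarrow> 'a fract \<Rightarrow> 'b" where
  "fract_lift h q = (SOME r. \<exists>a b. b \<noteq> 0 \<and> q = Fract a b \<and> r = h a / h b)"

context
  fixes h :: "'a::idom \<Rightarrow> 'b::field"
  assumes h: "ring_map h" and inj: "\<And>a. h a = 0 \<Longrightarrow> a = 0"
begin

lemma fract_lift_Fract: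
  assumes "b \<noteq> 0"
  shows "fract_lift h (Fract a b) = h a / h b"
  unfolding fract_lift_def
proof (rule some_equality)
  show "\<exists>a' b'. b' \<noteq> 0 \<and> Fract a b = Fract a' b' \<and> h a / h b = h a' / h b'" using assms by blast
next
  fix r assume "\<exists>a' b'. b' \<noteq> 0 \<and> Fract a b = Fract a' b' \<and> r = h a' / h b'"
  then obtain a' b' where b': "b' \<noteq> 0" "Fract a b = Fract a' b'" "r = h a' / h b'" by blast
  then have "h (a * b') = h (a' * b)" using assms by (simp add: eq_fract)
  moreover have "h b \<noteq> 0" "h b' \<noteq> 0" using inj assms b' by auto
  ultimately show "r = h a / h b" using b'(3) by (simp add: ring_map_simps[OF h] frac_eq_eq)
qed

lemma ring_map_fract_lift: "ring_map (fract_lift h)"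
  unfolding ring_map_def
proof (intro conjI allI)
  have nz: "h b \<noteq> 0" if "b \<noteq> 0" for b using inj that by auto
  show "fract_lift h 1 = 1" by (simp add: One_fract_def fract_lift_Fract ring_map_simps[OF h])
  fix p q :: "'a fract"
  show "fract_lift h (p + q) = fract_lift h p + fract_lift h q"
    by (cases p; cases q) (simp add: fract_lift_Fract ring_map_simps[OF h] nz field_simps)
  show "fract_lift h (p * q) = fract_lift h p * fract_lift h q"
    by (cases p; cases q) (simp add: fract_lift_Fract ring_map_simps[OF h] nz field_simps)
qed

lemma fract_lift_Fract_1: "fract_lift h (Fract a 1) = h a"
  by (simp add: fract_lift_Fract ring_map_simps[OF h])

end

lemma kshift_eq_fract_lift: "kshift m q = fract_lift (\<lambda>a. Fract (pshift m a) 1) q"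
  by (simp add: kshift_def fract_lift_def)

lemma ring_map_kshift: "ring_map (kshift m)"
  unfolding kshift_eq_fract_lift[abs_def]
  by (rule ring_map_fract_lift)
     (auto intro!: ring_map_comp[OF ring_map_Fract] ring_map_pshift simp: eq_fract Zero_fract_def)

lemma kshift_Fract_1: "kshift m (Fract a 1) = Fract (pshift m a) 1"
  unfolding kshift_eq_fract_lift
  by (rule fract_lift_Fract_1)
     (auto intro!: ring_map_comp[OF ring_map_Fract] ring_map_pshift simp: eq_fract Zero_fract_def)

definition kconst :: "complex \<Rightarrow> ('d::linorder, 'n::linorder) crat" where
  "kconst c = Fract (Poly_Mapping.single 0 c) 1"

lemma ring_map_kconst: "ring_map kconst"
  unfolding kconst_def[abs_def] by (intro ring_map_comp[OF ring_map_Fract] ring_map_single)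

lemmas kshift_simps = ring_map_simps[OF ring_map_kshift]

lemma of_int_Fract: "Fract (of_int z) 1 = of_int z"
  by (simp add: ring_map_simps(11)[OF ring_map_Fract])

lemma kshift_kvar: "kshift m (kvar v) = kvar v + (case v of SV i \<Rightarrow> of_int (m i) | XV j \<Rightarrow> 0)"
  by (cases v) (auto simp: kvar_def kshift_Fract_1 pshift_pvar shift_subst_def
      ring_map_simps(3)[OF ring_map_Fract] of_int_Fract)

section \<open>Derivations in the x-variables\<close>

lemma lookup_pderiv_x:
  fixes p :: "('d, 'n) cpoly"
  shows "Poly_Mapping.lookup (pderiv_x j p) \<mu>
    = of_nat (Poly_Mapping.lookup \<mu> (XV j) + 1) * Poly_Mapping.lookup p (\<mu> + Poly_Mapping.single (XV j) 1)"
proof -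
  let ?g = "\<lambda>\<mu>. \<mu> + Poly_Mapping.single (XV j) (1::nat)"
  have "finite (?g -` Poly_Mapping.keys p)" by (rule finite_vimageI) (auto simp: inj_def)
  then have "finite {\<mu>. of_nat (Poly_Mapping.lookup \<mu> (XV j) + 1) * Poly_Mapping.lookup p (?g \<mu>) \<noteq> 0}"
    by (rule rev_finite_subset) (auto simp: in_keys_iff)
  then show ?thesis unfolding pderiv_x_def by (simp add: Abs_poly_mapping_inverse)
qed

lemma pderiv_x_add: "pderiv_x j (p + q) = pderiv_x j p + pderiv_x j q"
  by (rule poly_mapping_eqI) (simp add: lookup_pderiv_x lookup_add algebra_simps)

lemma pderiv_x_0: "pderiv_x j 0 = 0"
  by (rule poly_mapping_eqI) (simp add: lookup_pderiv_x)

lemma pderiv_x_sum: "pderiv_x j (sum f S) = (\<Sum>s\<in>S. pderiv_x j (f s))"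
  by (induct S rule: infinite_finite_induct) (auto simp: pderiv_x_add pderiv_x_0)

text \<open>Subtraction of exponents is truncated: if x_j does not occur, the exponent on the right
  stays \<mu>, but its coefficient is 0.\<close>

lemma pderiv_x_single:
  "pderiv_x j (Poly_Mapping.single \<mu> c)
    = Poly_Mapping.single (\<mu> - Poly_Mapping.single (XV j) 1) (of_nat (Poly_Mapping.lookup \<mu> (XV j)) * c)"
proof (rule poly_mapping_eqI)
  fix \<nu>
  show "Poly_Mapping.lookup (pderiv_x j (Poly_Mapping.single \<mu> c)) \<nu> =
    Poly_Mapping.lookup (Poly_Mapping.single (\<mu> - Poly_Mapping.single (XV j) 1) (of_nat (Poly_Mapping.lookup \<mu> (XV j)) * c)) \<nu>"
  proof (cases "Poly_Mapping.lookup \<mu> (XV j) = 0")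
    case True
    then have "\<mu> \<noteq> \<nu> + Poly_Mapping.single (XV j) 1" by (auto simp: lookup_add)
    then show ?thesis using True by (simp add: lookup_pderiv_x lookup_single when_def)
  next
    case False
    have split: "\<mu> = (\<mu> - Poly_Mapping.single (XV j) 1) + Poly_Mapping.single (XV j) 1"
      using False by (intro poly_mapping_eqI) (auto simp: lookup_add lookup_minus lookup_single when_def)
    then have "\<mu> = \<nu> + Poly_Mapping.single (XV j) 1 \<longleftrightarrow> \<mu> - Poly_Mapping.single (XV j) 1 = \<nu>"
      by (metis add_right_cancel)
    moreover have "Poly_Mapping.lookup (\<mu> - Poly_Mapping.single (XV j) 1) (XV j) + 1 = Poly_Mapping.lookup \<mu> (XV j)"
      using False by (simp add: lookup_minus)
    ultimately show ?thesis
      by (auto simp only: lookup_pderiv_x lookup_single when_def mult_zero_right if_True if_False refl)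
  qed
qed

lemma pderiv_x_mult:
  fixes p q :: "('d, 'n) cpoly"
  shows "pderiv_x j (p * q) = pderiv_x j p * q + p * pderiv_x j q"
proof -
  let ?s = "\<lambda>p \<mu>. Poly_Mapping.single \<mu> (Poly_Mapping.lookup p \<mu>)"
  let ?e = "Poly_Mapping.single (XV j) (1::nat)"
  have mon: "pderiv_x j (Poly_Mapping.single \<mu> a * Poly_Mapping.single \<nu> b) =
     pderiv_x j (Poly_Mapping.single \<mu> a) * Poly_Mapping.single \<nu> b + Poly_Mapping.single \<mu> a * pderiv_x j (Poly_Mapping.single \<nu> b)"
    for \<mu> \<nu> :: "('d, 'n) hvar \<Rightarrow>\<^sub>0 nat" and a b
  proof -
    have 1: "Poly_Mapping.single (\<mu> - ?e + \<nu>) (of_nat (Poly_Mapping.lookup \<mu> (XV j)) * (a * b))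
        = Poly_Mapping.single (\<mu> + \<nu> - ?e) (of_nat (Poly_Mapping.lookup \<mu> (XV j)) * (a * b))"
    proof (cases "Poly_Mapping.lookup \<mu> (XV j) = 0")
      case False
      then have "\<mu> - ?e + \<nu> = \<mu> + \<nu> - ?e"
        by (intro poly_mapping_eqI) (auto simp: lookup_add lookup_minus lookup_single when_def)
      then show ?thesis by simp
    qed simp
    have 2: "Poly_Mapping.single (\<mu> + (\<nu> - ?e)) (of_nat (Poly_Mapping.lookup \<nu> (XV j)) * (a * b))
        = Poly_Mapping.single (\<mu> + \<nu> - ?e) (of_nat (Poly_Mapping.lookup \<nu> (XV j)) * (a * b))"
    proof (cases "Poly_Mapping.lookup \<nu> (XV j) = 0")
      case False
      then have "\<mu> + (\<nu> - ?e) = \<mu> + \<nu> - ?e"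
        by (intro poly_mapping_eqI) (auto simp: lookup_add lookup_minus lookup_single when_def)
      then show ?thesis by simp
    qed simp
    show ?thesis
      using 1 2 by (simp add: mult_single pderiv_x_single lookup_add single_add[symmetric] algebra_simps)
  qed
  have "p * q = (\<Sum>\<mu>\<in>Poly_Mapping.keys p. ?s p \<mu>) * (\<Sum>\<nu>\<in>Poly_Mapping.keys q. ?s q \<nu>)"
    by (simp add: poly_mapping_sum_singles[symmetric])
  also have "pderiv_x j \<dots> = pderiv_x j (\<Sum>\<mu>\<in>Poly_Mapping.keys p. ?s p \<mu>) * (\<Sum>\<nu>\<in>Poly_Mapping.keys q. ?s q \<nu>)
     + (\<Sum>\<mu>\<in>Poly_Mapping.keys p. ?s p \<mu>) * pderiv_x j (\<Sum>\<nu>\<in>Poly_Mapping.keys q. ?s q \<nu>)"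
    by (simp add: sum_product pderiv_x_sum mon sum.distrib)
  finally show ?thesis by (simp add: poly_mapping_sum_singles[symmetric])
qed

text \<open>The quotient rule does not depend on the representative: differentiating a b' = a' b
  supplies the second relation from which the cross-multiplied identity follows.\<close>

lemma kderiv_Fract:
  fixes a b :: "('d::linorder, 'n::linorder) cpoly"
  assumes "b \<noteq> 0"
  shows "kderiv j (Fract a b) = Fract (pderiv_x j a * b - a * pderiv_x j b) (b * b)"
  unfolding kderiv_def
proof (rule some_equality)
  show "\<exists>a' b'. b' \<noteq> 0 \<and> Fract a b = Fract a' b' \<and>
    Fract (pderiv_x j a * b - a * pderiv_x j b) (b * b) = Fract (pderiv_x j a' * b' - a' * pderiv_x j b') (b' * b')"
    using assms by blast
next
  fix r assume "\<exists>a' b'. b' \<noteq> 0 \<and> Fract a b = Fract a' b' \<and> r = Fract (pderiv_x j a' * b' - a' * pderiv_x j b') (b' * b')"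
  then obtain a' b' where b': "b' \<noteq> 0" "Fract a b = Fract a' b'"
    "r = Fract (pderiv_x j a' * b' - a' * pderiv_x j b') (b' * b')" by blast
  then have e: "a * b' = a' * b" using assms by (simp add: eq_fract)
  then have "pderiv_x j (a * b') = pderiv_x j (a' * b)" by simp
  then have d: "pderiv_x j a * b' + a * pderiv_x j b' = pderiv_x j a' * b + a' * pderiv_x j b"
    by (simp add: pderiv_x_mult)
  have "(pderiv_x j a' * b' - a' * pderiv_x j b') * (b * b) = (pderiv_x j a * b - a * pderiv_x j b) * (b' * b')"
    using e d by algebra
  then show "r = Fract (pderiv_x j a * b - a * pderiv_x j b) (b * b)"
    using assms b' by (simp add: eq_fract)
qed

lemma kderiv_add: "kderiv j (p + q) = kderiv j p + kderiv j q"
proof (cases p; cases q)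
  fix a b c d assume *: "p = Fract a b" "b \<noteq> 0" "q = Fract c d" "d \<noteq> 0"
  have "(pderiv_x j (a * d + c * b) * (b * d) - (a * d + c * b) * pderiv_x j (b * d)) * (b * b * (d * d)) =
    ((pderiv_x j a * b - a * pderiv_x j b) * (d * d) + (pderiv_x j c * d - c * pderiv_x j d) * (b * b)) * (b * d * (b * d))"
    unfolding pderiv_x_add pderiv_x_mult by algebra
  then show ?thesis using * by (simp add: kderiv_Fract eq_fract)
qed

lemma kderiv_mult: "kderiv j (p * q) = kderiv j p * q + p * kderiv j q"
proof (cases p; cases q)
  fix a b c d assume *: "p = Fract a b" "b \<noteq> 0" "q = Fract c d" "d \<noteq> 0"
  have "(pderiv_x j (a * c) * (b * d) - (a * c) * pderiv_x j (b * d)) * (b * b * d * (b * (d * d))) =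
    ((pderiv_x j a * b - a * pderiv_x j b) * c * (b * (d * d)) + a * (pderiv_x j c * d - c * pderiv_x j d) * (b * b * d)) * (b * d * (b * d))"
    unfolding pderiv_x_mult by algebra
  then show ?thesis using * by (simp add: kderiv_Fract eq_fract)
qed

lemma kderiv_0 [simp]: "kderiv j 0 = (0 :: ('a::linorder, 'b::linorder) crat)"
proof -
  have "kderiv j 0 + kderiv j 0 = kderiv j 0 + (0 :: ('a, 'b) crat)"
    using kderiv_add[of j 0 0, symmetric] by (simp only: add_0_right)
  then show ?thesis by (rule add_left_imp_eq)
qed

lemma kderiv_1 [simp]: "kderiv j 1 = (0 :: ('a::linorder, 'b::linorder) crat)"
proof -
  have "kderiv j 1 + kderiv j 1 = kderiv j 1 + (0 :: ('a, 'b) crat)"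
    using kderiv_mult[of j 1 1, symmetric] by (simp only: add_0_right mult_1 mult_1_right)
  then show ?thesis by (rule add_left_imp_eq)
qed

lemma kderiv_uminus: "kderiv j (- p) = - kderiv j p"
  using kderiv_add[of j p "- p"] by (simp add: eq_neg_iff_add_eq_0 add.commute)

lemma kderiv_of_int [simp]: "kderiv j (of_int z) = 0"
proof -
  have "kderiv j (of_nat n) = 0" for n by (induct n) (auto simp: kderiv_add)
  then show ?thesis by (cases z) (simp_all add: kderiv_uminus del: of_nat_Suc)
qed

lemma kderiv_kvar: "kderiv j (kvar v) = (if v = XV j then 1 else 0 :: ('a::linorder, 'b::linorder) crat)"
proof -
  have 1: "pderiv_x j (pvar v) = (if v = XV j then 1 else 0)"
    by (auto simp: pvar_def pderiv_x_single lookup_single when_def)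
  have "pderiv_x j 1 = (0 :: ('a, 'b) cpoly)"
    using pderiv_x_single[of j "0 :: ('a, 'b) hvar \<Rightarrow>\<^sub>0 nat" 1] by simp
  with 1 show ?thesis by (simp add: kvar_def kderiv_Fract One_fract_def Zero_fract_def)
qed

section \<open>The left ideal as a linear span\<close>

lemma lookup_U_scale [simp]: "Poly_Mapping.lookup (U_scale c u) x = c * Poly_Mapping.lookup u x"
  by (simp add: U_scale_def Poly_Mapping.map.rep_eq when_def)

interpretation U: vector_space U_scale
  by unfold_locales (auto intro!: poly_mapping_eqI simp: lookup_add algebra_simps)

lemma U_scale_single [simp]: "U_scale c (Poly_Mapping.single x a) = Poly_Mapping.single x (c * a)"
  by (rule poly_mapping_eqI) (simp add: lookup_single when_def)

lemma lookup_U_Smul: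
  "Poly_Mapping.lookup (U_Smul i e u) (m, k)
    = kshift (\<lambda>i'. e * unitvec i i') (Poly_Mapping.lookup u (\<lambda>i'. m i' - e * unitvec i i', k))"
proof -
  let ?f = "\<lambda>(m, k). kshift (\<lambda>i'. e * unitvec i i') (Poly_Mapping.lookup u (\<lambda>i'. m i' - e * unitvec i i', k))"
  have "finite ((\<lambda>(m, k). (\<lambda>i'. m i' - e * unitvec i i', k)) -` Poly_Mapping.keys u)"
  proof (rule finite_vimageI[OF finite_keys], rule injI, clarsimp)
    fix m m' :: "'a \<Rightarrow> int"
    assume eq: "(\<lambda>i'. m i' - e * unitvec i i') = (\<lambda>i'. m' i' - e * unitvec i i')"
    show "m = m'"
    proof
      fix i' show "m i' = m' i'" using fun_cong[OF eq, of i'] by simp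
    qed
  qed
  then have "finite {x. ?f x \<noteq> 0}"
    by (rule rev_finite_subset) (auto simp: in_keys_iff kshift_simps)
  then show ?thesis unfolding U_Smul_def by (simp add: Abs_poly_mapping_inverse)
qed

lemma lookup_U_Dmul:
  "Poly_Mapping.lookup (U_Dmul j u) (m, k) = kderiv j (Poly_Mapping.lookup u (m, k)) +
      (if k j > 0 then Poly_Mapping.lookup u (m, \<lambda>j'. k j' - unitvec j j') else 0)"
proof -
  let ?f = "\<lambda>(m, k). kderiv j (Poly_Mapping.lookup u (m, k)) +
      (if k j > 0 then Poly_Mapping.lookup u (m, \<lambda>j'. k j' - unitvec j j') else 0)"
  let ?g = "\<lambda>(m, k). (m, \<lambda>j'. k j' + unitvec j j')"
  have "finite (Poly_Mapping.keys u \<union> ?g ` Poly_Mapping.keys u)" by simp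
  moreover have "{x. ?f x \<noteq> 0} \<subseteq> Poly_Mapping.keys u \<union> ?g ` Poly_Mapping.keys u"
  proof
    fix x assume x: "x \<in> {x. ?f x \<noteq> 0}"
    obtain m k where mk: "x = (m, k)" by (cases x)
    show "x \<in> Poly_Mapping.keys u \<union> ?g ` Poly_Mapping.keys u"
    proof (cases "Poly_Mapping.lookup u (m, k) = 0")
      case True
      then have "k j > 0" "Poly_Mapping.lookup u (m, \<lambda>j'. k j' - unitvec j j') \<noteq> 0"
        using x mk by (auto split: if_splits)
      moreover from this have "(m, k) = ?g (m, \<lambda>j'. k j' - unitvec j j')"
        by (auto simp: fun_eq_iff unitvec_def)
      ultimately have "(m, k) \<in> ?g ` Poly_Mapping.keys u"
        by (intro image_eqI[of _ ?g "(m, \<lambda>j'. k j' - unitvec j j')"]) (auto simp: in_keys_iff)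
      then show ?thesis using mk by blast
    qed (auto simp: mk in_keys_iff)
  qed
  ultimately have "finite {x. ?f x \<noteq> 0}" by (rule rev_finite_subset)
  then show ?thesis unfolding U_Dmul_def by (simp add: Abs_poly_mapping_inverse)
qed

lemma U_Smul_add: "U_Smul i e (u + v) = U_Smul i e u + U_Smul i e v"
  by (rule poly_mapping_eqI) (auto simp: lookup_U_Smul lookup_add kshift_simps)

lemma U_Smul_0 [simp]: "U_Smul i e 0 = 0"
  by (rule poly_mapping_eqI) (auto simp: lookup_U_Smul kshift_simps)

lemma U_Smul_diff: "U_Smul i e (u - v) = U_Smul i e u - U_Smul i e v"
  by (rule poly_mapping_eqI) (auto simp: lookup_U_Smul lookup_minus kshift_simps)

lemma U_Smul_sum: "U_Smul i e (sum f S) = (\<Sum>s\<in>S. U_Smul i e (f s))"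
  by (induct S rule: infinite_finite_induct) (auto simp: U_Smul_add)

lemma U_Smul_scale:
  "U_Smul i e (U_scale c u) = U_scale (kshift (\<lambda>i'. e * unitvec i i') c) (U_Smul i e u)"
  by (rule poly_mapping_eqI) (auto simp: lookup_U_Smul kshift_simps)

lemma U_Smul_single:
  "U_Smul i e (Poly_Mapping.single (m, k) c)
    = Poly_Mapping.single (\<lambda>i'. m i' + e * unitvec i i', k) (kshift (\<lambda>i'. e * unitvec i i') c)"
proof (rule poly_mapping_eqI)
  fix x :: "('a \<Rightarrow> int) \<times> ('b \<Rightarrow> nat)"
  obtain m' k' where x: "x = (m', k')" by (cases x)
  have "m = (\<lambda>i'. m' i' - e * unitvec i i') \<longleftrightarrow> (\<lambda>i'. m i' + e * unitvec i i') = m'"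
    by (simp only: fun_eq_iff eq_diff_eq)
  then show "Poly_Mapping.lookup (U_Smul i e (Poly_Mapping.single (m, k) c)) x =
    Poly_Mapping.lookup (Poly_Mapping.single (\<lambda>i'. m i' + e * unitvec i i', k) (kshift (\<lambda>i'. e * unitvec i i') c)) x"
    unfolding x by (simp add: lookup_U_Smul lookup_single when_def kshift_simps)
qed

lemma U_Dmul_add: "U_Dmul j (u + v) = U_Dmul j u + U_Dmul j v"
  by (rule poly_mapping_eqI) (auto simp: lookup_U_Dmul lookup_add kderiv_add)

lemma U_Dmul_0 [simp]: "U_Dmul j 0 = 0"
  by (rule poly_mapping_eqI) (auto simp: lookup_U_Dmul)

lemma U_Dmul_diff: "U_Dmul j (u - v) = U_Dmul j u - U_Dmul j v"
  using U_Dmul_add[of j "u - v" v] by (simp add: algebra_simps)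

lemma U_Dmul_sum: "U_Dmul j (sum f S) = (\<Sum>s\<in>S. U_Dmul j (f s))"
  by (induct S rule: infinite_finite_induct) (auto simp: U_Dmul_add)

lemma U_Dmul_scale: "U_Dmul j (U_scale c u) = U_scale (kderiv j c) u + U_scale c (U_Dmul j u)"
  by (rule poly_mapping_eqI) (auto simp: lookup_U_Dmul lookup_add kderiv_mult algebra_simps)

lemma U_Dmul_single:
  "U_Dmul j (Poly_Mapping.single (m, k) c)
    = Poly_Mapping.single (m, k) (kderiv j c) + Poly_Mapping.single (m, \<lambda>j'. k j' + unitvec j j') c"
proof (rule poly_mapping_eqI)
  fix x :: "('a \<Rightarrow> int) \<times> ('b \<Rightarrow> nat)"
  obtain m' k' where x: "x = (m', k')" by (cases x)
  have "k = (\<lambda>j'. k' j' - unitvec j j') \<and> k' j > 0 \<longleftrightarrow> (\<lambda>j'. k j' + unitvec j j') = k'"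
    by (auto simp: fun_eq_iff unitvec_def)
  then have "(if k' j > 0 then c when (m, k) = (m', \<lambda>j'. k' j' - unitvec j j') else 0)
      = (c when (m, \<lambda>j'. k j' + unitvec j j') = (m', k'))"
    unfolding when_def prod.inject by (metis (mono_tags, lifting))
  then show "Poly_Mapping.lookup (U_Dmul j (Poly_Mapping.single (m, k) c)) x =
    Poly_Mapping.lookup (Poly_Mapping.single (m, k) (kderiv j c) + Poly_Mapping.single (m, \<lambda>j'. k j' + unitvec j j') c) x"
    unfolding x lookup_U_Dmul lookup_single lookup_add
    by (simp only: when_def[of "kderiv j c"] when_def[of c "(m, k) = (m', k')"] if_distrib[of "kderiv j"] kderiv_0)
qed

text \<open>This is S^m \<partial>^k (\<partial>_j - S^(-a_j)). Likewise \<open>euler_rel\<close>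
  below is S^m times the Euler operator in which \<partial>_j has already been replaced by S^(-a_j):
  it contains no derivatives, and s_i becomes s_i + m_i on passing S^m.\<close>

definition box_rel :: "int^('n::{finite,linorder})^('d::{finite,linorder}) \<Rightarrow> ('d \<Rightarrow> int) \<Rightarrow> ('n \<Rightarrow> nat) \<Rightarrow> 'n \<Rightarrow> ('d, 'n) Uop" where
  "box_rel A m k j = Poly_Mapping.single (m, \<lambda>j'. k j' + unitvec j j') 1
     - Poly_Mapping.single (\<lambda>i. m i - A$i$j, k) 1"

definition euler_rel :: "int^('n::{finite,linorder})^('d::{finite,linorder}) \<Rightarrow> ('d \<Rightarrow> int) \<Rightarrow> 'd \<Rightarrow> ('d, 'n) Uop" where
  "euler_rel A m i = (\<Sum>j\<in>UNIV. Poly_Mapping.single (\<lambda>i'. m i' - A$i'$j, \<lambda>_. 0) (of_int (A$i$j) * kvar (XV j)))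
     - Poly_Mapping.single (m, \<lambda>_. 0) (kvar (SV i) + of_int (m i))"

definition rel_gens :: "int^('n::{finite,linorder})^('d::{finite,linorder}) \<Rightarrow> ('d, 'n) Uop set" where
  "rel_gens A = {box_rel A m k j |m k j. True} \<union> {euler_rel A m i |m i. True}"

lemma U_Smul_box_rel: "U_Smul i e (box_rel A m k j) = box_rel A (\<lambda>i'. m i' + e * unitvec i i') k j"
  by (simp add: box_rel_def U_Smul_diff U_Smul_single kshift_simps algebra_simps)

lemma U_Smul_euler_rel: "U_Smul i e (euler_rel A m i') = euler_rel A (\<lambda>i'. m i' + e * unitvec i i') i'"
  by (simp add: euler_rel_def U_Smul_diff U_Smul_single U_Smul_sum kshift_simps kshift_kvar algebra_simps)

lemma U_Dmul_box_rel: "U_Dmul j' (box_rel A m k j) = box_rel A m (\<lambda>l. k l + unitvec j' l) j"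
  by (simp add: box_rel_def U_Dmul_diff U_Dmul_single add_ac)

text \<open>Trading \<partial>_l for S^(-a_l) moves the index to m - a_l at the cost of box
  relations. The extra term a_il S^(m - a_l), from differentiating x_l, is exactly what turns s_i +
  m_i into s_i + m_i - a_il. Hence the generators need no multiples of Euler relations by
  \<partial>^k.\<close>

lemma U_Dmul_euler_rel:
  fixes A :: "int^('n::{finite,linorder})^('d::{finite,linorder})"
  shows "U_Dmul l (euler_rel A m i) = euler_rel A (\<lambda>i'. m i' - A$i'$l) i
     + (\<Sum>j\<in>UNIV. U_scale (of_int (A$i$j) * kvar (XV j)) (box_rel A (\<lambda>i'. m i' - A$i'$j) (\<lambda>_. 0) l))
     - U_scale (kvar (SV i) + of_int (m i)) (box_rel A m (\<lambda>_. 0) l)"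
proof -
  let ?c = "\<lambda>j. of_int (A$i$j) * kvar (XV j) :: ('d, 'n) crat"
  let ?s = "kvar (SV i) + of_int (m i) :: ('d, 'n) crat"
  define X where "X = (\<Sum>j\<in>UNIV. Poly_Mapping.single (\<lambda>i'. m i' - A$i'$j, \<lambda>j'. 0 + unitvec l j' :: nat) (?c j))"
  define Y where "Y = (\<Sum>j\<in>UNIV. Poly_Mapping.single (\<lambda>i'. m i' - A$i'$j - A$i'$l, \<lambda>_::'n. 0::nat) (?c j))"
  define Z where "Z = Poly_Mapping.single (\<lambda>i'. m i' - A$i'$l, \<lambda>_::'n. 0::nat) (of_int (A$i$l) :: ('d, 'n) crat)"
  define P where "P = Poly_Mapping.single (m, \<lambda>j'. 0 + unitvec l j' :: nat) ?s"
  define Q where "Q = Poly_Mapping.single (\<lambda>i'. m i' - A$i'$l, \<lambda>_::'n. 0::nat) ?s"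
  have "kderiv l (?c j) = (if j = l then of_int (A$i$l) else 0)" for j
    by (auto simp: kderiv_mult kderiv_kvar)
  then have "(\<Sum>j\<in>UNIV. Poly_Mapping.single (\<lambda>i'. m i' - A$i'$j, \<lambda>_::'n. 0::nat) (kderiv l (?c j)))
    = (\<Sum>j\<in>UNIV. if j = l then Z else 0)"
    by (intro sum.cong refl) (auto simp: Z_def)
  then have s: "(\<Sum>j\<in>UNIV. Poly_Mapping.single (\<lambda>i'. m i' - A$i'$j, \<lambda>_::'n. 0::nat) (kderiv l (?c j))) = Z"
    by simp
  have "kderiv l ?s = 0" by (simp add: kderiv_add kderiv_kvar)
  then have 1: "U_Dmul l (euler_rel A m i) = Z + X - P"
    unfolding euler_rel_def U_Dmul_diff U_Dmul_sum U_Dmul_single sum.distrib s X_def P_def by simp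
  have 2: "euler_rel A (\<lambda>i'. m i' - A$i'$l) i = Y - (Q - Z)"
  proof -
    have "(\<lambda>i'. m i' - A$i'$l - A$i'$j) = (\<lambda>i'. m i' - A$i'$j - A$i'$l)" for j by (simp add: algebra_simps)
    moreover have "kvar (SV i) + of_int (m i - A$i$l) = ?s - of_int (A$i$l)" by simp
    ultimately show ?thesis
      unfolding euler_rel_def Y_def Q_def Z_def by (simp only: single_diff)
  qed
  have 3: "(\<Sum>j\<in>UNIV. U_scale (?c j) (box_rel A (\<lambda>i'. m i' - A$i'$j) (\<lambda>_. 0) l)) = X - Y"
    unfolding box_rel_def U.scale_right_diff_distrib X_def Y_def sum_subtractf by simp
  have 4: "U_scale ?s (box_rel A m (\<lambda>_. 0) l) = P - Q"
    unfolding box_rel_def U.scale_right_diff_distrib P_def Q_def by simp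
  show ?thesis unfolding 1 2 3 4 by simp
qed

lemma subspace_U_H_A: "U.subspace (U_H_A A)"
  unfolding U.subspace_def U_H_A_def by (auto intro: U_left_ideal.intros)

lemma span_rel_gens_Smul: "u \<in> U.span (rel_gens A) \<Longrightarrow> U_Smul i e u \<in> U.span (rel_gens A)"
proof (induct rule: U.span_induct)
  case base
  show ?case
    by (auto simp: U.subspace_def U_Smul_add U_Smul_scale intro: U.span_add U.span_scale U.span_zero)
next
  case (step x)
  then consider m k j where "x = box_rel A m k j" | m i where "x = euler_rel A m i"
    unfolding rel_gens_def by blast
  then have "U_Smul i e x \<in> rel_gens A"
  proof cases
    case 1
    show ?thesis unfolding 1 U_Smul_box_rel rel_gens_def by blast
  next
    case 2
    show ?thesis unfolding 2 U_Smul_euler_rel rel_gens_def by blast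
  qed
  then show ?case by (rule U.span_base)
qed

lemma span_rel_gens_Dmul: "u \<in> U.span (rel_gens A) \<Longrightarrow> U_Dmul l u \<in> U.span (rel_gens A)"
proof -
  assume "u \<in> U.span (rel_gens A)"
  \<comment> \<open>Membership of u itself is carried along because \<partial>_l (c u) contains the
    term (\<partial>c/\<partial>x_l) u.\<close>
  then have "u \<in> U.span (rel_gens A) \<and> U_Dmul l u \<in> U.span (rel_gens A)"
  proof (induct rule: U.span_induct)
    case base
    then show ?case
      by (auto simp: U.subspace_def U_Dmul_add U_Dmul_scale intro: U.span_add U.span_scale U.span_zero)
  next
    case (step x)
    have box: "box_rel A m k j \<in> U.span (rel_gens A)" and eul: "euler_rel A m i \<in> U.span (rel_gens A)" for m k j i
      by (rule U.span_base; auto simp: rel_gens_def)+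
    consider m k j where "x = box_rel A m k j" | m i where "x = euler_rel A m i"
      using step unfolding rel_gens_def by blast
    then have "U_Dmul l x \<in> U.span (rel_gens A)"
      by cases (auto simp: U_Dmul_box_rel U_Dmul_euler_rel intro!: U.span_add U.span_diff U.span_sum U.span_scale box eul)
    with step show ?case by (simp add: U.span_base)
  qed
  then show ?thesis ..
qed

text \<open>Matches the generation of all S^m from the S_i and their inverses.\<close>

lemma int_vec_induct:
  fixes m :: "'d::finite \<Rightarrow> int"
  assumes zero: "P (\<lambda>_. 0)"
    and step: "\<And>m i e. e \<in> {1, -1} \<Longrightarrow> P m \<Longrightarrow> P (\<lambda>i'. m i' + e * unitvec i i')"
  shows "P m"
proof -
  have upd: "P (m(i := z))" if "P (m(i := 0))" for m i and z :: int
  proof (induct z rule: int_induct[where k = 0])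
    case base show ?case by (fact that)
  next
    case (step1 z)
    have "(\<lambda>i'. (m(i := z)) i' + 1 * unitvec i i') = m(i := z + 1)" by (auto simp: unitvec_def)
    then show ?case using step[of 1 "m(i := z)" i] step1(2) by (simp del: fun_upd_apply)
  next
    case (step2 z)
    have "(\<lambda>i'. (m(i := z)) i' + (-1) * unitvec i i') = m(i := z - 1)" by (auto simp: unitvec_def)
    then show ?case using step[of "-1" "m(i := z)" i] step2(2) by (simp del: fun_upd_apply)
  qed
  have "P (\<lambda>i. if i \<in> S then m i else 0)" if "finite S" for S
    using that
  proof induct
    case empty then show ?case using zero by simp
  next
    case (insert i S)
    let ?m = "\<lambda>i. if i \<in> S then m i else 0"
    have "?m(i := 0) = ?m" using insert by auto
    then have "P (?m(i := m i))" using upd[of ?m i] insert by simp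
    moreover have "?m(i := m i) = (\<lambda>j. if j \<in> insert i S then m j else 0)" by auto
    ultimately show ?case by simp
  qed
  from this[of UNIV] show ?thesis by simp
qed

lemma nat_vec_induct:
  fixes k :: "'n::finite \<Rightarrow> nat"
  assumes zero: "P (\<lambda>_. 0)"
    and step: "\<And>k j. P k \<Longrightarrow> P (\<lambda>j'. k j' + unitvec j j')"
  shows "P k"
proof (induct "sum k UNIV" arbitrary: k)
  case 0
  then have "k = (\<lambda>_. 0)" by auto
  then show ?case using zero by simp
next
  case (Suc n)
  then obtain j where j: "k j > 0" by (metis nat.distinct(1) neq0_conv sum.neutral)
  let ?k = "\<lambda>j'. k j' - unitvec j j'"
  have eq: "k = (\<lambda>j'. ?k j' + unitvec j j')" using j by (auto simp: unitvec_def)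
  have "sum k UNIV = sum ?k UNIV + (\<Sum>j'\<in>UNIV. unitvec j j')" by (subst eq) (simp add: sum.distrib)
  then have "n = sum ?k UNIV" using Suc(2) by (simp add: unitvec_def)
  then have "P ?k" by (rule Suc(1))
  from step[OF this, of j] show ?case using eq by simp
qed

lemma box_rel_in_U_H_A: "box_rel A m k j \<in> U_H_A A"
proof (induct k rule: nat_vec_induct)
  case 1
  show ?case
  proof (induct m rule: int_vec_induct)
    case 1
    have "box_rel A (\<lambda>_. 0) (\<lambda>_. 0) j = box_op A j" by (simp add: box_rel_def box_op_def)
    then show ?case unfolding U_H_A_def by (auto intro!: U_left_ideal.gen simp: H_A_gens_def)
  next
    case (2 m i e)
    then show ?case using U_left_ideal.Smul unfolding U_H_A_def U_Smul_box_rel[symmetric] by blast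
  qed
next
  case (2 k l)
  then show ?case using U_left_ideal.Dmul unfolding U_H_A_def U_Dmul_box_rel[symmetric] by blast
qed

lemma euler_rel_0:
  "euler_rel A (\<lambda>_. 0) i = euler_op A i
     - (\<Sum>j\<in>UNIV. U_scale (of_int (A$i$j) * kvar (XV j)) (box_rel A (\<lambda>_. 0) (\<lambda>_. 0) j))"
  by (simp add: euler_rel_def euler_op_def box_rel_def U.scale_right_diff_distrib sum_subtractf)

lemma euler_rel_in_U_H_A: "euler_rel A m i \<in> U_H_A A"
proof (induct m rule: int_vec_induct)
  case 1
  have "euler_op A i \<in> U_H_A A"
    unfolding U_H_A_def by (auto intro!: U_left_ideal.gen simp: H_A_gens_def)
  then show ?case unfolding euler_rel_0
    by (intro U.subspace_diff[OF subspace_U_H_A] U.subspace_sum[OF subspace_U_H_A]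
        U.subspace_scale[OF subspace_U_H_A] box_rel_in_U_H_A)
next
  case (2 m i e)
  then show ?case using U_left_ideal.Smul unfolding U_H_A_def U_Smul_euler_rel[symmetric] by blast
qed

text \<open>The span is stable under S_i and \<partial>_l, although these act only semilinearly and
  by the Leibniz rule. From here on the ideal is a plain K-subspace with explicit generators, and
  functionals on the quotient can be tested on generators.\<close>

theorem U_H_A_eq_span: "U_H_A A = U.span (rel_gens A)"
proof
  show "U.span (rel_gens A) \<subseteq> U_H_A A"
    by (rule U.span_minimal[OF _ subspace_U_H_A])
       (auto simp: rel_gens_def box_rel_in_U_H_A euler_rel_in_U_H_A)
  have box: "box_rel A m k j \<in> U.span (rel_gens A)" and eul: "euler_rel A m i \<in> U.span (rel_gens A)" for m k j i
    by (rule U.span_base; auto simp: rel_gens_def)+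
  show "U_H_A A \<subseteq> U.span (rel_gens A)"
  proof
    fix u assume "u \<in> U_H_A A"
    then show "u \<in> U.span (rel_gens A)" unfolding U_H_A_def
    proof induct
      case (gen g)
      have "box_op A j = box_rel A (\<lambda>_. 0) (\<lambda>_. 0) j" for j by (simp add: box_rel_def box_op_def)
      moreover have "euler_op A i = euler_rel A (\<lambda>_. 0) i
        + (\<Sum>j\<in>UNIV. U_scale (of_int (A$i$j) * kvar (XV j)) (box_rel A (\<lambda>_. 0) (\<lambda>_. 0) j))" for i
        by (simp add: euler_rel_0)
      ultimately show ?case using gen unfolding H_A_gens_def
        by (auto intro!: U.span_add U.span_sum U.span_scale box eul)
    qed (auto intro: U.span_zero U.span_add U.span_scale span_rel_gens_Smul span_rel_gens_Dmul)
  qed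
qed

text \<open>The recurrence dual to \<open>euler_rel\<close>, with index m standing for S^(-m). The
  field map \<iota> is a parameter: it is the identity for functionals with values in K and the
  weight embedding for series solutions.\<close>

definition is_solution ::
  "int^('n::{finite,linorder})^('d::{finite,linorder}) \<Rightarrow> (('d, 'n) crat \<Rightarrow> 'f::field) \<Rightarrow> (('d \<Rightarrow> int) \<Rightarrow> 'f) \<Rightarrow> bool" where
  "is_solution A \<iota> \<phi> \<longleftrightarrow> (\<forall>i m. (\<Sum>j\<in>UNIV. of_int (A$i$j) * \<iota> (kvar (XV j)) * \<phi> (\<lambda>i'. m i' + A$i'$j))
      = (\<iota> (kvar (SV i)) - of_int (m i)) * \<phi> m)"

text \<open>The monomial y^m with y = S^(-1). With this sign, \<partial>_j acts on indices by adding
  the column a_j.\<close>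

definition monom_op :: "('d \<Rightarrow> int) \<Rightarrow> ('d::linorder, 'n::linorder) Uop" where
  "monom_op m = Poly_Mapping.single (\<lambda>i. - m i, \<lambda>_. 0) 1"

lemma col_sum_unitvec:
  "(\<Sum>j\<in>UNIV. A$i$j * int (k j + unitvec l j)) = (\<Sum>j\<in>UNIV. A$i$j * int (k j)) + A$i$(l::'n::finite)"
proof -
  have "(\<Sum>j\<in>UNIV. A$i$j * int (k j + unitvec l j)) = (\<Sum>j\<in>UNIV. A$i$j * int (k j) + (if j = l then A$i$l else 0))"
    by (intro sum.cong refl) (auto simp: unitvec_def algebra_simps)
  then show ?thesis by (simp add: sum.distrib)
qed

text \<open>The \<iota>-semilinear extension of \<phi> to U. Modulo box relations S^m \<partial>^k
  equals S^(m - A k), hence the argument A k - m.\<close>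

definition pairing ::
  "int^('n::{finite,linorder})^('d::{finite,linorder}) \<Rightarrow> (('d, 'n) crat \<Rightarrow> 'f::field) \<Rightarrow> (('d \<Rightarrow> int) \<Rightarrow> 'f) \<Rightarrow> ('d, 'n) Uop \<Rightarrow> 'f" where
  "pairing A \<iota> \<phi> u = (\<Sum>x\<in>Poly_Mapping.keys u. \<iota> (Poly_Mapping.lookup u x)
      * \<phi> (\<lambda>i. (\<Sum>j\<in>UNIV. A$i$j * int (snd x j)) - fst x i))"

context
  fixes A :: "int^('n::{finite,linorder})^('d::{finite,linorder})"
    and \<iota> :: "('d, 'n) crat \<Rightarrow> 'f::field"
  assumes \<iota>: "ring_map \<iota>"
begin

unbundle no Formal_Power_Series.fps_syntax

lemma pairing_add: "pairing A \<iota> \<phi> (u + v) = pairing A \<iota> \<phi> u + pairing A \<iota> \<phi> v"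
  unfolding pairing_def
  by (rule setsum_keys_plus_distrib) (auto simp: ring_map_simps[OF \<iota>] algebra_simps)

lemma pairing_single:
  "pairing A \<iota> \<phi> (Poly_Mapping.single (m, k) c) = \<iota> c * \<phi> (\<lambda>i. (\<Sum>j\<in>UNIV. A$i$j * int (k j)) - m i)"
  by (cases "c = 0") (auto simp: pairing_def ring_map_simps[OF \<iota>])

lemma pairing_0 [simp]: "pairing A \<iota> \<phi> 0 = 0"
  by (simp add: pairing_def)

lemma pairing_scale: "pairing A \<iota> \<phi> (U_scale c u) = \<iota> c * pairing A \<iota> \<phi> u"
proof (cases "c = 0")
  case False
  then have "Poly_Mapping.keys (U_scale c u) = Poly_Mapping.keys u" by (auto simp: in_keys_iff)
  then show ?thesis by (simp add: pairing_def sum_distrib_left ring_map_simps[OF \<iota>] mult_ac)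
qed (simp add: ring_map_simps[OF \<iota>])

lemma pairing_sum: "pairing A \<iota> \<phi> (sum f S) = (\<Sum>s\<in>S. pairing A \<iota> \<phi> (f s))"
  by (induct S rule: infinite_finite_induct) (auto simp: pairing_add)

lemma pairing_diff: "pairing A \<iota> \<phi> (u - v) = pairing A \<iota> \<phi> u - pairing A \<iota> \<phi> v"
  using pairing_add[of \<phi> "u - v" v] by simp

lemma pairing_monom_op: "pairing A \<iota> \<phi> (monom_op m) = \<phi> m"
  by (simp add: monom_op_def pairing_single ring_map_simps[OF \<iota>])

lemma pairing_U_H_A:
  assumes sol: "is_solution A \<iota> \<phi>" and u: "u \<in> U_H_A A"
  shows "pairing A \<iota> \<phi> u = 0"
  using u unfolding U_H_A_eq_span
proof (induct rule: U.span_induct)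
  case base
  show ?case by (auto simp: U.subspace_def pairing_add pairing_scale)
next
  case (step x)
  have "pairing A \<iota> \<phi> (box_rel A m k j) = 0" for m k j
  proof -
    have "(\<lambda>i. (\<Sum>j'\<in>UNIV. A$i$j' * int (k j' + unitvec j j')) - m i)
      = (\<lambda>i. (\<Sum>j'\<in>UNIV. A$i$j' * int (k j')) - (m i - A$i$j))"
      by (simp only: col_sum_unitvec) (simp add: algebra_simps)
    then show ?thesis
      unfolding box_rel_def pairing_diff pairing_single by simp
  qed
  \<comment> \<open>The recurrence is taken at -m, since \<open>euler_rel A m i\<close> is built
    around S^m.\<close>
  moreover have "pairing A \<iota> \<phi> (euler_rel A m i) = 0" for m i
    using sol unfolding is_solution_def
    by (auto dest!: spec[of _ i] spec[of _ "\<lambda>i. - m i"]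
        simp: euler_rel_def pairing_diff pairing_sum pairing_single ring_map_simps[OF \<iota>] algebra_simps)
  ultimately show ?case using step by (auto simp: rel_gens_def)
qed

end

text \<open>K as a vector space over itself, so that extension of linear maps provides functionals
  on U.\<close>

interpretation UK: vector_space_pair U_scale "(*) :: ('d::linorder, 'n::linorder) crat \<Rightarrow> _ \<Rightarrow> _"
  by unfold_locales (auto simp: algebra_simps)

lemma single_eq_monom_op_mod_U_H_A:
  "Poly_Mapping.single (m, k) 1 - monom_op (\<lambda>i. (\<Sum>j\<in>UNIV. A$i$j * int (k j)) - m i) \<in> U_H_A A"
proof (induct k arbitrary: m rule: nat_vec_induct)
  case 1
  then show ?case using U.subspace_0[OF subspace_U_H_A] by (simp add: monom_op_def)
next
  case (2 k l)
  have "Poly_Mapping.single (m, \<lambda>j'. k j' + unitvec l j') 1 - monom_op (\<lambda>i. (\<Sum>j\<in>UNIV. A$i$j * int (k j + unitvec l j)) - m i)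
    = box_rel A m k l + (Poly_Mapping.single (\<lambda>i. m i - A$i$l, k) 1 - monom_op (\<lambda>i. (\<Sum>j\<in>UNIV. A$i$j * int (k j)) - (m i - A$i$l)))"
  proof -
    have "(\<lambda>i. (\<Sum>j\<in>UNIV. A$i$j * int (k j + unitvec l j)) - m i)
      = (\<lambda>i. (\<Sum>j\<in>UNIV. A$i$j * int (k j)) - (m i - A$i$l))"
      by (simp only: col_sum_unitvec) (simp add: algebra_simps)
    then show ?thesis unfolding box_rel_def by simp
  qed
  then show ?case
    using U.subspace_add[OF subspace_U_H_A box_rel_in_U_H_A 2[of "\<lambda>i. m i - A$i$l"]] by simp
qed

section \<open>Spanning sets of the quotient through linear functionals\<close>

lemma linear_functional_separating:
  fixes S :: "('d::linorder, 'n::linorder) Uop set"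
  assumes S: "U.subspace S" and u0: "u0 \<notin> S"
  obtains f :: "('d, 'n) Uop \<Rightarrow> ('d, 'n) crat"
  where "Vector_Spaces.linear U_scale (*) f" "\<And>s. s \<in> S \<Longrightarrow> f s = 0" "f u0 = 1"
proof -
  obtain B where B: "B \<subseteq> S" "U.independent B" "S \<subseteq> U.span B"
    by (rule U.maximal_independent_subset)
  have "U.span B \<subseteq> S" by (rule U.span_minimal[OF B(1) S])
  then have u0B: "u0 \<notin> U.span B" using u0 by blast
  then have "U.independent (insert u0 B)" using B(2) by (rule U.independent_insertI)
  from UK.linear_independent_extend[OF this, of "\<lambda>x. if x = u0 then 1 else 0"]
  obtain g :: "('d, 'n) Uop \<Rightarrow> ('d, 'n) crat" where g: "Vector_Spaces.linear U_scale (*) g"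
    "\<forall>x\<in>insert u0 B. g x = (if x = u0 then 1 else 0)" by blast
  have "g s = 0" if "s \<in> S" for s
  proof (rule UK.linear_eq_0_on_span[OF g(1)])
    show "s \<in> U.span B" using B(3) that by blast
    show "g x = 0" if "x \<in> B" for x using g(2) that u0B U.span_base by auto
  qed
  then show thesis using that[OF g(1)] g(2) by auto
qed

lemma single_eq_scale_monom_op:
  "Poly_Mapping.single (m, \<lambda>_. 0) c = U_scale c (monom_op (\<lambda>i. - m i))"
  by (simp add: monom_op_def)

text \<open>By duality: if the span were proper, a functional would vanish on it but not at u. Its
  values on monomials form a solution vanishing on \<open>B\<close>, so it kills every monomial and
  with them all of U. No finiteness of the quotient is presupposed.\<close>

lemma span_monom_op_eq_UNIV:
  assumes nosol: "\<And>\<phi>. is_solution A (\<lambda>x. x) \<phi> \<Longrightarrow> (\<And>b. b \<in> B \<Longrightarrow> \<phi> b = 0) \<Longrightarrow> \<phi> = (\<lambda>_. 0)"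
  shows "u \<in> U.span (U_H_A A \<union> monom_op ` B)"
proof (rule ccontr)
  let ?S = "U.span (U_H_A A \<union> monom_op ` B)"
  assume "u \<notin> ?S"
  then obtain f where f: "Vector_Spaces.linear U_scale (*) f" "\<And>s. s \<in> ?S \<Longrightarrow> f s = 0" "f u = 1"
    using linear_functional_separating[OF U.subspace_span] by blast
  interpret f: Vector_Spaces.linear U_scale "(*)" f by (fact f(1))
  define \<phi> where "\<phi> m = f (monom_op m)" for m
  have "is_solution A (\<lambda>x. x) \<phi>"
    unfolding is_solution_def
  proof (intro allI)
    fix i m
    have "f (euler_rel A (\<lambda>i. - m i) i) = 0"
      by (intro f(2) U.span_base UnI1 euler_rel_in_U_H_A)
    then show "(\<Sum>j\<in>UNIV. of_int (A$i$j) * kvar (XV j) * \<phi> (\<lambda>i'. m i' + A$i'$j)) = (kvar (SV i) - of_int (m i)) * \<phi> m"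
      by (simp add: euler_rel_def f.diff f.sum single_eq_scale_monom_op f.scale \<phi>_def add.commute)
  qed
  moreover have "\<phi> b = 0" if "b \<in> B" for b
    unfolding \<phi>_def using that by (intro f(2) U.span_base) auto
  ultimately have \<phi>0: "\<phi> = (\<lambda>_. 0)" by (rule nosol)
  have single0: "f (Poly_Mapping.single x 1) = 0" for x
  proof -
    obtain m k where x: "x = (m, k)" by (cases x)
    have "f (Poly_Mapping.single (m, k) 1 - monom_op (\<lambda>i. (\<Sum>j\<in>UNIV. A$i$j * int (k j)) - m i)) = 0"
      by (intro f(2) U.span_base UnI1 single_eq_monom_op_mod_U_H_A)
    then show ?thesis using fun_cong[OF \<phi>0] by (simp add: x f.diff \<phi>_def)
  qed
  have "u = (\<Sum>x\<in>Poly_Mapping.keys u. U_scale (Poly_Mapping.lookup u x) (Poly_Mapping.single x 1))"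
    by (subst poly_mapping_sum_singles) simp
  then have "f u = (\<Sum>x\<in>Poly_Mapping.keys u. Poly_Mapping.lookup u x * f (Poly_Mapping.single x 1))"
    by (metis (no_types, lifting) f.sum f.scale sum.cong)
  then show False using f(3) single0 by simp
qed

lemma inj_monom_op: "inj monom_op"
proof (rule injI)
  fix m m' :: "'a \<Rightarrow> int" assume "monom_op m = (monom_op m' :: ('a, 'b) Uop)"
  then have "Poly_Mapping.lookup (monom_op m :: ('a, 'b) Uop) (\<lambda>i. - m i, \<lambda>_. 0) = Poly_Mapping.lookup (monom_op m') (\<lambda>i. - m i, \<lambda>_. 0)"
    by simp
  then show "m = m'" by (auto simp: monom_op_def lookup_single when_def fun_eq_iff split: if_splits)
qed

lemma quot_dim_eqI:
  fixes A :: "int^('n::{finite,linorder})^('d::{finite,linorder})"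
  assumes fin: "finite B"
    and span: "\<And>u. u \<in> U.span (U_H_A A \<union> monom_op ` B)"
    and indep: "\<And>c b. (\<Sum>b\<in>B. U_scale (c b) (monom_op b)) \<in> U_H_A A \<Longrightarrow> b \<in> B \<Longrightarrow> c b = 0"
  shows "quot_dim_eq (U_H_A A) (card B)"
proof -
  obtain e where e: "bij_betw e {..<card B} B"
    using ex_bij_betw_nat_finite[OF fin] by (auto simp: lessThan_atLeast0)
  let ?e' = "the_inv_into {..<card B} e"
  have e': "?e' (e t) = t" if "t < card B" for t
    using e that by (simp add: bij_betw_def the_inv_into_f_f)
  have reindex: "(\<Sum>t<card B. U_scale (c t) (monom_op (e t))) = (\<Sum>b\<in>B. U_scale (c (?e' b)) (monom_op b))"
    for c :: "nat \<Rightarrow> ('d, 'n) crat"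
    by (subst sum.reindex_bij_betw[OF e, symmetric]) (intro sum.cong refl, simp add: e')
  show ?thesis unfolding quot_dim_eq_def
  proof (intro exI[of _ "\<lambda>t. monom_op (e t)"] conjI allI impI)
    fix u :: "('d, 'n) Uop"
    from span[of u] obtain w y where wy: "u = w + y" "w \<in> U.span (U_H_A A)" "y \<in> U.span (monom_op ` B)"
      by (auto simp: U.span_Un)
    have "w \<in> U_H_A A" using wy(2) U.span_minimal[OF subset_refl subspace_U_H_A] by blast
    moreover obtain g where "y = (\<Sum>v\<in>monom_op ` B. U_scale (g v) v)"
      using wy(3) fin by (auto simp: U.span_finite)
    then have "y = (\<Sum>b\<in>B. U_scale (g (monom_op b)) (monom_op b))"
      by (simp add: sum.reindex inj_on_subset[OF inj_monom_op])
    moreover have "(\<Sum>b\<in>B. U_scale (g (monom_op b)) (monom_op b)) = (\<Sum>t<card B. U_scale (g (monom_op (e t))) (monom_op (e t)))"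
      by (rule sum.reindex_bij_betw[OF e, symmetric])
    ultimately have "u - (\<Sum>t<card B. U_scale (g (monom_op (e t))) (monom_op (e t))) \<in> U_H_A A"
      using wy(1) by simp
    then show "\<exists>c. u - (\<Sum>t<card B. U_scale (c t) (monom_op (e t))) \<in> U_H_A A"
      by (intro exI[of _ "\<lambda>t. g (monom_op (e t))"])
  next
    fix c :: "nat \<Rightarrow> ('d, 'n) crat" and t
    assume "(\<Sum>t<card B. U_scale (c t) (monom_op (e t))) \<in> U_H_A A" "t < card B"
    then have "c (?e' (e t)) = 0"
      unfolding reindex using e by (intro indep) (auto simp: bij_betw_def)
    then show "c t = 0" using e' \<open>t < card B\<close> by simp
  qed
qed

section \<open>A weight valuation on rational functions\<close>

text \<open>The Laurent monomial c t^e; \<open>fls_shift\<close> lowers exponents, hence the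
  sign.\<close>

definition tmon :: "'a::field \<Rightarrow> int \<Rightarrow> 'a fls" where
  "tmon c e = fls_shift (- e) (fls_const c)"

lemma tmon_mult: "tmon c e * tmon d f = tmon (c * d) (e + f)"
  by (simp add: tmon_def fls_times_both_shifted_simp fls_const_mult_const)

lemma nth_tmon: "fls_nth (tmon c e) n = (if n = e then c else 0)"
  by (simp add: tmon_def fls_const_def)

lemma tmon_eq_0_iff [simp]: "tmon c e = 0 \<longleftrightarrow> c = 0"
  by (auto simp: fls_eq_iff nth_tmon)

lemma subdegree_tmon: "c \<noteq> 0 \<Longrightarrow> fls_subdegree (tmon c e) = e"
  by (simp add: tmon_def)

lemma nth_tmon_times: "fls_nth (tmon c e * f) n = c * fls_nth f (n - e)"
proof -
  have "tmon c e * f = fls_shift (- e) (fls_const c * f)"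
    by (simp add: tmon_def fls_shifted_times_simps)
  then show ?thesis by simp
qed

lemma tmon_0: "tmon c 0 = fls_const c"
  by (simp add: tmon_def)

lemma tmon_prod: "(\<Prod>v\<in>S. tmon (c v) (e v)) = tmon (prod c S) (sum e S)"
  by (induct S rule: infinite_finite_induct) (auto simp: tmon_mult tmon_0)

lemma tmon_power: "tmon c e ^ n = tmon (c ^ n) (int n * e)"
  by (induct n) (auto simp: tmon_mult tmon_0 algebra_simps)

lemma ring_map_tmon_0: "ring_map (\<lambda>c. tmon c 0)"
  by (simp add: ring_map_def tmon_0 fls_plus_const fls_const_mult_const)

fun hwt :: "('n \<Rightarrow> int) \<Rightarrow> ('d, 'n) hvar \<Rightarrow> int" where
  "hwt \<omega> (SV i) = 0"
| "hwt \<omega> (XV j) = \<omega> j"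

text \<open>Substitutes x_j t^(\<omega>_j) for x_j and fixes s. Keeping x_j in the coefficient stops
  distinct monomials of equal weight from cancelling.\<close>

definition weight_embedding_poly :: "('n \<Rightarrow> int) \<Rightarrow> ('d::linorder, 'n::linorder) cpoly \<Rightarrow> ('d, 'n) crat fls" where
  "weight_embedding_poly \<omega> = poly_eval (\<lambda>c. tmon (kconst c) 0) (\<lambda>v. tmon (kvar v) (hwt \<omega> v))"

definition weight_embedding :: "('n \<Rightarrow> int) \<Rightarrow> ('d::linorder, 'n::linorder) crat \<Rightarrow> ('d, 'n) crat fls" where
  "weight_embedding \<omega> = fract_lift (weight_embedding_poly \<omega>)"

lemma ring_map_weight_embedding_poly: "ring_map (weight_embedding_poly \<omega>)"
  unfolding weight_embedding_poly_def
  by (intro ring_map_poly_eval ring_map_comp[OF ring_map_tmon_0] ring_map_kconst)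

lemma prod_kvar_powers:
  "(\<Prod>v\<in>Poly_Mapping.keys \<mu>. kvar v ^ Poly_Mapping.lookup \<mu> v) = Fract (Poly_Mapping.single \<mu> 1) 1"
proof -
  have "(\<Prod>v\<in>Poly_Mapping.keys \<mu>. kvar v ^ Poly_Mapping.lookup \<mu> v) = Fract (monom_eval pvar \<mu>) 1"
    unfolding monom_eval_def kvar_def by (simp add: ring_map_simps[OF ring_map_Fract])
  then show ?thesis by (simp add: monom_eval_pvar)
qed

text \<open>The coefficient of t^e is the part of p of weight e, viewed in K. Taking e to be the
  weight of a monomial of p keeps that monomial visible.\<close>

lemma weight_embedding_poly_eq_0:
  fixes p :: "('d::linorder, 'n::linorder) cpoly"
  assumes "weight_embedding_poly \<omega> p = 0"
  shows "p = 0"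
proof (rule ccontr)
  assume "p \<noteq> 0"
  then obtain \<mu>0 where \<mu>0: "\<mu>0 \<in> Poly_Mapping.keys p" by fastforce
  define wt where "wt \<mu> = (\<Sum>v\<in>Poly_Mapping.keys \<mu>. int (Poly_Mapping.lookup \<mu> v) * hwt \<omega> v)" for \<mu> :: "('d, 'n) hvar \<Rightarrow>\<^sub>0 nat"
  have term_eq: "tmon (kconst c) 0 * monom_eval (\<lambda>v. tmon (kvar v) (hwt \<omega> v)) \<mu>
      = tmon (Fract (Poly_Mapping.single \<mu> c) 1) (wt \<mu>)" for c and \<mu> :: "('d, 'n) hvar \<Rightarrow>\<^sub>0 nat"
    by (simp add: monom_eval_def tmon_power tmon_prod tmon_mult prod_kvar_powers kconst_def mult_single wt_def)
  let ?K = "{\<mu> \<in> Poly_Mapping.keys p. wt \<mu> = wt \<mu>0}"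
  have "0 = fls_nth (weight_embedding_poly \<omega> p) (wt \<mu>0)" using assms by simp
  also have "\<dots> = (\<Sum>\<mu>\<in>Poly_Mapping.keys p. if wt \<mu>0 = wt \<mu> then Fract (Poly_Mapping.single \<mu> (Poly_Mapping.lookup p \<mu>)) 1 else 0)"
    by (simp add: weight_embedding_poly_def poly_eval_def term_eq fls_nth_sum nth_tmon)
  also have "\<dots> = (\<Sum>\<mu>\<in>?K. Fract (Poly_Mapping.single \<mu> (Poly_Mapping.lookup p \<mu>)) 1)"
    by (intro sum.mono_neutral_cong_right) auto
  also have "\<dots> = Fract (\<Sum>\<mu>\<in>?K. Poly_Mapping.single \<mu> (Poly_Mapping.lookup p \<mu>)) 1"
    by (simp add: ring_map_simps(7)[OF ring_map_Fract])
  finally have "(\<Sum>\<mu>\<in>?K. Poly_Mapping.single \<mu> (Poly_Mapping.lookup p \<mu>)) = 0"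
    by (simp add: Zero_fract_def eq_fract)
  then have "Poly_Mapping.lookup (\<Sum>\<mu>\<in>?K. Poly_Mapping.single \<mu> (Poly_Mapping.lookup p \<mu>)) \<mu>0 = 0" by simp
  then have "Poly_Mapping.lookup p \<mu>0 = 0"
    using \<mu>0 by (simp add: lookup_sum lookup_single when_def)
  with \<mu>0 show False by (simp add: in_keys_iff)
qed

lemma ring_map_weight_embedding: "ring_map (weight_embedding \<omega>)"
  unfolding weight_embedding_def
  by (intro ring_map_fract_lift ring_map_weight_embedding_poly weight_embedding_poly_eq_0)

lemma weight_embedding_Fract_1: "weight_embedding \<omega> (Fract a 1) = weight_embedding_poly \<omega> a"
  unfolding weight_embedding_def
  by (intro fract_lift_Fract_1 ring_map_weight_embedding_poly weight_embedding_poly_eq_0)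

lemma weight_embedding_kvar: "weight_embedding \<omega> (kvar v) = tmon (kvar v) (hwt \<omega> v)"
  unfolding kvar_def[of v] weight_embedding_Fract_1 weight_embedding_poly_def
  by (subst poly_eval_pvar) (auto intro: ring_map_comp[OF ring_map_tmon_0] ring_map_kconst simp: kvar_def)

lemma weight_embedding_kconst: "weight_embedding \<omega> (kconst c) = tmon (kconst c) 0"
  unfolding kconst_def[of c] weight_embedding_Fract_1 weight_embedding_poly_def
  by (subst poly_eval_const[OF ring_map_comp[OF ring_map_tmon_0 ring_map_kconst]]) (simp add: kconst_def)

lemma ring_map_inject:
  assumes "ring_map (h :: 'a::field \<Rightarrow> 'b::field)"
  shows "h a = 0 \<longleftrightarrow> a = 0"
  by (metis assms mult_eq_0_iff right_inverse ring_map_simps(1,2,4) zero_neq_one)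

lemma kvar_nonzero [simp]: "kvar v \<noteq> 0"
proof
  assume "kvar v = 0"
  then have "Poly_Mapping.lookup (pvar v) (Poly_Mapping.single v 1) = 0"
    by (simp add: kvar_def Zero_fract_def eq_fract)
  then show False by (simp add: pvar_def)
qed

text \<open>Coordinate functionals of a cone are real vectors, so equations with integer
  coefficients get combined with real scalars.\<close>

definition rconst :: "real \<Rightarrow> ('d::linorder, 'n::linorder) crat" where
  "rconst r = kconst (complex_of_real r)"

lemma rconst_simps:
  "rconst 0 = 0" "rconst 1 = 1" "rconst (a + b) = rconst a + rconst b" "rconst (a * b) = rconst a * rconst b"
  "rconst (a - b) = rconst a - rconst b" "rconst (- a) = - rconst a" "rconst (sum f S) = (\<Sum>s\<in>S. rconst (f s))"
  "rconst (of_int z) = of_int z"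
  by (simp_all add: rconst_def ring_map_simps[OF ring_map_kconst])

lemma rconst_eq_0_iff [simp]: "(rconst a :: ('b::linorder, 'c::linorder) crat) = 0 \<longleftrightarrow> a = 0"
proof
  assume "(rconst a :: ('b, 'c) crat) = 0"
  then have "Poly_Mapping.lookup (Poly_Mapping.single (0 :: ('b, 'c) hvar \<Rightarrow>\<^sub>0 nat) (complex_of_real a)) 0 = 0"
    by (simp add: rconst_def kconst_def Zero_fract_def eq_fract)
  then show "a = 0" by (simp only: lookup_single_eq of_real_eq_0_iff)
qed (simp add: rconst_simps)

definition slin :: "('d::{finite,linorder} \<Rightarrow> real) \<Rightarrow> ('d, 'n::linorder) crat" where
  "slin l = (\<Sum>i\<in>UNIV. rconst (l i) * kvar (SV i))"

text \<open>The s_i are independent variables: the coefficient of the monomial s_i0 is read off.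
  This non-resonance makes division by such forms legitimate at every lattice point.\<close>

lemma slin_plus_const_nonzero:
  fixes l :: "'d::{finite,linorder} \<Rightarrow> real"
  assumes "l i0 \<noteq> 0"
  shows "slin l + rconst r \<noteq> (0 :: ('d, 'n::linorder) crat)"
proof
  assume eq: "slin l + rconst r = (0 :: ('d, 'n) crat)"
  let ?p = "(\<Sum>i\<in>UNIV. Poly_Mapping.single 0 (complex_of_real (l i)) * pvar (SV i)) + Poly_Mapping.single 0 (complex_of_real r) :: ('d, 'n) cpoly"
  have "slin l + rconst r = Fract ?p 1"
    by (simp add: slin_def rconst_def kconst_def kvar_def ring_map_simps(3,7)[OF ring_map_Fract])
  then have "?p = 0" using eq by (simp add: Zero_fract_def eq_fract)
  then have "Poly_Mapping.lookup ?p (Poly_Mapping.single (SV i0) 1) = 0" by simp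
  moreover have "Poly_Mapping.single (SV i0) (1::nat) \<noteq> (0 :: ('d, 'n) hvar \<Rightarrow>\<^sub>0 nat)"
    by (metis lookup_single_eq lookup_zero one_neq_zero)
  moreover have "Poly_Mapping.single (SV i) (1::nat) = (Poly_Mapping.single (SV i0) 1 :: ('d, 'n) hvar \<Rightarrow>\<^sub>0 nat) \<longleftrightarrow> i = i0" for i :: 'd
    by (metis hvar.inject(1) lookup_single_eq lookup_single_not_eq zero_neq_one)
  ultimately show False
    using assms by (simp add: lookup_add lookup_sum pvar_def mult_single lookup_single when_def del: One_nat_def)
qed

text \<open>Ultrametric inequality: the leading coefficient of the sum comes from at least one
  summand, whose order is then no larger.\<close>

lemma fls_sum_nonzero_term:
  assumes "finite S" "sum f S = g" "g \<noteq> (0 :: 'a::field fls)"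
  obtains s where "s \<in> S" "f s \<noteq> 0" "fls_subdegree (f s) \<le> fls_subdegree g"
proof -
  have "(\<Sum>s\<in>S. fls_nth (f s) (fls_subdegree g)) \<noteq> 0"
    using assms by (simp flip: fls_nth_sum)
  then obtain s where "s \<in> S" "fls_nth (f s) (fls_subdegree g) \<noteq> 0" by (meson sum.neutral)
  then show thesis using that by (metis fls_nonzeroI fls_subdegree_leI)
qed

section \<open>Cones over bases and dual feasibility\<close>

text \<open>A simplicial cone is indexed by a function \<sigma> from coordinates to columns rather
  than by a set, so that coefficient vectors lie in the ambient space and \<open>cmap\<close> is an
  endomorphism.\<close>

definition cmap :: "('n \<Rightarrow> real^'d) \<Rightarrow> ('d::finite \<Rightarrow> 'n) \<Rightarrow> real^'d \<Rightarrow> real^'d" where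
  "cmap a \<sigma> c = (\<Sum>i\<in>UNIV. c$i *\<^sub>R a (\<sigma> i))"

definition is_basis :: "('n \<Rightarrow> real^'d) \<Rightarrow> ('d::finite \<Rightarrow> 'n) \<Rightarrow> bool" where
  "is_basis a \<sigma> \<longleftrightarrow> surj (cmap a \<sigma>)"

definition coords :: "('n \<Rightarrow> real^'d) \<Rightarrow> ('d::finite \<Rightarrow> 'n) \<Rightarrow> real^'d \<Rightarrow> real^'d" where
  "coords a \<sigma> = inv (cmap a \<sigma>)"

text \<open>For a basis, the linear function interpolating \<omega> on the columns of \<sigma>;
  constant weight 1 gives the function that is 1 on the hyperplane through these columns.\<close>

definition height :: "('n \<Rightarrow> real^'d) \<Rightarrow> ('n \<Rightarrow> real) \<Rightarrow> ('d::finite \<Rightarrow> 'n) \<Rightarrow> real^'d \<Rightarrow> real" where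
  "height a \<omega> \<sigma> w = (\<Sum>i\<in>UNIV. \<omega> (\<sigma> i) * coords a \<sigma> w $ i)"

definition in_cone :: "('n \<Rightarrow> real^'d) \<Rightarrow> ('d::finite \<Rightarrow> 'n) \<Rightarrow> real^'d \<Rightarrow> bool" where
  "in_cone a \<sigma> w \<longleftrightarrow> is_basis a \<sigma> \<and> (\<forall>i. coords a \<sigma> w $ i > 0)"

text \<open>Quantifying over arbitrary \<sigma>, degenerate ones included, puts w off every subspace
  spanned by fewer than d columns.\<close>

definition generic_point :: "('n \<Rightarrow> real^'d) \<Rightarrow> real^'d::finite \<Rightarrow> bool" where
  "generic_point a w \<longleftrightarrow> (\<forall>\<sigma> c. cmap a \<sigma> c = w \<longrightarrow> is_basis a \<sigma> \<and> (\<forall>i. c$i \<noteq> 0))"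

text \<open>Nondegeneracy of the lifting by \<omega>, together with closeness to a constant: a
  column lifted strictly above the linear function of \<sigma> must not lie beyond the hyperplane
  through the columns of \<sigma>, seen from the origin.\<close>

definition generic_weight :: "('n \<Rightarrow> real^'d::finite) \<Rightarrow> ('n \<Rightarrow> real) \<Rightarrow> bool" where
  "generic_weight a \<omega> \<longleftrightarrow> (\<forall>j. \<omega> j > 0) \<and>
     (\<forall>\<sigma> k. is_basis a \<sigma> \<longrightarrow> k \<notin> range \<sigma> \<longrightarrow> height a \<omega> \<sigma> (a k) \<noteq> \<omega> k \<and>
        (height a \<omega> \<sigma> (a k) < \<omega> k \<longrightarrow> height a (\<lambda>_. 1) \<sigma> (a k) \<le> 1))"

text \<open>A lower facet of the configuration lifted by \<omega>; in linear programming terms, a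
  basis with positive reduced cost at all other columns.\<close>

definition feasible :: "('n \<Rightarrow> real^'d) \<Rightarrow> ('n \<Rightarrow> real) \<Rightarrow> ('d::finite \<Rightarrow> 'n) \<Rightarrow> bool" where
  "feasible a \<omega> \<sigma> \<longleftrightarrow> is_basis a \<sigma> \<and> (\<forall>k. k \<notin> range \<sigma> \<longrightarrow> height a \<omega> \<sigma> (a k) < \<omega> k)"

lemma linear_cmap: "linear (cmap a \<sigma>)"
  unfolding cmap_def by (rule linearI) (auto simp: algebra_simps sum.distrib scaleR_sum_right)

lemma cmap_axis: "cmap a \<sigma> (axis i 1) = a (\<sigma> i)"
  by (simp add: cmap_def axis_def if_distrib[of "\<lambda>x. x *\<^sub>R _"] cong: if_cong)

lemma inj_cmap: "is_basis a \<sigma> \<Longrightarrow> inj (cmap a \<sigma>)"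
  unfolding is_basis_def using linear_surjective_imp_injective[OF linear_cmap] by blast

lemma coords_cmap: "is_basis a \<sigma> \<Longrightarrow> coords a \<sigma> (cmap a \<sigma> c) = c"
  by (simp add: coords_def inj_cmap)

lemma cmap_coords: "is_basis a \<sigma> \<Longrightarrow> cmap a \<sigma> (coords a \<sigma> w) = w"
  by (simp add: coords_def is_basis_def surj_f_inv_f)

lemma linear_coords:
  assumes "is_basis a \<sigma>"
  shows "linear (coords a \<sigma>)"
proof (rule linearI)
  fix x y and r :: real
  show "coords a \<sigma> (x + y) = coords a \<sigma> x + coords a \<sigma> y"
    by (rule injD[OF inj_cmap[OF assms]]) (simp add: linear_add[OF linear_cmap] cmap_coords[OF assms])
  show "coords a \<sigma> (r *\<^sub>R x) = r *\<^sub>R coords a \<sigma> x"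
    by (rule injD[OF inj_cmap[OF assms]]) (simp add: linear_scale[OF linear_cmap] cmap_coords[OF assms])
qed

lemma coords_col: "is_basis a \<sigma> \<Longrightarrow> coords a \<sigma> (a (\<sigma> i)) = axis i 1"
  by (metis cmap_axis coords_cmap)

lemma is_basis_imp_inj: "is_basis a \<sigma> \<Longrightarrow> inj \<sigma>"
  by (rule injI) (metis axis_eq_axis coords_col zero_neq_one)

lemma linear_height:
  assumes "is_basis a \<sigma>"
  shows "linear (height a \<omega> \<sigma>)"
  unfolding height_def
  by (rule linearI) (auto simp: linear_add[OF linear_coords[OF assms]] linear_scale[OF linear_coords[OF assms]]
      algebra_simps sum.distrib sum_distrib_left)

lemmas height_simps = linear_add[OF linear_height] linear_diff[OF linear_height] linear_scale[OF linear_height]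
  linear_sum[OF linear_height] linear_neg[OF linear_height] linear_0[OF linear_height]

lemma height_col: "is_basis a \<sigma> \<Longrightarrow> height a \<omega> \<sigma> (a (\<sigma> i)) = \<omega> (\<sigma> i)"
  by (simp add: height_def coords_col axis_def if_distrib cong: if_cong)

lemma height_cmap:
  assumes "is_basis a \<sigma>"
  shows "height a \<omega> \<sigma> (cmap a \<tau> c) = (\<Sum>i\<in>UNIV. c$i * height a \<omega> \<sigma> (a (\<tau> i)))"
  unfolding cmap_def by (simp add: height_simps[OF assms])

lemma feasible_height_le:
  assumes "feasible a \<omega> \<sigma>"
  shows "height a \<omega> \<sigma> (a k) \<le> \<omega> k"
  using assms by (cases "k \<in> range \<sigma>") (auto simp: feasible_def height_col less_imp_le)

lemma feasible_height_one_le: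
  assumes "generic_weight a \<omega>" "feasible a \<omega> \<sigma>"
  shows "height a (\<lambda>_. 1) \<sigma> (a k) \<le> 1"
  using assms by (cases "k \<in> range \<sigma>") (auto simp: feasible_def generic_weight_def height_col)

text \<open>Weak duality: w is expanded with positive coefficients in the columns of \<tau>, and the
  linear function of \<sigma> underestimates \<omega> at each of them.\<close>

lemma height_le_of_cone:
  assumes \<sigma>: "is_basis a \<sigma>" "\<And>k. height a \<omega> \<sigma> (a k) \<le> \<omega> k" and \<tau>: "in_cone a \<tau> w"
  shows "height a \<omega> \<sigma> w \<le> height a \<omega> \<tau> w"
proof -
  have b: "is_basis a \<tau>" using \<tau> by (simp add: in_cone_def)
  have "height a \<omega> \<sigma> w = (\<Sum>i\<in>UNIV. coords a \<tau> w $ i * height a \<omega> \<sigma> (a (\<tau> i)))"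
    by (subst height_cmap[OF \<sigma>(1), symmetric]) (simp add: cmap_coords[OF b])
  also have "\<dots> \<le> (\<Sum>i\<in>UNIV. coords a \<tau> w $ i * \<omega> (\<tau> i))"
    using \<tau> \<sigma>(2) by (intro sum_mono mult_left_mono) (auto simp: in_cone_def less_imp_le)
  finally show ?thesis by (simp add: height_def mult.commute)
qed

text \<open>Strictness comes from a column of \<tau> outside \<sigma>, which exists since both have
  d columns. It makes the piecewise linear height strictly convex across walls and the cell of a
  point unique.\<close>

lemma height_less_of_cone:
  assumes \<sigma>: "feasible a \<omega> \<sigma>" and \<tau>: "in_cone a \<tau> w" and ne: "range \<sigma> \<noteq> range \<tau>"
  shows "height a \<omega> \<sigma> w < height a \<omega> \<tau> w"
proof -
  have b: "is_basis a \<tau>" and b': "is_basis a \<sigma>" using \<tau> \<sigma> by (auto simp: in_cone_def feasible_def)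
  have "card (range \<sigma>) = card (range \<tau>)"
    by (simp add: card_image is_basis_imp_inj[OF b] is_basis_imp_inj[OF b'])
  then have "\<not> range \<tau> \<subseteq> range \<sigma>" using ne card_subset_eq[of "range \<sigma>" "range \<tau>"] by auto
  then obtain i0 where i0: "\<tau> i0 \<notin> range \<sigma>" by blast
  have "height a \<omega> \<sigma> w = (\<Sum>i\<in>UNIV. coords a \<tau> w $ i * height a \<omega> \<sigma> (a (\<tau> i)))"
    by (subst height_cmap[OF b', symmetric]) (simp add: cmap_coords[OF b])
  also have "\<dots> < (\<Sum>i\<in>UNIV. coords a \<tau> w $ i * \<omega> (\<tau> i))"
    using \<tau> feasible_height_le[OF \<sigma>] i0 \<sigma>
    by (intro sum_strict_mono_ex1) (auto simp: in_cone_def feasible_def less_imp_le intro!: bexI[of _ i0])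
  finally show ?thesis by (simp add: height_def mult.commute)
qed

lemma in_cone_cong_range:
  assumes \<sigma>: "is_basis a \<sigma>" and r: "range \<sigma> = range \<tau>" and \<tau>: "in_cone a \<tau> w"
  shows "in_cone a \<sigma> w"
proof -
  have b: "is_basis a \<tau>" using \<tau> by (auto simp: in_cone_def)
  have inj: "inj \<sigma>" "inj \<tau>" using is_basis_imp_inj \<sigma> b by auto
  define p where "p i = inv \<tau> (\<sigma> i)" for i
  have p: "\<tau> (p i) = \<sigma> i" for i using r by (auto simp: p_def intro!: f_inv_into_f)
  have "inj p" by (rule injI) (metis p inj(1) injD)
  then have bij: "bij p" by (simp add: finite_UNIV_inj_surj bij_def)
  have "cmap a \<sigma> (\<chi> i. coords a \<tau> w $ p i) = cmap a \<tau> (coords a \<tau> w)"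
    unfolding cmap_def using sum.reindex_bij_betw[OF bij, of "\<lambda>i. coords a \<tau> w $ i *\<^sub>R a (\<tau> i)"]
    by (simp add: p)
  then have "coords a \<sigma> w = (\<chi> i. coords a \<tau> w $ p i)"
    by (metis cmap_coords[OF b] coords_cmap[OF \<sigma>])
  then show ?thesis using \<tau> \<sigma> by (simp add: in_cone_def)
qed

lemma finite_ex_minimizer:
  fixes f :: "'a \<Rightarrow> 'b::linorder"
  assumes "finite S" "S \<noteq> {}"
  obtains x where "x \<in> S" "\<And>y. y \<in> S \<Longrightarrow> f x \<le> f y"
proof -
  have "Min (f ` S) \<in> f ` S" using assms by simp
  then obtain x where x: "x \<in> S" "f x = Min (f ` S)" by force
  show thesis
  proof (rule that[OF x(1)])
    show "f x \<le> f y" if "y \<in> S" for y using x(2) assms(1) that by simp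
  qed
qed

lemma conic_caratheodory:
  fixes a :: "'n::finite \<Rightarrow> real^'d::finite"
  assumes u: "\<And>j. u j \<ge> 0" and w: "w = (\<Sum>j\<in>UNIV. u j *\<^sub>R a j)"
  obtains \<sigma> c where "cmap a \<sigma> c = w" "\<And>i. c$i \<ge> 0"
proof -
  define P where "P = (\<lambda>u. (\<forall>j. u j \<ge> 0) \<and> w = (\<Sum>j\<in>UNIV. u j *\<^sub>R a j))"
  define supp where "supp u = {j. u j \<noteq> 0}" for u :: "'n \<Rightarrow> real"
  have "P u" using u w by (auto simp: P_def)
  then obtain v where v: "P v" and min: "\<And>u. P u \<Longrightarrow> card (supp v) \<le> card (supp u)"
    using ex_has_least_nat[of P u "\<lambda>u. card (supp u)"] by blast
  have no_dep: False if z: "\<And>j. z j \<noteq> 0 \<Longrightarrow> j \<in> supp v" "(\<Sum>j\<in>UNIV. z j *\<^sub>R a j) = 0" "z k > 0" for z k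
  proof -
    let ?Z = "{j. z j > 0}"
    have "?Z \<noteq> {}" using z(3) by auto
    then obtain j0 where j0: "z j0 > 0" "\<And>j. z j > 0 \<Longrightarrow> v j0 / z j0 \<le> v j / z j"
      using finite_ex_minimizer[of ?Z "\<lambda>j. v j / z j"] by auto
    \<comment> \<open>The largest step along the relation z that keeps all coefficients nonnegative;
      it annihilates coefficient j0 and so shrinks the support.\<close>
    define t where "t = v j0 / z j0"
    have vnn: "v j \<ge> 0" for j using v by (auto simp: P_def)
    have t: "t \<ge> 0" using vnn[of j0] j0(1) by (simp add: t_def)
    let ?u = "\<lambda>j. v j - t * z j"
    have "?u j \<ge> 0" for j
    proof (cases "z j > 0")
      case True
      then show ?thesis using j0(2)[OF True] by (simp add: t_def pos_le_divide_eq)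
    next
      case False
      then have "t * z j \<le> 0" using t by (simp add: mult_nonneg_nonpos)
      then show ?thesis using vnn[of j] by simp
    qed
    moreover have "w = (\<Sum>j\<in>UNIV. ?u j *\<^sub>R a j)"
    proof -
      have "(\<Sum>j\<in>UNIV. ?u j *\<^sub>R a j) = (\<Sum>j\<in>UNIV. v j *\<^sub>R a j) - t *\<^sub>R (\<Sum>j\<in>UNIV. z j *\<^sub>R a j)"
        by (simp add: algebra_simps sum_subtractf scaleR_sum_right)
      then show ?thesis using v z(2) by (simp add: P_def)
    qed
    ultimately have "P ?u" by (simp add: P_def)
    then have "card (supp v) \<le> card (supp ?u)" by (rule min)
    moreover have "supp ?u \<subset> supp v"
    proof
      show "supp ?u \<subseteq> supp v" using z(1) by (force simp: supp_def)
      have "j0 \<in> supp v" using z(1)[of j0] j0(1) by simp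
      moreover have "j0 \<notin> supp ?u" using j0(1) by (simp add: supp_def t_def)
      ultimately show "supp ?u \<noteq> supp v" by blast
    qed
    ultimately show False by (meson finite leD psubset_card_mono)
  qed
  have no_dep': False if "\<And>j. z j \<noteq> 0 \<Longrightarrow> j \<in> supp v" "(\<Sum>j\<in>UNIV. z j *\<^sub>R a j) = 0" "z k \<noteq> 0" for z k
  proof (cases "z k > 0")
    case True
    then show ?thesis using no_dep[of z k] that(1,2) by blast
  next
    case False
    then have "- z k > 0" using that(3) by simp
    moreover have "(\<Sum>j\<in>UNIV. (- z j) *\<^sub>R a j) = 0" using that(2) by (simp add: sum_negf)
    ultimately show ?thesis using no_dep[of "\<lambda>j. - z j" k] that(1) by simp
  qed
  have inj: "inj_on a (supp v)"
  proof (rule inj_onI, rule ccontr)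
    fix j j' assume j: "j \<in> supp v" "j' \<in> supp v" "a j = a j'" "j \<noteq> j'"
    let ?z = "\<lambda>k. (if k = j then 1 else 0) - (if k = j' then 1 else 0 :: real)"
    have "(\<Sum>k\<in>UNIV. ?z k *\<^sub>R a k) = a j - a j'"
      by (simp add: scaleR_left_diff_distrib sum_subtractf if_distrib[of "\<lambda>x. x *\<^sub>R _"] cong: if_cong)
    then have eq: "(\<Sum>k\<in>UNIV. ?z k *\<^sub>R a k) = 0" using j(3) by simp
    show False
    proof (rule no_dep'[OF _ eq])
      show "k \<in> supp v" if "?z k \<noteq> 0" for k using j(1,2) that by (cases "k = j"; cases "k = j'") auto
      show "?z j \<noteq> 0" using j(4) by simp
    qed
  qed
  have "independent (a ` supp v)"
  proof (rule ccontr)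
    assume "\<not> independent (a ` supp v)"
    then obtain r x where r: "x \<in> a ` supp v" "r x \<noteq> 0" "(\<Sum>x\<in>a ` supp v. r x *\<^sub>R x) = 0"
      by (auto simp: dependent_finite)
    let ?z = "\<lambda>k. if k \<in> supp v then r (a k) else 0"
    have "(\<Sum>k\<in>UNIV. ?z k *\<^sub>R a k) = (\<Sum>k\<in>supp v. r (a k) *\<^sub>R a k)"
      by (intro sum.mono_neutral_cong_right) auto
    also have "\<dots> = 0" using r(3) by (simp add: sum.reindex[OF inj])
    finally have eq: "(\<Sum>k\<in>UNIV. ?z k *\<^sub>R a k) = 0" .
    obtain k where k: "k \<in> supp v" "x = a k" using r(1) by blast
    show False
    proof (rule no_dep'[OF _ eq])
      show "k \<in> supp v" if "?z k \<noteq> 0" for k using that by (cases "k \<in> supp v") auto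
      show "?z k \<noteq> 0" using k r(2) by simp
    qed
  qed
  then have "card (a ` supp v) \<le> DIM(real^'d)" by (rule independent_card_le)
  then have "card (supp v) \<le> card (UNIV :: 'd set)" by (simp add: card_image[OF inj])
  then obtain f :: "'n \<Rightarrow> 'd" where f: "inj_on f (supp v)"
    using card_le_inj[of "supp v" "UNIV :: 'd set"] by auto
  define \<sigma> where "\<sigma> = inv_into (supp v) f"
  define c :: "real^'d" where "c = (\<chi> i. if i \<in> f ` supp v then v (\<sigma> i) else 0)"
  have "cmap a \<sigma> c = (\<Sum>i\<in>f ` supp v. v (\<sigma> i) *\<^sub>R a (\<sigma> i))"
    unfolding cmap_def c_def by (intro sum.mono_neutral_cong_right) auto
  also have "\<dots> = (\<Sum>j\<in>supp v. v j *\<^sub>R a j)"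
    by (subst sum.reindex[OF f]) (simp add: \<sigma>_def f cong: sum.cong)
  also have "\<dots> = (\<Sum>j\<in>UNIV. v j *\<^sub>R a j)" by (intro sum.mono_neutral_left) (auto simp: supp_def)
  also have "\<dots> = w" using v by (simp add: P_def)
  finally show thesis using that[of \<sigma> c] v by (auto simp: c_def P_def)
qed

text \<open>Existence is linear programming: among all bases whose cone contains the point, the cheapest
  one is dual feasible, since otherwise a pivot step would lower the cost.\<close>

lemma ex_feasible_cone:
  fixes a :: "'n::finite \<Rightarrow> real^'d::finite"
  assumes \<omega>: "generic_weight a \<omega>" and gen: "generic_point a w"
    and u: "\<And>j. u j \<ge> 0" and w: "w = (\<Sum>j\<in>UNIV. u j *\<^sub>R a j)"
  obtains \<sigma> where "feasible a \<omega> \<sigma>" "in_cone a \<sigma> w"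
proof -
  let ?S = "{\<sigma>. in_cone a \<sigma> w}"
  obtain \<sigma>0 c where c: "cmap a \<sigma>0 c = w" "\<And>i. c$i \<ge> 0" using conic_caratheodory[OF u w] by blast
  have "in_cone a \<sigma>0 w"
    using gen c by (auto simp: in_cone_def generic_point_def coords_cmap order_less_le)
  then have "?S \<noteq> {}" by auto
  then obtain \<sigma> where \<sigma>: "in_cone a \<sigma> w" and min: "\<And>\<tau>. in_cone a \<tau> w \<Longrightarrow> height a \<omega> \<sigma> w \<le> height a \<omega> \<tau> w"
    using finite_ex_minimizer[of ?S "\<lambda>\<sigma>. height a \<omega> \<sigma> w"] by auto
  have b: "is_basis a \<sigma>" using \<sigma> by (simp add: in_cone_def)
  have "height a \<omega> \<sigma> (a k) < \<omega> k" if k: "k \<notin> range \<sigma>" for k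
  proof (rule ccontr)
    assume "\<not> height a \<omega> \<sigma> (a k) < \<omega> k"
    then have gt: "height a \<omega> \<sigma> (a k) > \<omega> k" using \<omega> k b by (auto simp: generic_weight_def less_le)
    define l where "l = coords a \<sigma> (a k)"
    define x where "x = coords a \<sigma> w"
    have xpos: "x$i > 0" for i using \<sigma> by (simp add: x_def in_cone_def)
    have \<omega>pos: "\<omega> j > 0" for j using \<omega> by (simp add: generic_weight_def)
    let ?L = "{i. l$i > 0}"
    \<comment> \<open>Otherwise a_k would have nonpositive height, although its height exceeds
      \<omega>_k > 0: positive weights exclude an unbounded pivot.\<close>
    have "?L \<noteq> {}"
    proof
      assume "?L = {}"
      then have "height a \<omega> \<sigma> (a k) \<le> 0"
        unfolding height_def l_def[symmetric] using \<omega>pos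
        by (intro sum_nonpos mult_nonneg_nonpos) (auto simp: less_imp_le not_less)
      then show False using gt \<omega>pos[of k] by simp
    qed
    then obtain i0 where i0: "l$i0 > 0" "\<And>i. l$i > 0 \<Longrightarrow> x$i0 / l$i0 \<le> x$i / l$i"
      using finite_ex_minimizer[of ?L "\<lambda>i. x$i / l$i"] by auto
    \<comment> \<open>Ratio test: column k enters with coefficient t, and the column at index i0
      drops to coefficient 0.\<close>
    define t where "t = x$i0 / l$i0"
    have t: "t > 0" using xpos i0 by (simp add: t_def)
    define x' where "x' = (\<chi> i. x$i - t * l$i)"
    have x'nn: "x'$i \<ge> 0" for i
    proof (cases "l$i > 0")
      case True
      then show ?thesis using i0(2)[OF True] by (simp add: x'_def t_def pos_le_divide_eq)
    next
      case False
      then have "t * l$i \<le> 0" using t by (simp add: mult_nonneg_nonpos)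
      then show ?thesis using xpos[of i] by (simp add: x'_def)
    qed
    have x'0: "x'$i0 = 0" using i0(1) by (simp add: x'_def t_def)
    define \<tau> where "\<tau> = \<sigma>(i0 := k)"
    define y where "y = (\<chi> i. if i = i0 then t else x'$i)"
    have split: "(\<Sum>i\<in>UNIV. F i (y$i)) = F i0 t + (\<Sum>i\<in>UNIV - {i0}. F i (x'$i))"
      for F :: "'d \<Rightarrow> real \<Rightarrow> 'b::comm_monoid_add"
      by (subst sum.remove[of _ i0]) (auto simp: y_def intro!: arg_cong2[of _ _ _ _ "(+)"] sum.cong)
    have "cmap a \<tau> y = t *\<^sub>R a k + (\<Sum>i\<in>UNIV - {i0}. x'$i *\<^sub>R a (\<sigma> i))"
      unfolding cmap_def split[of "\<lambda>i r. r *\<^sub>R a (\<tau> i)"] by (simp add: \<tau>_def)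
    also have "(\<Sum>i\<in>UNIV - {i0}. x'$i *\<^sub>R a (\<sigma> i)) = cmap a \<sigma> x'"
      unfolding cmap_def by (intro sum.mono_neutral_left) (auto simp: x'0)
    also have "x' = x - t *\<^sub>R l" by (simp add: x'_def vec_eq_iff)
    also have "cmap a \<sigma> (x - t *\<^sub>R l) = w - t *\<^sub>R a k"
      by (simp add: linear_diff[OF linear_cmap] linear_scale[OF linear_cmap] x_def l_def cmap_coords[OF b])
    finally have y: "cmap a \<tau> y = w" by simp
    \<comment> \<open>Genericity of w yields both that the exchanged columns form a basis and that
      no coefficient of \<open>y\<close> vanishes.\<close>
    then have \<tau>b: "is_basis a \<tau>" and "y$i \<noteq> 0" for i using gen by (auto simp: generic_point_def)
    moreover have "y$i \<ge> 0" for i using x'nn t by (simp add: y_def)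
    moreover have yc: "coords a \<tau> w = y" using coords_cmap[OF \<tau>b] y by blast
    ultimately have "in_cone a \<tau> w" by (simp add: in_cone_def less_le)
    then have "height a \<omega> \<sigma> w \<le> height a \<omega> \<tau> w" by (rule min)
    moreover have "height a \<omega> \<tau> w = height a \<omega> \<sigma> w + t * (\<omega> k - height a \<omega> \<sigma> (a k))"
    proof -
      have "height a \<omega> \<tau> w = \<omega> k * t + (\<Sum>i\<in>UNIV - {i0}. \<omega> (\<sigma> i) * x'$i)"
        unfolding height_def yc split[of "\<lambda>i r. \<omega> (\<tau> i) * r"] by (simp add: \<tau>_def)
      also have "(\<Sum>i\<in>UNIV - {i0}. \<omega> (\<sigma> i) * x'$i) = (\<Sum>i\<in>UNIV. \<omega> (\<sigma> i) * x'$i)"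
        by (intro sum.mono_neutral_left) (auto simp: x'0)
      also have "\<dots> = height a \<omega> \<sigma> w - t * height a \<omega> \<sigma> (a k)"
        by (simp add: height_def x'_def x_def l_def algebra_simps sum_subtractf sum_distrib_left)
      finally show ?thesis by (simp add: algebra_simps)
    qed
    ultimately show False using t gt by (simp add: zero_le_mult_iff)
  qed
  then show thesis using that[of \<sigma>] \<sigma> b by (simp add: feasible_def)
qed

text \<open>Finitely generated cones are polyhedral. In each defining inequality b x \<le> r the
  origin gives r \<ge> 0, and large multiples of a generator force b a_j \<le> 0, so b x \<le> 0 can
  replace it. The normals drive the induction outside the cone.\<close>

lemma finitely_generated_cone_halfspaces:
  fixes a :: "'n::finite \<Rightarrow> real^'d::finite"
  obtains F :: "(real^'d) set" where "finite F" "\<And>l j. l \<in> F \<Longrightarrow> l \<bullet> a j \<ge> 0"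
    "\<And>w. (\<And>l. l \<in> F \<Longrightarrow> l \<bullet> w \<ge> 0) \<Longrightarrow> \<exists>u. (\<forall>j. u j \<ge> 0) \<and> w = (\<Sum>j\<in>UNIV. u j *\<^sub>R a j)"
proof -
  let ?C = "convex_cone hull (range a)"
  have "polyhedron ?C" by (rule polyhedron_convex_cone_hull) simp
  then obtain H where H: "finite H" "?C = \<Inter> H" "\<And>h. h \<in> H \<Longrightarrow> \<exists>b r. b \<noteq> 0 \<and> h = {x. b \<bullet> x \<le> r}"
    unfolding polyhedron_def by metis
  from H(3) obtain b r where br: "\<And>h. h \<in> H \<Longrightarrow> h = {x. b h \<bullet> x \<le> r h}" by metis
  have r: "r h \<ge> 0" if "h \<in> H" for h
  proof -
    have "0 \<in> h" using H(2) convex_cone_hull_contains_0[of "range a"] that by blast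
    then have "b h \<bullet> 0 \<le> r h" using br[OF that] by blast
    then show ?thesis by simp
  qed
  have nonpos: "b h \<bullet> a j \<le> 0" if h: "h \<in> H" for h j
  proof (rule ccontr)
    assume pos: "\<not> b h \<bullet> a j \<le> 0"
    \<comment> \<open>At this multiple of a_j the inequality would be violated by exactly 1.\<close>
    define t where "t = (r h + 1) / (b h \<bullet> a j)"
    have "t \<ge> 0" using pos r[OF h] by (simp add: t_def)
    then have "t *\<^sub>R a j \<in> ?C" by (intro convex_cone_hull_mul hull_inc) auto
    then have "t *\<^sub>R a j \<in> h" using H(2) h by blast
    then have "b h \<bullet> (t *\<^sub>R a j) \<le> r h" using br[OF h] by blast
    then show False using pos by (simp add: t_def)
  qed
  let ?D = "{w. \<exists>u. (\<forall>j. u j \<ge> 0) \<and> w = (\<Sum>j\<in>UNIV. u j *\<^sub>R a j)}"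
  have "convex_cone ?D"
    unfolding convex_cone_iff
  proof (intro conjI ballI allI impI)
    show "0 \<in> ?D" by (auto intro!: exI[of _ "\<lambda>_. 0"])
    fix x y assume "x \<in> ?D" "y \<in> ?D"
    then obtain u v where "\<forall>j. u j \<ge> 0" "x = (\<Sum>j\<in>UNIV. u j *\<^sub>R a j)" "\<forall>j. v j \<ge> 0" "y = (\<Sum>j\<in>UNIV. v j *\<^sub>R a j)"
      by blast
    then show "x + y \<in> ?D" by (auto intro!: exI[of _ "\<lambda>j. u j + v j"] simp: scaleR_left_distrib sum.distrib)
  next
    fix x and c :: real assume "x \<in> ?D" "c \<ge> 0"
    then obtain u where "\<forall>j. u j \<ge> 0" "x = (\<Sum>j\<in>UNIV. u j *\<^sub>R a j)" by blast
    then show "c *\<^sub>R x \<in> ?D" using \<open>c \<ge> 0\<close> by (auto intro!: exI[of _ "\<lambda>j. c * u j"] simp: scaleR_sum_right)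
  qed
  moreover have "range a \<subseteq> ?D"
  proof
    fix x assume "x \<in> range a"
    then obtain k where "x = a k" by blast
    then show "x \<in> ?D"
      by (auto intro!: exI[of _ "\<lambda>j. if j = k then 1 else 0"] simp: if_distrib[of "\<lambda>x. x *\<^sub>R _"] cong: if_cong)
  qed
  ultimately have CD: "?C \<subseteq> ?D" by (rule hull_minimal[rotated])
  show thesis
  proof (rule that[of "(\<lambda>h. - b h) ` H"])
    show "finite ((\<lambda>h. - b h) ` H)" using H(1) by simp
    show "l \<bullet> a j \<ge> 0" if "l \<in> (\<lambda>h. - b h) ` H" for l j using that nonpos by auto
    fix w assume w: "\<And>l. l \<in> (\<lambda>h. - b h) ` H \<Longrightarrow> l \<bullet> w \<ge> 0"
    have "w \<in> h" if "h \<in> H" for h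
      using w[of "- b h"] that r[OF that] by (subst br[OF that]) auto
    then have "w \<in> ?C" using H(2) by blast
    then show "\<exists>u. (\<forall>j. u j \<ge> 0) \<and> w = (\<Sum>j\<in>UNIV. u j *\<^sub>R a j)" using CD by blast
  qed
qed

lemma poly_eventually_pos:
  fixes p :: "real poly"
  assumes "lead_coeff p > 0"
  shows "eventually (\<lambda>M::nat. poly p (real M) > 0) sequentially"
proof -
  obtain n where n: "\<And>x. x \<ge> n \<Longrightarrow> poly p x \<ge> lead_coeff p" using poly_pinfty_gt_lc[OF assms] by blast
  have "eventually (\<lambda>M::nat. real M \<ge> n) sequentially"
    by (metis eventually_sequentiallyI order_trans real_nat_ceiling_ge of_nat_le_iff)
  then show ?thesis by eventually_elim (use n assms in force)
qed

text \<open>The weight \<open>M^N + M^(idx j)\<close> is a generic perturbation of the constant weight \<open>M^N\<close>,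
  so the triangulation it induces refines the faces of the polytope that do not contain the origin.\<close>

lemma ex_generic_weight:
  fixes a :: "'n::finite \<Rightarrow> real^'d::finite"
  obtains \<omega> :: "'n \<Rightarrow> int" where "generic_weight a (\<lambda>j. real_of_int (\<omega> j))"
proof -
  define N where "N = CARD('n)"
  obtain idx where idx: "bij_betw idx (UNIV :: 'n set) {..<N}"
    using ex_bij_betw_finite_nat[of "UNIV :: 'n set"] by (auto simp: N_def lessThan_atLeast0)
  have idx_lt: "idx j < N" for j using idx by (auto simp: bij_betw_def)
  have idx_inj: "idx j = idx k \<longleftrightarrow> j = k" for j k using idx by (auto simp: bij_betw_def inj_on_def)
  define W where "W M j = real (M ^ N + M ^ idx j)" for M j
  define Q where "Q M \<sigma> k \<longleftrightarrow> (is_basis a \<sigma> \<longrightarrow> k \<notin> range \<sigma> \<longrightarrow> height a (W M) \<sigma> (a k) \<noteq> W M k \<and>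
        (height a (W M) \<sigma> (a k) < W M k \<longrightarrow> height a (\<lambda>_. 1) \<sigma> (a k) \<le> 1))" for M \<sigma> k
  have ev: "eventually (\<lambda>M. Q M \<sigma> k) sequentially" for \<sigma> k
  proof (cases "is_basis a \<sigma> \<and> k \<notin> range \<sigma>")
    case True
    define l where "l = coords a \<sigma> (a k)"
    \<comment> \<open>The coefficient of M^N in \<omega>_k minus the height of a_k, a difference
      that is the value at M of the polynomial p below.\<close>
    define s where "s = 1 - (\<Sum>i\<in>UNIV. l$i)"
    define p where "p = monom s N + monom 1 (idx k) - (\<Sum>i\<in>UNIV. monom (l$i) (idx (\<sigma> i)))"
    have pv: "poly p (real M) = W M k - height a (W M) \<sigma> (a k)" for M
      by (simp add: p_def poly_monom poly_sum W_def height_def l_def[symmetric] s_def algebra_simps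
          sum.distrib sum_distrib_left sum_distrib_right)
    have "idx j \<noteq> N" for j using idx_lt[of j] by simp
    then have cN: "coeff p N = s" by (simp add: p_def coeff_sum)
    \<comment> \<open>Injectivity of \<open>idx\<close> isolates the monomial of column k, so p is
      nonzero even when s = 0.\<close>
    have "coeff p (idx k) = 1"
    proof -
      have "\<sigma> i \<noteq> k" for i using True by blast
      then show ?thesis using idx_lt[of k] by (auto simp: p_def coeff_sum idx_inj)
    qed
    then have p0: "p \<noteq> 0" by auto
    have deg: "degree p \<le> N"
      unfolding p_def using idx_lt
      by (intro degree_diff_le degree_add_le degree_sum_le) (auto intro: order.trans[OF degree_monom_le] less_imp_le)
    show ?thesis
    proof (cases "lead_coeff p > 0")
      case lc: True
      \<comment> \<open>Since p has degree at most N, a negative s would be its leading coefficient.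
        As s is 1 minus the constant-weight height of a_k, this is the closeness clause.\<close>
      have "s \<ge> 0"
      proof (rule ccontr)
        assume "\<not> s \<ge> 0"
        then have "degree p = N" using cN deg le_degree[of p N] by auto
        then show False using lc cN \<open>\<not> s \<ge> 0\<close> by simp
      qed
      then have "height a (\<lambda>_. 1) \<sigma> (a k) \<le> 1" by (simp add: height_def s_def l_def)
      with poly_eventually_pos[OF lc] show ?thesis by (auto elim!: eventually_mono simp: Q_def pv)
    next
      case False
      then have "lead_coeff (- p) > 0" using p0 by (simp add: less_le)
      from poly_eventually_pos[OF this] show ?thesis by eventually_elim (simp add: Q_def pv)
    qed
  qed (simp add: Q_def)
  have "eventually (\<lambda>M. (\<forall>\<sigma> k. Q M \<sigma> k) \<and> M > 0) sequentially"
    using ev by (intro eventually_conj eventually_gt_at_top) (auto intro!: eventually_all_finite)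
  then obtain M where M: "\<forall>\<sigma> k. Q M \<sigma> k" "M > 0"
    by (metis (no_types, lifting) eventually_sequentially order_refl)
  have "W M = (\<lambda>j. real_of_int (int (M ^ N + M ^ idx j)))" by (simp add: W_def fun_eq_iff)
  moreover have "generic_weight a (W M)"
    unfolding generic_weight_def using M by (auto simp: Q_def) (simp add: W_def add_pos_pos)
  ultimately show thesis using that[of "\<lambda>j. int (M ^ N + M ^ idx j)"] by simp
qed

section \<open>Solutions are determined by the standard points\<close>

definition lat :: "('d::finite \<Rightarrow> int) \<Rightarrow> real^'d" where
  "lat m = (\<chi> i. real_of_int (m i))"

lemma lat_add_col: "lat (\<lambda>i. m i + A$i$j) = lat m + col_real A j"
  by (simp add: lat_def col_real_def vec_eq_iff)

lemma lat_diff_col: "lat (\<lambda>i. m i - A$i$j) = lat m - col_real A j"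
  by (simp add: lat_def col_real_def vec_eq_iff)

lemma finite_lattice_points_bounded:
  fixes v :: "real^'d::finite"
  assumes "bounded S"
  shows "finite {m. lat m + v \<in> S}"
proof -
  obtain R where R: "\<And>x. x \<in> S \<Longrightarrow> norm x \<le> R" using assms by (auto simp: bounded_iff)
  define K where "K = \<lceil>R + norm v\<rceil>"
  have "{m. lat m + v \<in> S} \<subseteq> (UNIV :: 'd set) \<rightarrow>\<^sub>E {-K..K}"
  proof
    fix m assume "m \<in> {m. lat m + v \<in> S}"
    then have "norm (lat m + v) \<le> R" using R by auto
    then have "norm (lat m) \<le> R + norm v" using norm_triangle_ineq4[of "lat m + v" v] by simp
    then have "\<bar>real_of_int (m i)\<bar> \<le> R + norm v" for i
      using component_le_norm_cart[of "lat m" i] by (simp add: lat_def)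
    then have "\<bar>m i\<bar> \<le> K" for i unfolding K_def by (metis le_of_int_ceiling of_int_abs of_int_le_iff order_trans)
    then show "m \<in> (UNIV :: 'd set) \<rightarrow>\<^sub>E {-K..K}" by (auto simp: abs_le_iff) (metis minus_le_iff)
  qed
  then show ?thesis by (rule finite_subset) (auto intro: finite_PiE)
qed

text \<open>Permuting the indices of \<sigma> describes the same cone; the choice operator keeps one
  representative per set of columns, so no cell is counted d! times.\<close>

definition triangulation :: "('n \<Rightarrow> real^'d) \<Rightarrow> ('n \<Rightarrow> real) \<Rightarrow> ('d::finite \<Rightarrow> 'n) set" where
  "triangulation a \<omega> = {\<sigma>. feasible a \<omega> \<sigma> \<and> \<sigma> = (SOME \<tau>. feasible a \<omega> \<tau> \<and> range \<tau> = range \<sigma>)}"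

lemma feasible_in_triangulation:
  assumes "feasible a \<omega> \<sigma>"
  obtains \<tau> where "\<tau> \<in> triangulation a \<omega>" "range \<tau> = range \<sigma>"
proof -
  define \<tau> where "\<tau> = (SOME \<tau>. feasible a \<omega> \<tau> \<and> range \<tau> = range \<sigma>)"
  have "feasible a \<omega> \<tau> \<and> range \<tau> = range \<sigma>"
    unfolding \<tau>_def by (rule someI[of _ \<sigma>]) (use assms in auto)
  moreover from this have "\<tau> \<in> triangulation a \<omega>" by (simp add: triangulation_def flip: \<tau>_def)
  ultimately show thesis using that by blast
qed

lemma triangulation_unique:
  assumes "\<sigma> \<in> triangulation a \<omega>" "\<tau> \<in> triangulation a \<omega>" "in_cone a \<sigma> w" "in_cone a \<tau> w"
  shows "\<sigma> = \<tau>"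
proof -
  have f: "feasible a \<omega> \<sigma>" "feasible a \<omega> \<tau>" using assms unfolding triangulation_def by blast+
  have "range \<sigma> = range \<tau>"
    using height_less_of_cone[OF f(1) assms(4)] height_less_of_cone[OF f(2) assms(3)] by fastforce
  then show ?thesis using assms(1,2) unfolding triangulation_def by simp
qed

lemma ex_triangulation_cone:
  fixes a :: "'n::finite \<Rightarrow> real^'d::finite"
  assumes "generic_weight a \<omega>" "generic_point a w" "\<And>j. u j \<ge> 0" "w = (\<Sum>j\<in>UNIV. u j *\<^sub>R a j)"
  obtains \<sigma> where "\<sigma> \<in> triangulation a \<omega>" "in_cone a \<sigma> w"
proof -
  obtain \<sigma> where \<sigma>: "feasible a \<omega> \<sigma>" "in_cone a \<sigma> w" using ex_feasible_cone[OF assms] by blast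
  obtain \<tau> where \<tau>: "\<tau> \<in> triangulation a \<omega>" "range \<tau> = range \<sigma>" using feasible_in_triangulation[OF \<sigma>(1)] by blast
  have "is_basis a \<tau>" using \<tau>(1) unfolding triangulation_def feasible_def by blast
  then have "in_cone a \<tau> w" by (rule in_cone_cong_range[OF _ \<tau>(2) \<sigma>(2)])
  then show thesis using that \<tau> by blast
qed

lemma finite_cell:
  fixes a :: "'n \<Rightarrow> real^'d::finite"
  assumes b: "is_basis a \<sigma>"
  shows "finite {m. (\<forall>i. 0 \<le> coords a \<sigma> (lat m + v) $ i \<and> coords a \<sigma> (lat m + v) $ i \<le> N)}"
proof -
  have "bounded (cmap a \<sigma> ` cbox 0 (\<chi> i. N))"
    by (intro bounded_linear_image bounded_cbox linear_conv_bounded_linear[THEN iffD1] linear_cmap)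
  from finite_lattice_points_bounded[OF this, of v] show ?thesis
  proof (rule rev_finite_subset, intro subsetI CollectI)
    fix m assume "m \<in> {m. \<forall>i. 0 \<le> coords a \<sigma> (lat m + v) $ i \<and> coords a \<sigma> (lat m + v) $ i \<le> N}"
    then have "coords a \<sigma> (lat m + v) \<in> cbox 0 (\<chi> i. N)" by (simp add: mem_box_cart)
    then show "lat m + v \<in> cmap a \<sigma> ` cbox 0 (\<chi> i. N)" by (metis b cmap_coords image_eqI)
  qed
qed

definition cell_points :: "('n \<Rightarrow> real^'d) \<Rightarrow> real^'d \<Rightarrow> ('d::finite \<Rightarrow> 'n) \<Rightarrow> ('d \<Rightarrow> int) set" where
  "cell_points a v \<sigma> = {m. \<forall>i. 0 \<le> coords a \<sigma> (lat m + v) $ i \<and> coords a \<sigma> (lat m + v) $ i < 1}"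

definition standard_points :: "('n \<Rightarrow> real^'d) \<Rightarrow> ('n \<Rightarrow> real) \<Rightarrow> real^'d \<Rightarrow> ('d::finite \<Rightarrow> int) set" where
  "standard_points a \<omega> v = (\<Union>\<sigma>\<in>triangulation a \<omega>. cell_points a v \<sigma>)"

lemma finite_cell_points: "is_basis a \<sigma> \<Longrightarrow> finite (cell_points a v \<sigma>)"
  by (rule finite_subset[OF _ finite_cell[of a \<sigma> v 1]]) (auto simp: cell_points_def less_imp_le)

lemma triangulation_feasible: "\<sigma> \<in> triangulation a \<omega> \<Longrightarrow> feasible a \<omega> \<sigma>"
  unfolding triangulation_def by blast

lemma triangulation_is_basis: "\<sigma> \<in> triangulation a \<omega> \<Longrightarrow> is_basis a \<sigma>"
  unfolding triangulation_def feasible_def by blast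

lemma finite_standard_points:
  fixes a :: "'n::finite \<Rightarrow> real^'d::finite"
  shows "finite (standard_points a \<omega> v)"
  unfolding standard_points_def by (auto intro!: finite_cell_points triangulation_is_basis)

lemma coords_functional:
  assumes b: "is_basis a \<sigma>"
  obtains l where "\<And>w. l \<bullet> w = coords a \<sigma> w $ i"
proof -
  let ?f = "\<lambda>w. coords a \<sigma> w $ i"
  have lin: "linear ?f"
    by (rule linearI) (simp_all add: linear_add[OF linear_coords[OF b]] linear_scale[OF linear_coords[OF b]])
  have "adjoint ?f 1 \<bullet> w = ?f w" for w
    using adjoint_works[OF lin, of w 1] by (simp add: inner_commute)
  then show thesis using that by blast
qed

text \<open>The value at q = 0 is the conventional 0 and carries no meaning; minimizations are
  therefore restricted to nonzero elements.\<close>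

definition wval :: "('n \<Rightarrow> int) \<Rightarrow> ('d::linorder, 'n::linorder) crat \<Rightarrow> int" where
  "wval \<omega> q = fls_subdegree (weight_embedding \<omega> q)"

lemmas weight_embedding_simps = ring_map_simps[OF ring_map_weight_embedding]

lemma weight_embedding_eq_0_iff [simp]: "weight_embedding \<omega> q = 0 \<longleftrightarrow> q = 0"
  by (rule ring_map_inject[OF ring_map_weight_embedding])

lemma wval_mult: "p \<noteq> 0 \<Longrightarrow> q \<noteq> 0 \<Longrightarrow> wval \<omega> (p * q) = wval \<omega> p + wval \<omega> q"
  by (simp add: wval_def weight_embedding_simps)

lemma wval_kvar_XV: "wval \<omega> (kvar (XV j)) = \<omega> j"
  by (simp add: wval_def weight_embedding_kvar subdegree_tmon)

lemma wval_uminus: "wval \<omega> (- p) = wval \<omega> p"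
  by (simp add: wval_def weight_embedding_simps)

lemma weight_embedding_slin: "weight_embedding \<omega> (slin l + rconst r) = tmon (slin l + rconst r) 0"
proof -
  have "weight_embedding \<omega> (slin l + rconst r) = (\<Sum>i\<in>UNIV. tmon (rconst (l i) * kvar (SV i)) 0) + tmon (rconst r) 0"
    by (simp add: slin_def rconst_def weight_embedding_simps(3,4,7) weight_embedding_kvar weight_embedding_kconst tmon_mult)
  then show ?thesis by (simp add: slin_def ring_map_simps(3,7)[OF ring_map_tmon_0])
qed

lemma wval_slin:
  assumes "(slin l + rconst r :: ('d::{finite,linorder}, 'n::linorder) crat) \<noteq> 0"
  shows "wval \<omega> (slin l + rconst r :: ('d, 'n) crat) = 0"
  using assms by (simp add: wval_def weight_embedding_slin subdegree_tmon)

lemma wval_rconst: "r \<noteq> 0 \<Longrightarrow> wval \<omega> (rconst r) = 0"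
  unfolding wval_def rconst_def weight_embedding_kconst by (intro subdegree_tmon) (simp flip: rconst_def)

lemma wval_sum_term:
  assumes "finite S" "sum f S = g" "g \<noteq> 0"
  obtains s where "s \<in> S" "f s \<noteq> 0" "wval \<omega> (f s) \<le> wval \<omega> g"
proof -
  have "(\<Sum>s\<in>S. weight_embedding \<omega> (f s)) = weight_embedding \<omega> g" "weight_embedding \<omega> g \<noteq> 0"
    using assms(2,3) by (auto simp flip: weight_embedding_simps(7))
  from fls_sum_nonzero_term[OF assms(1) this] show thesis using that by (auto simp: wval_def)
qed

text \<open>The d equations at m contracted with l. For l dual to one column of a cone, the other
  columns of that cone drop out of the sum.\<close>

lemma solution_linear_combination:
  fixes A :: "int^('n::{finite,linorder})^('d::{finite,linorder})" and l :: "real^('d::{finite,linorder})" and m :: "'d \<Rightarrow> int"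
  assumes sol: "is_solution A (\<lambda>x. x) \<phi>"
  shows "(\<Sum>j\<in>UNIV. rconst (l \<bullet> col_real A j) * kvar (XV j) * \<phi> (\<lambda>i. m i + A$i$j))
    = (slin (($) l) - rconst (l \<bullet> lat m)) * \<phi> m"
proof -
  have "(\<Sum>j\<in>UNIV. rconst (l \<bullet> col_real A j) * kvar (XV j) * \<phi> (\<lambda>i. m i + A$i$j))
    = (\<Sum>j\<in>UNIV. \<Sum>i\<in>UNIV. rconst (l$i) * (of_int (A$i$j) * kvar (XV j) * \<phi> (\<lambda>i. m i + A$i$j)))"
  proof (rule sum.cong[OF refl])
    fix j
    have "(rconst (l \<bullet> col_real A j) :: ('d, 'n) crat) = (\<Sum>i\<in>UNIV. rconst (l$i) * of_int (A$i$j))"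
      by (simp only: inner_vec_def col_real_def rconst_simps vec_lambda_beta inner_real_def)
    then show "rconst (l \<bullet> col_real A j) * kvar (XV j) * \<phi> (\<lambda>i. m i + A$i$j)
      = (\<Sum>i\<in>UNIV. rconst (l$i) * (of_int (A$i$j) * kvar (XV j) * \<phi> (\<lambda>i. m i + A$i$j)))"
      by (simp only: sum_distrib_right mult.assoc)
  qed
  also have "\<dots> = (\<Sum>i\<in>UNIV. rconst (l$i) * (\<Sum>j\<in>UNIV. of_int (A$i$j) * kvar (XV j) * \<phi> (\<lambda>i. m i + A$i$j)))"
    by (subst sum.swap) (simp only: sum_distrib_left)
  also have "\<dots> = (\<Sum>i\<in>UNIV. rconst (l$i) * ((kvar (SV i) - of_int (m i)) * \<phi> m))"
    by (simp only: sol[unfolded is_solution_def, rule_format])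
  also have "\<dots> = (\<Sum>i\<in>UNIV. rconst (l$i) * (kvar (SV i) - of_int (m i))) * \<phi> m"
    by (simp only: sum_distrib_right mult.assoc)
  also have "(\<Sum>i\<in>UNIV. rconst (l$i) * (kvar (SV i) - of_int (m i)) :: ('d, 'n) crat) = slin (($) l) - rconst (l \<bullet> lat m)"
    by (simp only: slin_def inner_vec_def lat_def rconst_simps vec_lambda_beta inner_real_def right_diff_distrib sum_subtractf)
  finally show ?thesis .
qed

locale generic_data =
  fixes A :: "int^('n::{finite,linorder})^('d::{finite,linorder})"
    and \<omega> :: "'n \<Rightarrow> int" and v :: "real^('d::{finite,linorder})"
  assumes weight: "generic_weight (col_real A) (\<lambda>j. real_of_int (\<omega> j))"
    and point: "\<And>m. generic_point (col_real A) (lat m + v)"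
begin

abbreviation "a \<equiv> col_real A"
abbreviation "w \<equiv> (\<lambda>j. real_of_int (\<omega> j))"
abbreviation "T \<equiv> triangulation a w"
abbreviation "pt m \<equiv> lat m + v"

definition "covered m \<longleftrightarrow> (\<exists>\<sigma>\<in>T. in_cone a \<sigma> (pt m))"
definition "cell m = (SOME \<sigma>. \<sigma> \<in> T \<and> in_cone a \<sigma> (pt m))"
definition "hgt m = height a w (cell m) (pt m)"
text \<open>Serves finiteness: this sum of positive cell coordinates bounds each of them, so only
  finitely many covered points lie below a given value.\<close>

definition "deg m = height a (\<lambda>_. 1) (cell m) (pt m)"

lemma cell:
  assumes "covered m"
  shows "cell m \<in> T" "in_cone a (cell m) (pt m)" "is_basis a (cell m)" "feasible a w (cell m)"
proof -
  have "cell m \<in> T \<and> in_cone a (cell m) (pt m)"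
    unfolding cell_def by (rule someI_ex[of "\<lambda>\<sigma>. \<sigma> \<in> T \<and> in_cone a \<sigma> (pt m)"]) (use assms in \<open>unfold covered_def, blast\<close>)
  then show "cell m \<in> T" "in_cone a (cell m) (pt m)" "is_basis a (cell m)" "feasible a w (cell m)"
    using triangulation_feasible triangulation_is_basis by blast+
qed

lemma cell_eqI:
  assumes "\<sigma> \<in> T" "in_cone a \<sigma> (pt m)"
  shows "covered m" "cell m = \<sigma>"
proof -
  show "covered m" unfolding covered_def using assms by blast
  then show "cell m = \<sigma>" using assms cell triangulation_unique by blast
qed

text \<open>The cell of a point is the unique maximizer of the heights over T.\<close>

lemma height_less_hgt:
  assumes "\<sigma> \<in> T" "covered m" "\<sigma> \<noteq> cell m"
  shows "height a w \<sigma> (pt m) < hgt m"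
  unfolding hgt_def
proof (intro height_less_of_cone cell assms)
  show "feasible a w \<sigma>" using assms by (simp add: triangulation_feasible)
  have "cell m \<in> T" using assms cell by blast
  with assms show "range \<sigma> \<noteq> range (cell m)" unfolding triangulation_def by force
qed

lemma deg_le: "\<sigma> \<in> T \<Longrightarrow> covered m \<Longrightarrow> height a (\<lambda>_. 1) \<sigma> (pt m) \<le> deg m"
  unfolding deg_def
  by (intro height_le_of_cone cell triangulation_is_basis feasible_height_one_le[OF weight] triangulation_feasible)

lemma covered_of_nonneg:
  assumes "\<And>j. u j \<ge> 0" "pt m = (\<Sum>j\<in>UNIV. u j *\<^sub>R a j)"
  shows "covered m"
proof -
  obtain \<sigma> where "\<sigma> \<in> T" "in_cone a \<sigma> (pt m)"
    by (rule ex_triangulation_cone[OF weight point assms])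
  then show ?thesis by (rule cell_eqI)
qed

lemma covered_add_col:
  assumes "covered m"
  shows "covered (\<lambda>i. m i + A$i$k)"
proof -
  define \<sigma> where "\<sigma> = cell m"
  have \<sigma>: "in_cone a \<sigma> (pt m)" "is_basis a \<sigma>" using cell[OF assms] by (auto simp: \<sigma>_def)
  define c where "c = coords a \<sigma> (pt m)"
  have c: "c$i > 0" for i using \<sigma> by (simp add: in_cone_def c_def)
  have inj: "inj \<sigma>" using \<sigma>(2) by (rule is_basis_imp_inj)
  define u where "u j = (if j \<in> range \<sigma> then c $ (inv \<sigma> j) else 0) + (if j = k then 1 else 0)" for j
  have "(\<Sum>j\<in>UNIV. u j *\<^sub>R a j) = (\<Sum>j\<in>UNIV. if j \<in> range \<sigma> then c $ (inv \<sigma> j) *\<^sub>R a j else 0) + a k"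
    by (simp add: u_def scaleR_left_distrib sum.distrib if_distrib[of "\<lambda>x. x *\<^sub>R _"] cong: if_cong)
  also have "(\<Sum>j\<in>UNIV. if j \<in> range \<sigma> then c $ (inv \<sigma> j) *\<^sub>R a j else 0) = (\<Sum>j\<in>range \<sigma>. c $ (inv \<sigma> j) *\<^sub>R a j)"
    by (intro sum.mono_neutral_cong_right) auto
  also have "\<dots> = cmap a \<sigma> c" by (simp add: sum.reindex[OF inj] cmap_def inj)
  also have "\<dots> = pt m" by (simp add: c_def cmap_coords[OF \<sigma>(2)])
  finally have "pt (\<lambda>i. m i + A$i$k) = (\<Sum>j\<in>UNIV. u j *\<^sub>R a j)" by (simp add: lat_add_col)
  moreover have "u j \<ge> 0" for j using c by (simp add: u_def less_imp_le)
  ultimately show ?thesis by (intro covered_of_nonneg)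
qed

lemma finite_deg_le: "finite {m. covered m \<and> deg m \<le> N}"
proof -
  have "{m. covered m \<and> deg m \<le> N} \<subseteq>
    (\<Union>\<sigma>\<in>T. {m. \<forall>i. 0 \<le> coords a \<sigma> (pt m) $ i \<and> coords a \<sigma> (pt m) $ i \<le> N})"
  proof
    fix m assume "m \<in> {m. covered m \<and> deg m \<le> N}"
    then have m: "covered m" "deg m \<le> N" by auto
    have pos: "coords a (cell m) (pt m) $ i > 0" for i using cell(2)[OF m(1)] by (simp add: in_cone_def)
    have "coords a (cell m) (pt m) $ i \<le> deg m" for i
      unfolding deg_def height_def using pos
      by (simp, intro member_le_sum) (auto simp: less_imp_le)
    then show "m \<in> (\<Union>\<sigma>\<in>T. {m. \<forall>i. 0 \<le> coords a \<sigma> (pt m) $ i \<and> coords a \<sigma> (pt m) $ i \<le> N})"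
      using cell(1)[OF m(1)] pos m(2) by (auto intro!: bexI[of _ "cell m"] simp: less_imp_le intro: order_trans)
  qed
  then show ?thesis by (rule finite_subset) (auto intro!: finite_cell triangulation_is_basis)
qed

text \<open>Descent on \<psi>, the valuation of \<phi> plus \<open>hgt\<close>, inside a set of
  bounded \<open>deg\<close>. From a minimizer that is not standard one can step back along a column
  of its cell; the equation at the point m' reached then produces a point of nonzero \<phi> with
  smaller \<psi>, or with no larger \<psi> and smaller \<open>deg\<close>.\<close>

lemma solution_zero_covered:
  assumes sol: "is_solution A (\<lambda>x. x) \<phi>"
    and std: "\<And>b. b \<in> standard_points a w v \<Longrightarrow> \<phi> b = 0"
    and "covered m0"
  shows "\<phi> m0 = 0"
proof (rule ccontr)
  assume "\<phi> m0 \<noteq> 0"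
  define \<psi> where "\<psi> m = real_of_int (wval \<omega> (\<phi> m)) + hgt m" for m
  define V where "V = {m. covered m \<and> deg m \<le> deg m0 \<and> \<phi> m \<noteq> 0}"
  have finV: "finite V" unfolding V_def using finite_deg_le[of "deg m0"] by (rule rev_finite_subset) auto
  moreover have "V \<noteq> {}" using \<open>\<phi> m0 \<noteq> 0\<close> \<open>covered m0\<close> by (auto simp: V_def)
  ultimately obtain m1 where m1: "m1 \<in> V" "\<And>m'. m' \<in> V \<Longrightarrow> \<psi> m1 \<le> \<psi> m'"
    using finite_ex_minimizer[of V \<psi>] by blast
  \<comment> \<open>Ties in \<psi> are broken by \<open>deg\<close>, because the term containing
    \<phi> m' below only yields \<psi> m' \<le> \<psi> m.\<close>
  obtain m where m: "m \<in> {m\<in>V. \<psi> m = \<psi> m1}" "\<And>m'. m' \<in> {m\<in>V. \<psi> m = \<psi> m1} \<Longrightarrow> deg m \<le> deg m'"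
    using finite_ex_minimizer[of "{m\<in>V. \<psi> m = \<psi> m1}" deg] finV m1(1) by auto
  have mV: "m \<in> V" and min1: "\<And>m'. m' \<in> V \<Longrightarrow> \<psi> m \<le> \<psi> m'"
    and min2: "\<And>m'. m' \<in> V \<Longrightarrow> \<psi> m' \<le> \<psi> m \<Longrightarrow> deg m \<le> deg m'"
    using m m1 by (auto intro: antisym)
  have ins: "covered m" and \<phi>m: "\<phi> m \<noteq> 0" and degm: "deg m \<le> deg m0" using mV by (auto simp: V_def)
  define \<sigma> where "\<sigma> = cell m"
  note \<sigma> = cell[OF ins, folded \<sigma>_def]
  note b = \<sigma>(3)
  define c where "c = coords a \<sigma> (pt m)"
  have c: "c$i > 0" for i using \<sigma>(2) by (simp add: in_cone_def c_def)
  have "m \<notin> cell_points a v \<sigma>"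
    using std[of m] \<phi>m \<sigma>(1) by (auto simp: standard_points_def)
  then obtain i where i: "c$i \<ge> 1"
    using c by (auto simp: cell_points_def c_def less_imp_le not_less)
  let ?k = "\<sigma> i"
  define m' where "m' = (\<lambda>i'. m i' - A$i'$?k)"
  have pt': "pt m' = pt m - a ?k" by (simp add: m'_def lat_diff_col)
  have c': "coords a \<sigma> (pt m') = c - axis i 1"
    by (simp add: pt' linear_diff[OF linear_coords[OF b]] coords_col[OF b] c_def)
  have "cmap a \<sigma> (c - axis i 1) = pt m'" by (metis c' cmap_coords[OF b])
  \<comment> \<open>The value c_i = 1 is ruled out by genericity at m', so m' stays in the open cone
    of the same cell.\<close>
  then have "(c - axis i 1) $ i \<noteq> 0" using point[of m'] unfolding generic_point_def by blast
  then have cone': "in_cone a \<sigma> (pt m')"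
    using b c i by (auto simp: in_cone_def c' axis_def less_le)
  have ins': "covered m'" and cell': "cell m' = \<sigma>" using cell_eqI[OF \<sigma>(1) cone'] by auto
  have hgt': "hgt m = hgt m' + w ?k" and deg': "deg m = deg m' + 1"
    by (simp_all add: hgt_def deg_def cell' \<sigma>_def[symmetric] pt' height_simps[OF b] height_col[OF b])
  obtain l where l: "\<And>x. l \<bullet> x = coords a \<sigma> x $ i" using coords_functional[OF b] by blast
  have lk: "l \<bullet> a ?k = 1" by (simp add: l coords_col[OF b])
  have lrange: "l \<bullet> a j = 0" if "j \<in> range \<sigma>" "j \<noteq> ?k" for j
    using that by (auto simp: l coords_col[OF b] axis_def)
  have "l \<noteq> 0" using lk by auto
  then obtain i0 where i0: "l$i0 \<noteq> 0" by (auto simp: vec_eq_iff)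
  define q :: "('d, 'n) crat" where "q = slin (($) l) + rconst (- (l \<bullet> lat m'))"
  have q0: "q \<noteq> 0" unfolding q_def by (rule slin_plus_const_nonzero[of "($) l" i0, OF i0])
  define f where "f j = (if j = ?k then q * \<phi> m'
     else - (rconst (l \<bullet> a j) * kvar (XV j) * \<phi> (\<lambda>i. m' i + A$i$j)))" for j
  have "(\<Sum>j\<in>UNIV. rconst (l \<bullet> a j) * kvar (XV j) * \<phi> (\<lambda>i. m' i + A$i$j)) = q * \<phi> m'"
    using solution_linear_combination[OF sol, of l m'] by (simp add: q_def rconst_simps)
  \<comment> \<open>The functional l is 1 on column ?k and 0 on the other columns of the cell, which
    isolates \<phi> m; the factor q is a nonzero form in s and has valuation 0.\<close>
  then have e1: "kvar (XV ?k) * \<phi> m + (\<Sum>j\<in>UNIV - {?k}. rconst (l \<bullet> a j) * kvar (XV j) * \<phi> (\<lambda>i. m' i + A$i$j)) = q * \<phi> m'"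
    by (subst (asm) sum.remove[of _ ?k]) (auto simp: lk rconst_simps m'_def)
  have e2: "sum f UNIV = q * \<phi> m' - (\<Sum>j\<in>UNIV - {?k}. rconst (l \<bullet> a j) * kvar (XV j) * \<phi> (\<lambda>i. m' i + A$i$j))"
    by (subst sum.remove[of _ ?k]) (auto simp: f_def sum_negf)
  have "sum f UNIV = kvar (XV ?k) * \<phi> m" unfolding e2 e1[symmetric] by simp
  moreover have "kvar (XV ?k) * \<phi> m \<noteq> 0" using \<phi>m by simp
  ultimately obtain j where j: "f j \<noteq> 0" "wval \<omega> (f j) \<le> wval \<omega> (kvar (XV ?k) * \<phi> m)"
    using wval_sum_term[of UNIV f "kvar (XV ?k) * \<phi> m"] by auto
  then have jle: "wval \<omega> (f j) \<le> \<omega> ?k + wval \<omega> (\<phi> m)" using \<phi>m by (simp add: wval_mult wval_kvar_XV)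
  show False
  proof (cases "j = ?k")
    case True
    then have "\<phi> m' \<noteq> 0" using j by (auto simp: f_def)
    then have "wval \<omega> (f j) = wval \<omega> (\<phi> m')"
      using True q0 by (simp add: f_def wval_mult q_def wval_slin)
    then have "\<psi> m' \<le> \<psi> m" using jle hgt' by (simp add: \<psi>_def)
    moreover have "m' \<in> V" using \<open>\<phi> m' \<noteq> 0\<close> ins' deg' degm by (simp add: V_def)
    ultimately show False using min2[of m'] deg' by simp
  next
    case False
    define m'' where "m'' = (\<lambda>i. m' i + A$i$j)"
    have nz: "\<phi> m'' \<noteq> 0" "l \<bullet> a j \<noteq> 0" using j False by (auto simp: f_def m''_def rconst_simps)
    then have jr: "j \<notin> range \<sigma>" using lrange False by blast
    have "wval \<omega> (f j) = \<omega> j + wval \<omega> (\<phi> m'')"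
      using False nz by (simp add: f_def m''_def wval_uminus wval_mult wval_rconst wval_kvar_XV)
    then have le: "\<omega> j + wval \<omega> (\<phi> m'') \<le> \<omega> ?k + wval \<omega> (\<phi> m)" using jle by simp
    have ins'': "covered m''" unfolding m''_def by (rule covered_add_col[OF ins'])
    define \<tau> where "\<tau> = cell m''"
    note \<tau> = cell[OF ins'', folded \<tau>_def]
    have pt'': "pt m'' = pt m' + a j" by (simp add: m''_def lat_add_col)
    have h'': "hgt m'' = height a w \<tau> (pt m') + height a w \<tau> (a j)"
      by (simp add: hgt_def \<tau>_def[symmetric] pt'' height_simps[OF \<tau>(3)])
    \<comment> \<open>In the same cell the strict inequality at column j decides; in a different
      cell the height of \<tau> is strictly too small at m'.\<close>
    have "hgt m'' < hgt m' + w j"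
    proof (cases "\<tau> = \<sigma>")
      case True
      have "height a w \<sigma> (a j) < w j" using jr \<sigma>(4) by (simp add: feasible_def)
      moreover have "hgt m' = height a w \<sigma> (pt m')" by (simp add: hgt_def cell')
      ultimately show ?thesis unfolding h'' True by simp
    next
      case False
      then show ?thesis
        using height_less_hgt[OF \<tau>(1) ins'] feasible_height_le[OF \<tau>(4), of j] by (simp add: h'' cell')
    qed
    then have "\<psi> m'' < \<psi> m" using le hgt' by (simp add: \<psi>_def)
    \<comment> \<open>Closeness of the weight to a constant enters here: since deg m = deg m' + 1,
      the point m'' cannot leave V.\<close>
    moreover have "deg m'' \<le> deg m' + 1"
      using deg_le[OF \<tau>(1) ins'] feasible_height_one_le[OF weight \<tau>(4), of j]
      by (simp add: deg_def[of m''] \<tau>_def[symmetric] pt'' height_simps[OF \<tau>(3)])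
    then have "m'' \<in> V" using nz ins'' deg' degm by (simp add: V_def)
    ultimately show False using min1[of m''] by simp
  qed
qed

text \<open>A point outside the cone violates some inequality l. The equation contracted with l
  involves only neighbours m + a_j with l a_j > 0, where \<phi> vanishes by induction because they
  violate the inequalities less, while the factor of \<phi> m is a nonzero form in s.\<close>

theorem solution_zero:
  assumes sol: "is_solution A (\<lambda>x. x) \<phi>"
    and std: "\<And>b. b \<in> standard_points a w v \<Longrightarrow> \<phi> b = 0"
  shows "\<phi> m = 0"
proof -
  obtain F where F: "finite F" "\<And>l j. l \<in> F \<Longrightarrow> l \<bullet> a j \<ge> 0"
    "\<And>x. (\<And>l. l \<in> F \<Longrightarrow> l \<bullet> x \<ge> 0) \<Longrightarrow> \<exists>u. (\<forall>j. u j \<ge> 0) \<and> x = (\<Sum>j\<in>UNIV. u j *\<^sub>R a j)"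
    using finitely_generated_cone_halfspaces[of a] by blast
  \<comment> \<open>At most the least positive value of a normal on a column (1 is inserted so that
    the set is nonempty). In units of \<delta>, each relevant step reduces the violation of l by at
    least 1, so the rounded sum \<mu> drops.\<close>
  obtain \<delta> where \<delta>: "\<delta> > 0" "\<And>l j. l \<in> F \<Longrightarrow> l \<bullet> a j > 0 \<Longrightarrow> l \<bullet> a j \<ge> \<delta>"
  proof -
    let ?D = "insert 1 ((\<lambda>(l, j). l \<bullet> a j) ` {(l, j). l \<in> F \<and> l \<bullet> a j > 0})"
    have "finite {(l, j). l \<in> F \<and> l \<bullet> a j > 0}"
      by (rule finite_subset[of _ "F \<times> UNIV"]) (use F(1) in auto)
    then have fin: "finite ?D" by simp
    then have "Min ?D \<in> ?D" by (intro Min_in) auto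
    then have "Min ?D > 0" by auto
    moreover have "Min ?D \<le> l \<bullet> a j" if "l \<in> F" "l \<bullet> a j > 0" for l j
      using fin that by (intro Min_le) auto
    ultimately show thesis using that by blast
  qed
  define \<mu> where "\<mu> m = (\<Sum>l\<in>F. nat \<lceil>- (l \<bullet> pt m) / \<delta>\<rceil>)" for m
  show ?thesis
  proof (induct "\<mu> m" arbitrary: m rule: less_induct)
    case less
    show ?case
    proof (cases "\<forall>l\<in>F. l \<bullet> pt m \<ge> 0")
      case True
      then obtain u where "\<forall>j. u j \<ge> 0" "pt m = (\<Sum>j\<in>UNIV. u j *\<^sub>R a j)" using F(3) by blast
      then show ?thesis by (intro solution_zero_covered[OF sol std] covered_of_nonneg[of u]) auto
    next
      case False
      then obtain l where l: "l \<in> F" "l \<bullet> pt m < 0" by auto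
      have "rconst (l \<bullet> a j) * kvar (XV j) * \<phi> (\<lambda>i. m i + A$i$j) = 0" for j
      proof (cases "l \<bullet> a j = 0")
        case False
        define m' where "m' = (\<lambda>i. m i + A$i$j)"
        have pos: "l \<bullet> a j > 0" using F(2)[OF l(1), of j] False by simp
        have pt': "pt m' = pt m + a j" by (simp add: m'_def lat_add_col)
        have "\<mu> m' < \<mu> m" unfolding \<mu>_def
        proof (rule sum_strict_mono_ex1[OF F(1)])
          show "\<forall>l\<in>F. nat \<lceil>- (l \<bullet> pt m') / \<delta>\<rceil> \<le> nat \<lceil>- (l \<bullet> pt m) / \<delta>\<rceil>"
          proof
            fix l assume "l \<in> F"
            then have "- (l \<bullet> pt m') / \<delta> \<le> - (l \<bullet> pt m) / \<delta>"
              using F(2)[of l j] \<delta>(1) by (intro divide_right_mono) (simp_all add: pt' inner_add_right)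
            then show "nat \<lceil>- (l \<bullet> pt m') / \<delta>\<rceil> \<le> nat \<lceil>- (l \<bullet> pt m) / \<delta>\<rceil>"
              by (intro nat_mono ceiling_mono)
          qed
          have "l \<bullet> a j / \<delta> \<ge> 1" using \<delta> pos l(1) by simp
          then have "- (l \<bullet> pt m') / \<delta> \<le> - (l \<bullet> pt m) / \<delta> - 1"
            by (simp add: pt' inner_add_right diff_divide_distrib add_divide_distrib)
          then have "\<lceil>- (l \<bullet> pt m') / \<delta>\<rceil> \<le> \<lceil>- (l \<bullet> pt m) / \<delta>\<rceil> - 1"
            by (metis ceiling_diff_one ceiling_mono)
          moreover have "\<lceil>- (l \<bullet> pt m) / \<delta>\<rceil> > 0" using l(2) \<delta>(1) by (simp add: divide_pos_pos divide_neg_pos)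
          ultimately show "\<exists>l\<in>F. nat \<lceil>- (l \<bullet> pt m') / \<delta>\<rceil> < nat \<lceil>- (l \<bullet> pt m) / \<delta>\<rceil>"
            by (intro bexI[OF _ l(1)]) linarith
        qed
        then have "\<phi> m' = 0" by (rule less)
        then show ?thesis by (simp add: m'_def)
      qed (simp add: rconst_simps)
      then have "(\<Sum>j\<in>UNIV. rconst (l \<bullet> a j) * kvar (XV j) * \<phi> (\<lambda>i. m i + A$i$j)) = 0"
        by (intro sum.neutral ballI)
      then have eq: "(slin (($) l) - rconst (l \<bullet> lat m)) * \<phi> m = 0"
        unfolding solution_linear_combination[OF sol, of l m] .
      have "l \<noteq> 0" using l(2) by auto
      then obtain i0 where "l$i0 \<noteq> 0" by (auto simp: vec_eq_iff)
      then have "slin (($) l) + rconst (- (l \<bullet> lat m)) \<noteq> (0 :: ('d, 'n) crat)"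
        by (rule slin_plus_const_nonzero[of "($) l" i0])
      with eq show ?thesis by (simp add: rconst_simps)
    qed
  qed
qed

end

section \<open>Series solutions\<close>

text \<open>\<open>inv_gamma \<alpha> N\<close> plays the role of \<open>\<Gamma>(\<alpha> + 1) / \<Gamma>(\<alpha> + N + 1)\<close>; for \<open>\<alpha> = 0\<close> it is \<open>1 / N!\<close>, and \<open>0\<close> for negative \<open>N\<close>.\<close>

definition inv_gamma :: "'f::field \<Rightarrow> int \<Rightarrow> 'f" where
  "inv_gamma \<alpha> N = (if N \<ge> 0 then inverse (\<Prod>k=1..nat N. \<alpha> + of_nat k) else (\<Prod>k<nat (- N). \<alpha> - of_nat k))"

lemma inv_gamma_0 [simp]: "inv_gamma \<alpha> 0 = 1"
  by (simp add: inv_gamma_def)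



lemma inv_gamma_rec:
  assumes "\<And>k. k > 0 \<Longrightarrow> \<alpha> + of_nat k \<noteq> 0"
  shows "inv_gamma \<alpha> (N - 1) = (\<alpha> + of_int N) * inv_gamma \<alpha> N"
proof (cases "N \<ge> 1")
  case True
  then obtain n where n: "N = int (Suc n)" by (metis One_nat_def Suc_le_D int_nat_eq nat_le_iff nonneg_int_cases of_nat_1 order_trans zero_le_one zle_int)
  have "\<alpha> + of_nat (Suc n) \<noteq> 0" using assms[of "Suc n"] by blast
  moreover have "(\<Prod>k=1..Suc n. \<alpha> + of_nat k) = (\<alpha> + of_nat (Suc n)) * (\<Prod>k=1..n. \<alpha> + of_nat k)"
    by (simp add: mult.commute)
  moreover have "nat (int (Suc n) - 1) = n" "nat (int (Suc n)) = Suc n" "int (Suc n) - 1 \<ge> 0" by simp_all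
  ultimately show ?thesis unfolding n inv_gamma_def
    by (simp only: if_True of_nat_0_le_iff inverse_mult_distrib of_int_of_nat_eq) simp
next
  case False
  then obtain n where n: "N = - int n" by (metis add.inverse_inverse int_one_le_iff_zero_less neg_0_le_iff_le nonneg_int_cases not_less)
  show ?thesis unfolding n by (cases "n = 0") (simp_all add: inv_gamma_def nat_add_distrib mult.commute)
qed

lemma of_nat_crat_nonzero: "k > 0 \<Longrightarrow> (of_nat k :: ('d::linorder, 'n::linorder) crat) \<noteq> 0"
  using rconst_eq_0_iff[of "real k"] rconst_simps(8)[of "int k"] by (metis of_int_of_nat_eq of_nat_0_less_iff of_nat_eq_0_iff less_irrefl)

context generic_data
begin

lemma standard_points_covered:
  assumes "b \<in> standard_points a w v"
  shows "covered b" "b \<in> cell_points a v (cell b)"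
proof -
  obtain \<sigma> where \<sigma>: "\<sigma> \<in> T" "b \<in> cell_points a v \<sigma>" using assms by (auto simp: standard_points_def)
  have basis: "is_basis a \<sigma>" using \<sigma>(1) by (rule triangulation_is_basis)
  have "cmap a \<sigma> (coords a \<sigma> (pt b)) = pt b" by (rule cmap_coords[OF basis])
  then have "coords a \<sigma> (pt b) $ i \<noteq> 0" for i using point[of b] unfolding generic_point_def by blast
  then have "in_cone a \<sigma> (pt b)" using \<sigma>(2) basis by (auto simp: in_cone_def cell_points_def less_le)
  from cell_eqI[OF \<sigma>(1) this] show "covered b" "b \<in> cell_points a v (cell b)" using \<sigma>(2) by auto
qed

end

text \<open>The Gamma series attached to a cone \<sigma> and a lattice point b0, normalized so that
  its value at b0 starts with 1.\<close>

locale series_solution = generic_data A \<omega> v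
  for A :: "int^('n::{finite,linorder})^('d::{finite,linorder})" and \<omega> v +
  fixes \<sigma> :: "'d \<Rightarrow> 'n" and b0 :: "'d \<Rightarrow> int"
  assumes \<sigma>: "feasible a w \<sigma>"
begin

lemma basis: "is_basis a \<sigma>"
  using \<sigma> by (simp add: feasible_def)

lemma inj_\<sigma>: "inj \<sigma>"
  using basis by (rule is_basis_imp_inj)

definition "L k = (SOME l. \<forall>x. l \<bullet> x = coords a \<sigma> x $ k)"

lemma L: "L k \<bullet> x = coords a \<sigma> x $ k"
proof -
  have "\<exists>l. \<forall>x. l \<bullet> x = coords a \<sigma> x $ k" using coords_functional[OF basis] by metis
  then have "\<forall>x. L k \<bullet> x = coords a \<sigma> x $ k" unfolding L_def by (rule someI_ex)
  then show ?thesis by blast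
qed

lemma L_dual: "(\<Sum>k\<in>UNIV. (L k \<bullet> x) * a (\<sigma> k) $ i) = x $ i"
proof -
  have "(\<Sum>k\<in>UNIV. coords a \<sigma> x $ k *\<^sub>R a (\<sigma> k)) $ i = x $ i"
    using cmap_coords[OF basis, of x] by (simp add: cmap_def)
  then show ?thesis by (simp add: L)
qed

text \<open>The coordinates of s - b0 in the basis \<sigma>.\<close>

definition alpha0 :: "'d \<Rightarrow> ('d, 'n) crat" where
  "alpha0 k = slin (($) (L k)) + rconst (- (L k \<bullet> lat b0))"

text \<open>The starting exponent vector of the Gamma series, supported on \<sigma> and satisfying A
  \<alpha> = s - b0.\<close>

definition alpha :: "'n \<Rightarrow> ('d, 'n) crat" where
  "alpha j = (if j \<in> range \<sigma> then alpha0 (inv \<sigma> j) else 0)"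

lemma alpha_plus_nat_nonzero:
  assumes "k > 0"
  shows "alpha j + of_nat k \<noteq> 0"
proof (cases "j \<in> range \<sigma>")
  case True
  let ?i = "inv \<sigma> j"
  have "L ?i \<bullet> a (\<sigma> ?i) = 1" by (simp add: L coords_col[OF basis])
  then have "L ?i \<noteq> 0" by auto
  then obtain i0 where i0: "L ?i $ i0 \<noteq> 0" by (auto simp: vec_eq_iff)
  have "slin (($) (L ?i)) + rconst (- (L ?i \<bullet> lat b0) + real k) \<noteq> (0 :: ('d, 'n) crat)"
    by (rule slin_plus_const_nonzero[of "($) (L ?i)" i0, OF i0])
  moreover have "(rconst (real k) :: ('d, 'n) crat) = of_nat k"
    using rconst_simps(8)[of "int k"] by simp
  moreover have "alpha j = slin (($) (L ?i)) + rconst (- (L ?i \<bullet> lat b0))"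
    using True by (simp add: alpha_def alpha0_def)
  ultimately show ?thesis by (simp only: rconst_simps(3) add.assoc) blast
qed (use assms of_nat_crat_nonzero in \<open>simp add: alpha_def\<close>)

lemma sum_A_alpha: "(\<Sum>j\<in>UNIV. of_int (A$i$j) * alpha j) = kvar (SV i) - of_int (b0 i)"
proof -
  have "(\<Sum>j\<in>UNIV. of_int (A$i$j) * alpha j) = (\<Sum>j\<in>range \<sigma>. of_int (A$i$j) * alpha j)"
    by (intro sum.mono_neutral_right) (auto simp: alpha_def)
  also have "\<dots> = (\<Sum>k\<in>UNIV. of_int (A$i$(\<sigma> k)) * alpha0 k)"
    by (simp add: sum.reindex[OF inj_\<sigma>] alpha_def inj_\<sigma>)
  also have "\<dots> = (\<Sum>k\<in>UNIV. \<Sum>i'\<in>UNIV. rconst (a (\<sigma> k) $ i * L k $ i') * kvar (SV i'))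
      - (\<Sum>k\<in>UNIV. rconst (a (\<sigma> k) $ i * (L k \<bullet> lat b0)))"
    by (simp add: alpha0_def slin_def col_real_def rconst_simps distrib_left right_diff_distrib sum.distrib sum_subtractf sum_negf
        sum_distrib_left mult.assoc)
  also have "(\<Sum>k\<in>UNIV. \<Sum>i'\<in>UNIV. rconst (a (\<sigma> k) $ i * L k $ i') * kvar (SV i') :: ('d, 'n) crat)
    = (\<Sum>i'\<in>UNIV. (if i' = i then kvar (SV i) else 0))"
  proof (subst sum.swap, rule sum.cong[OF refl])
    fix i'
    have "(\<Sum>k\<in>UNIV. a (\<sigma> k) $ i * L k $ i') = (if i' = i then 1 else 0)"
    proof -
      have "L k \<bullet> axis i' 1 = L k $ i'" for k by (simp add: inner_axis)
      moreover have "axis i' (1::real) $ i = (if i' = i then 1 else 0)" by (simp add: axis_def)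
      ultimately show ?thesis using L_dual[of "axis i' 1" i] by (simp only: mult.commute)
    qed
    then show "(\<Sum>k\<in>UNIV. rconst (a (\<sigma> k) $ i * L k $ i') * kvar (SV i') :: ('d, 'n) crat) = (if i' = i then kvar (SV i) else 0)"
      by (simp add: rconst_simps(1,2) flip: sum_distrib_right rconst_simps(7))
  qed
  also have "\<dots> = kvar (SV i)" by simp
  also have "(\<Sum>k\<in>UNIV. rconst (a (\<sigma> k) $ i * (L k \<bullet> lat b0)) :: ('d, 'n) crat) = of_int (b0 i)"
    using L_dual[of "lat b0" i] by (simp add: mult.commute lat_def rconst_simps(8) flip: rconst_simps(7))
  finally show ?thesis .
qed

text \<open>The usual term x^(\<alpha> + u) / \<Gamma>(\<alpha> + u + 1) divided by x^\<alpha> /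
  \<Gamma>(\<alpha> + 1). This removes the powers whose exponents depend on s and leaves an element
  of K.\<close>

definition term_of :: "('n \<Rightarrow> int) \<Rightarrow> ('d, 'n) crat" where
  "term_of u = (\<Prod>j\<in>UNIV. inv_gamma (alpha j) (u j) * kvar (XV j) powi (u j))"

definition wt :: "('n \<Rightarrow> int) \<Rightarrow> int" where
  "wt u = (\<Sum>j\<in>UNIV. \<omega> j * u j)"

text \<open>The exponents contributing to t^e at the point m. Off \<sigma>, where \<alpha>_j = 0, a
  negative u_j would produce a zero factor anyway; excluding it makes the set finite.\<close>

definition S :: "('d \<Rightarrow> int) \<Rightarrow> int \<Rightarrow> ('n \<Rightarrow> int) set" where
  "S m e = {u. (\<forall>i. (\<Sum>j\<in>UNIV. A$i$j * u j) = b0 i - m i) \<and> wt u = e \<and> (\<forall>j. j \<notin> range \<sigma> \<longrightarrow> u j \<ge> 0)}"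

text \<open>The reduced cost of column j in the sense of linear programming.\<close>

definition gap :: "'n \<Rightarrow> real" where
  "gap j = w j - height a w \<sigma> (a j)"

lemma gap: "j \<in> range \<sigma> \<Longrightarrow> gap j = 0" "j \<notin> range \<sigma> \<Longrightarrow> gap j > 0"
  using \<sigma> by (auto simp: gap_def height_col[OF basis] feasible_def)

lemma S_vector:
  assumes "u \<in> S m e"
  shows "(\<Sum>j\<in>UNIV. real_of_int (u j) *\<^sub>R a j) = lat b0 - lat m"
proof -
  have "(\<Sum>j\<in>UNIV. real_of_int (A$i$j) * real_of_int (u j)) = real_of_int (b0 i) - real_of_int (m i)" for i
  proof -
    have "(\<Sum>j\<in>UNIV. A$i$j * u j) = b0 i - m i" using assms by (simp add: S_def)
    then have "real_of_int (\<Sum>j\<in>UNIV. A$i$j * u j) = real_of_int (b0 i - m i)" by simp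
    then show ?thesis by simp
  qed
  then show ?thesis by (simp add: vec_eq_iff lat_def col_real_def mult.commute)
qed

text \<open>Split \<omega>_j into the height of a_j and \<open>gap j\<close>: the first part depends
  on A u only. The weight thus exceeds the height of b0 - m by a nonnegative combination of gaps,
  which bounds the orders from below and the exponents off \<sigma> from above.\<close>

lemma S_weight:
  assumes "u \<in> S m e"
  shows "real_of_int e = height a w \<sigma> (lat b0 - lat m) + (\<Sum>j\<in>UNIV. real_of_int (u j) * gap j)"
proof -
  have "height a w \<sigma> (lat b0 - lat m) = (\<Sum>j\<in>UNIV. real_of_int (u j) * height a w \<sigma> (a j))"
    by (simp add: S_vector[OF assms, symmetric] height_simps[OF basis])
  moreover have "real_of_int e = (\<Sum>j\<in>UNIV. real_of_int (u j) * w j)"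
    using assms by (auto simp: S_def wt_def mult.commute)
  ultimately show ?thesis by (simp add: gap_def right_diff_distrib sum_subtractf)
qed

lemma S_gap_nonneg:
  assumes "u \<in> S m e"
  shows "real_of_int (u j) * gap j \<ge> 0"
  using assms gap[of j] by (cases "j \<in> range \<sigma>") (auto simp: S_def intro!: mult_nonneg_nonneg)

lemma S_weight_ge: "u \<in> S m e \<Longrightarrow> real_of_int e \<ge> height a w \<sigma> (lat b0 - lat m)"
  using S_weight S_gap_nonneg by (simp add: sum_nonneg)

lemma S_cmap:
  assumes "u \<in> S m e" "\<And>j. j \<notin> range \<sigma> \<Longrightarrow> u j = 0"
  shows "cmap a \<sigma> (\<chi> k. real_of_int (u (\<sigma> k))) = lat b0 - lat m"
proof -
  have "(\<Sum>j\<in>UNIV. real_of_int (u j) *\<^sub>R a j) = (\<Sum>j\<in>range \<sigma>. real_of_int (u j) *\<^sub>R a j)"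
    using assms(2) by (intro sum.mono_neutral_right) auto
  then show ?thesis using S_vector[OF assms(1)] by (simp add: sum.reindex[OF inj_\<sigma>] cmap_def)
qed

text \<open>For fixed e the positive gaps bound u off \<sigma>; on \<sigma> it is then determined,
  as these columns form a basis.\<close>

lemma finite_S: "finite (S m e)"
proof -
  define K where "K = real_of_int e - height a w \<sigma> (lat b0 - lat m)"
  define R where "R u = (\<lambda>j. if j \<in> range \<sigma> then 0 else u j)" for u :: "'n \<Rightarrow> int"
  have "inj_on R (S m e)"
  proof (rule inj_onI)
    fix u u' assume u: "u \<in> S m e" "u' \<in> S m e" "R u = R u'"
    have off: "u j = u' j" if "j \<notin> range \<sigma>" for j using fun_cong[OF u(3), of j] that by (simp add: R_def)
    have "(\<Sum>j\<in>UNIV. real_of_int (u j - u' j) *\<^sub>R a j) = 0"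
      using S_vector[OF u(1)] S_vector[OF u(2)] by (simp add: scaleR_left_diff_distrib sum_subtractf)
    moreover have "(\<Sum>j\<in>UNIV. real_of_int (u j - u' j) *\<^sub>R a j) = (\<Sum>j\<in>range \<sigma>. real_of_int (u j - u' j) *\<^sub>R a j)"
      using off by (intro sum.mono_neutral_right) auto
    ultimately have "cmap a \<sigma> (\<chi> k. real_of_int (u (\<sigma> k) - u' (\<sigma> k))) = cmap a \<sigma> 0"
      by (simp add: sum.reindex[OF inj_\<sigma>] cmap_def)
    then have "(\<chi> k. real_of_int (u (\<sigma> k) - u' (\<sigma> k))) = 0"
      by (rule injD[OF inj_cmap[OF basis]])
    then have "u (\<sigma> k) = u' (\<sigma> k)" for k by (simp add: vec_eq_iff)
    with off show "u = u'" by (metis ext rangeE)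
  qed
  moreover have "R ` S m e \<subseteq> (\<Pi>\<^sub>E j\<in>UNIV. {0..\<lceil>K / gap j\<rceil>} \<union> {0})"
  proof
    fix r assume "r \<in> R ` S m e"
    then obtain u where u: "u \<in> S m e" "r = R u" by blast
    have "r j \<in> {0..\<lceil>K / gap j\<rceil>} \<union> {0}" for j
    proof (cases "j \<in> range \<sigma>")
      case False
      then have "u j \<ge> 0" using u(1) by (simp add: S_def)
      have "real_of_int (u j) * gap j \<le> (\<Sum>j\<in>UNIV. real_of_int (u j) * gap j)"
        using S_gap_nonneg[OF u(1)] by (intro member_le_sum) auto
      also have "\<dots> = K" using S_weight[OF u(1)] by (simp add: K_def)
      finally have "real_of_int (u j) \<le> K / gap j" using gap(2)[OF False] by (simp add: pos_le_divide_eq)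
      then have "u j \<le> \<lceil>K / gap j\<rceil>" by (metis ceiling_mono ceiling_of_int)
      then show ?thesis using \<open>u j \<ge> 0\<close> False by (simp add: u(2) R_def)
    qed (simp add: u(2) R_def)
    then show "r \<in> (\<Pi>\<^sub>E j\<in>UNIV. {0..\<lceil>K / gap j\<rceil>} \<union> {0})" by (simp add: PiE_iff)
  qed
  then have "finite (R ` S m e)" by (rule finite_subset) (auto intro!: finite_PiE)
  ultimately show ?thesis by (rule finite_imageD[rotated])
qed

definition coef :: "('d \<Rightarrow> int) \<Rightarrow> int \<Rightarrow> ('d, 'n) crat" where
  "coef m e = (\<Sum>u\<in>S m e. term_of u)"

definition \<Phi> :: "('d \<Rightarrow> int) \<Rightarrow> ('d, 'n) crat fls" where
  "\<Phi> m = Abs_fls (coef m)"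

lemma coef_eq_0:
  assumes "real_of_int e < height a w \<sigma> (lat b0 - lat m)"
  shows "coef m e = 0"
proof -
  have "S m e = {}" using S_weight_ge assms by force
  then show ?thesis by (simp add: coef_def)
qed

lemma nth_\<Phi>: "fls_nth (\<Phi> m) e = coef m e"
  unfolding \<Phi>_def
proof (rule nth_Abs_fls_lower_bound[of "\<lfloor>height a w \<sigma> (lat b0 - lat m)\<rfloor>"], intro allI impI)
  fix n assume "n < \<lfloor>height a w \<sigma> (lat b0 - lat m)\<rfloor>"
  then have "real_of_int n < height a w \<sigma> (lat b0 - lat m)" by linarith
  then show "coef m n = 0" by (rule coef_eq_0)
qed

lemma term_of_diff_unitvec:
  "kvar (XV j) * term_of (\<lambda>k. u k - unitvec j k) = (alpha j + of_int (u j)) * term_of u"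
proof -
  let ?f = "\<lambda>u j. inv_gamma (alpha j) (u j) * kvar (XV j) powi (u j) :: ('d, 'n) crat"
  have "term_of (\<lambda>k. u k - unitvec j k) = ?f (\<lambda>k. u k - unitvec j k) j * (\<Prod>k\<in>UNIV - {j}. ?f (\<lambda>k. u k - unitvec j k) k)"
    unfolding term_of_def by (rule prod.remove) auto
  also have "(\<Prod>k\<in>UNIV - {j}. ?f (\<lambda>k. u k - unitvec j k) k) = (\<Prod>k\<in>UNIV - {j}. ?f u k)"
    by (intro prod.cong) (auto simp: unitvec_def)
  also have "?f (\<lambda>k. u k - unitvec j k) j = inv_gamma (alpha j) (u j - 1) * kvar (XV j) powi (u j - 1)"
    by (simp add: unitvec_def)
  also have "inv_gamma (alpha j) (u j - 1) = (alpha j + of_int (u j)) * inv_gamma (alpha j) (u j)"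
    by (rule inv_gamma_rec) (rule alpha_plus_nat_nonzero)
  finally have "kvar (XV j) * term_of (\<lambda>k. u k - unitvec j k)
    = (alpha j + of_int (u j)) * (inv_gamma (alpha j) (u j) * (kvar (XV j) * kvar (XV j) powi (u j - 1)) * (\<Prod>k\<in>UNIV - {j}. ?f u k))"
    by (simp add: mult_ac)
  also have "kvar (XV j) * kvar (XV j) powi (u j - 1) = (kvar (XV j) powi (u j) :: ('d, 'n) crat)"
    by (simp add: power_int_diff)
  also have "?f u j * (\<Prod>k\<in>UNIV - {j}. ?f u k) = term_of u"
    unfolding term_of_def by (rule prod.remove[symmetric]) auto
  finally show ?thesis .
qed

text \<open>Reindexing by u \<mapsto> u - e_j. Off \<sigma> the terms with u_j = 0 have no
  counterpart on the left, but their factor \<alpha>_j + u_j is 0.\<close>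

lemma coef_shift:
  "kvar (XV j) * coef (\<lambda>i. m i + A$i$j) (e - \<omega> j) = (\<Sum>u\<in>S m e. (alpha j + of_int (u j)) * term_of u)"
proof -
  let ?g = "\<lambda>u k. u k - unitvec j k :: int"
  let ?S' = "{u \<in> S m e. j \<notin> range \<sigma> \<longrightarrow> u j \<ge> 1}"
  have sumA: "(\<Sum>k\<in>UNIV. A$i$k * ?g u k) = (\<Sum>k\<in>UNIV. A$i$k * u k) - A$i$j" for i u
  proof -
    have "(\<Sum>k\<in>UNIV. A$i$k * ?g u k) = (\<Sum>k\<in>UNIV. A$i$k * u k - (if k = j then A$i$j else 0))"
      by (intro sum.cong refl) (auto simp: unitvec_def algebra_simps)
    then show ?thesis by (simp add: sum_subtractf)
  qed
  have wtg: "wt (?g u) = wt u - \<omega> j" for u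
  proof -
    have "wt (?g u) = (\<Sum>k\<in>UNIV. \<omega> k * u k - (if k = j then \<omega> j else 0))"
      unfolding wt_def by (intro sum.cong refl) (auto simp: unitvec_def algebra_simps)
    then show ?thesis by (simp add: sum_subtractf wt_def)
  qed
  have img: "S (\<lambda>i. m i + A$i$j) (e - \<omega> j) = ?g ` ?S'"
  proof (intro equalityI subsetI)
    fix u assume u: "u \<in> S (\<lambda>i. m i + A$i$j) (e - \<omega> j)"
    define u' where "u' = (\<lambda>k. u k + unitvec j k)"
    have gu: "?g u' = u" by (simp add: u'_def)
    have "(\<Sum>k\<in>UNIV. A$i$k * u' k) = b0 i - m i" for i
    proof -
      have "(\<Sum>k\<in>UNIV. A$i$k * u k) = b0 i - (m i + A$i$j)" using u by (simp add: S_def)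
      moreover have "(\<Sum>k\<in>UNIV. A$i$k * u k) = (\<Sum>k\<in>UNIV. A$i$k * u' k) - A$i$j"
        using sumA[of i u'] by (simp add: u'_def)
      ultimately show ?thesis by simp
    qed
    moreover have "wt u' = e" using u wtg[of u'] unfolding gu by (simp add: S_def)
    moreover have "u' k \<ge> 0" if "k \<notin> range \<sigma>" for k using u that by (simp add: S_def u'_def unitvec_def)
    moreover have "u' j \<ge> 1" if "j \<notin> range \<sigma>" using u that by (simp add: S_def u'_def unitvec_def)
    ultimately have "u' \<in> ?S'" by (simp add: S_def)
    then show "u \<in> ?g ` ?S'" by (intro image_eqI[of u ?g u']) (simp_all only: gu)
  next
    fix u assume "u \<in> ?g ` ?S'"
    then obtain u' where u': "u' \<in> S m e" "j \<notin> range \<sigma> \<longrightarrow> u' j \<ge> 1" "u = ?g u'" by blast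
    have nn: "u k \<ge> 0" if "k \<notin> range \<sigma>" for k
    proof -
      have "u' k \<ge> 0" using u'(1) that by (simp add: S_def)
      then show ?thesis using u'(2) that by (cases "k = j") (simp_all add: u'(3) unitvec_def)
    qed
    have "(\<Sum>k\<in>UNIV. A$i$k * u k) = b0 i - (m i + A$i$j)" for i
    proof -
      have "(\<Sum>k\<in>UNIV. A$i$k * u' k) = b0 i - m i" using u'(1) by (simp add: S_def)
      then show ?thesis unfolding u'(3) sumA by simp
    qed
    moreover have "wt u = e - \<omega> j" unfolding u'(3) wtg using u'(1) by (simp add: S_def)
    ultimately show "u \<in> S (\<lambda>i. m i + A$i$j) (e - \<omega> j)" unfolding S_def using nn by blast
  qed
  have inj: "inj_on ?g ?S'"
  proof (rule inj_onI)
    fix u u' assume "?g u = ?g u'"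
    then have "u k - unitvec j k = u' k - unitvec j k" for k by (rule fun_cong)
    then show "u = u'" by (simp add: fun_eq_iff)
  qed
  have "kvar (XV j) * coef (\<lambda>i. m i + A$i$j) (e - \<omega> j) = (\<Sum>u\<in>?S'. kvar (XV j) * term_of (?g u))"
    unfolding coef_def img by (simp add: sum.reindex[OF inj] sum_distrib_left)
  also have "\<dots> = (\<Sum>u\<in>?S'. (alpha j + of_int (u j)) * term_of u)"
    by (intro sum.cong refl term_of_diff_unitvec)
  also have "\<dots> = (\<Sum>u\<in>S m e. (alpha j + of_int (u j)) * term_of u)"
  proof (intro sum.mono_neutral_left finite_S ballI)
    fix u assume u: "u \<in> S m e - ?S'"
    then have j: "j \<notin> range \<sigma>" and "\<not> u j \<ge> 1" by blast+
    moreover have "u j \<ge> 0" using u j by (simp add: S_def)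
    ultimately have "j \<notin> range \<sigma>" "u j = 0" by simp_all
    then show "(alpha j + of_int (u j)) * term_of u = 0" by (simp add: alpha_def)
  qed auto
  finally show ?thesis .
qed

text \<open>In the coefficient of t^e every term acquires a component of the factor A (\<alpha> + u)
  = (s - b0) + (b0 - m) = s - m.\<close>

lemma \<Phi>_solution: "is_solution A (weight_embedding \<omega>) \<Phi>"
  unfolding is_solution_def
proof (intro allI fls_eqI)
  fix i m e
  have of_int_fls: "of_int z = tmon (of_int z :: ('d, 'n) crat) 0" for z
    by (simp add: ring_map_simps(11)[OF ring_map_tmon_0])
  have "fls_nth (\<Sum>j\<in>UNIV. of_int (A$i$j) * weight_embedding \<omega> (kvar (XV j)) * \<Phi> (\<lambda>i'. m i' + A$i'$j)) e
    = (\<Sum>j\<in>UNIV. of_int (A$i$j) * (kvar (XV j) * coef (\<lambda>i'. m i' + A$i'$j) (e - \<omega> j)))"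
    by (simp add: fls_nth_sum of_int_fls weight_embedding_kvar tmon_mult nth_tmon_times nth_\<Phi> mult.assoc)
  also have "\<dots> = (\<Sum>j\<in>UNIV. \<Sum>u\<in>S m e. of_int (A$i$j) * (alpha j + of_int (u j)) * term_of u)"
    by (simp add: coef_shift sum_distrib_left mult.assoc)
  also have "\<dots> = (\<Sum>u\<in>S m e. (\<Sum>j\<in>UNIV. of_int (A$i$j) * (alpha j + of_int (u j))) * term_of u)"
    by (subst sum.swap) (simp add: sum_distrib_right)
  also have "\<dots> = (\<Sum>u\<in>S m e. (kvar (SV i) - of_int (m i)) * term_of u)"
  proof (intro sum.cong refl arg_cong2[of _ _ _ _ "(*)"])
    fix u assume "u \<in> S m e"
    then have "(\<Sum>j\<in>UNIV. A$i$j * u j) = b0 i - m i" by (simp add: S_def)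
    then have "(\<Sum>j\<in>UNIV. of_int (A$i$j) * of_int (u j) :: ('d, 'n) crat) = of_int (b0 i) - of_int (m i)"
      by (metis (no_types, lifting) of_int_diff of_int_mult of_int_sum sum.cong)
    then show "(\<Sum>j\<in>UNIV. of_int (A$i$j) * (alpha j + of_int (u j))) = kvar (SV i) - of_int (m i)"
      by (simp add: distrib_left sum.distrib sum_A_alpha)
  qed
  also have "\<dots> = (kvar (SV i) - of_int (m i)) * coef m e" by (simp add: coef_def sum_distrib_left)
  also have "\<dots> = fls_nth ((weight_embedding \<omega> (kvar (SV i)) - of_int (m i)) * \<Phi> m) e"
    by (simp add: of_int_fls weight_embedding_kvar nth_tmon_times nth_\<Phi> flip: ring_map_simps(6)[OF ring_map_tmon_0])
  finally show "fls_nth (\<Sum>j\<in>UNIV. of_int (A$i$j) * weight_embedding \<omega> (kvar (XV j)) * \<Phi> (\<lambda>i'. m i' + A$i'$j)) e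
    = fls_nth ((weight_embedding \<omega> (kvar (SV i)) - of_int (m i)) * \<Phi> m) e" .
qed

text \<open>Attaining the lower bound forces each nonnegative product of u_j with its gap to vanish,
  so u is supported on \<sigma>.\<close>

lemma S_min_weight:
  assumes u: "u \<in> S m e" and e: "real_of_int e = height a w \<sigma> (lat b0 - lat m)"
  shows "coords a \<sigma> (lat b0 - lat m) = (\<chi> k. real_of_int (u (\<sigma> k)))" "\<And>j. j \<notin> range \<sigma> \<Longrightarrow> u j = 0"
proof -
  have "(\<Sum>j\<in>UNIV. real_of_int (u j) * gap j) = 0" using S_weight[OF u] e by simp
  then have "real_of_int (u j) * gap j = 0" for j
    using S_gap_nonneg[OF u] by (simp add: sum_nonneg_eq_0_iff)
  then show off: "u j = 0" if "j \<notin> range \<sigma>" for j using gap(2)[OF that] by (metis less_irrefl mult_eq_0_iff of_int_eq_0_iff)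
  show "coords a \<sigma> (lat b0 - lat m) = (\<chi> k. real_of_int (u (\<sigma> k)))"
    using S_cmap[OF u off] by (metis coords_cmap[OF basis])
qed

text \<open>At m = b0 and weight 0 only u = 0 survives, and its term is 1.\<close>

lemma \<Phi>_b0: "\<Phi> b0 \<noteq> 0" "fls_subdegree (\<Phi> b0) = 0"
proof -
  have "S b0 0 = {\<lambda>_. 0}"
  proof (intro equalityI subsetI)
    fix u assume u: "u \<in> S b0 0"
    have e: "real_of_int 0 = height a w \<sigma> (lat b0 - lat b0)" by (simp add: height_simps[OF basis])
    have "u (\<sigma> k) = 0" for k
      using S_min_weight(1)[OF u e] by (simp add: linear_0[OF linear_coords[OF basis]] vec_eq_iff)
    then show "u \<in> {\<lambda>_. 0}" using S_min_weight(2)[OF u e] by (auto simp: fun_eq_iff) (metis rangeE)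
  qed (simp add: S_def wt_def)
  then have nz: "fls_nth (\<Phi> b0) 0 = 1" by (simp add: nth_\<Phi> coef_def term_of_def)
  then show "\<Phi> b0 \<noteq> 0" by auto
  show "fls_subdegree (\<Phi> b0) = 0"
    by (rule fls_subdegree_eqI) (use nz in \<open>auto simp: nth_\<Phi> height_simps[OF basis] intro!: coef_eq_0\<close>)
qed

lemma \<Phi>_subdegree_ge:
  assumes "\<Phi> m \<noteq> 0"
  shows "height a w \<sigma> (lat b0 - lat m) \<le> real_of_int (fls_subdegree (\<Phi> m))"
proof (rule ccontr)
  assume "\<not> ?thesis"
  then have "fls_nth (\<Phi> m) (fls_subdegree (\<Phi> m)) = 0" by (simp add: nth_\<Phi> coef_eq_0)
  with assms show False by simp
qed

text \<open>A term of minimal order would make the \<sigma>-coordinates of b0 - m integers. Two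
  points of one half-open parallelepiped have coordinate differences in (-1, 1), which leaves only m
  = b0.\<close>

lemma \<Phi>_subdegree_gt:
  assumes \<Phi>: "\<Phi> m \<noteq> 0" and m: "m \<noteq> b0" "m \<in> cell_points a v \<sigma>" "b0 \<in> cell_points a v \<sigma>"
  shows "height a w \<sigma> (lat b0 - lat m) < real_of_int (fls_subdegree (\<Phi> m))"
proof (rule ccontr)
  assume "\<not> ?thesis"
  then have e: "real_of_int (fls_subdegree (\<Phi> m)) = height a w \<sigma> (lat b0 - lat m)"
    using \<Phi>_subdegree_ge[OF \<Phi>] by simp
  have "coef m (fls_subdegree (\<Phi> m)) \<noteq> 0" using \<Phi> by (simp flip: nth_\<Phi>)
  then have "S m (fls_subdegree (\<Phi> m)) \<noteq> {}" by (auto simp: coef_def)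
  then obtain u where u: "u \<in> S m (fls_subdegree (\<Phi> m))" by blast
  have "coords a \<sigma> (lat b0 - lat m) = coords a \<sigma> (pt b0) - coords a \<sigma> (pt m)"
    by (simp flip: linear_diff[OF linear_coords[OF basis]])
  then have "real_of_int (u (\<sigma> k)) = coords a \<sigma> (pt b0) $ k - coords a \<sigma> (pt m) $ k" for k
    using S_min_weight(1)[OF u e] by (simp add: vec_eq_iff)
  then have u_eq: "real_of_int (u (\<sigma> k)) = coords a \<sigma> (pt b0) $ k - coords a \<sigma> (pt m) $ k" for k by blast
  have bnd: "0 \<le> coords a \<sigma> (pt m) $ k" "coords a \<sigma> (pt m) $ k < 1"
    "0 \<le> coords a \<sigma> (pt b0) $ k" "coords a \<sigma> (pt b0) $ k < 1" for k
    using m(2,3) unfolding cell_points_def by blast+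
  have "u (\<sigma> k) = 0" for k
  proof -
    have "real_of_int (u (\<sigma> k)) < 1" "- 1 < real_of_int (u (\<sigma> k))" using u_eq[of k] bnd[of k] by linarith+
    then show ?thesis by linarith
  qed
  then have "coords a \<sigma> (lat b0 - lat m) = 0" using S_min_weight(1)[OF u e] by (simp add: vec_eq_iff)
  then have "cmap a \<sigma> 0 = lat b0 - lat m" by (metis cmap_coords[OF basis])
  then have "lat b0 = lat m" by (simp add: linear_0[OF linear_cmap])
  then show False using m(1) by (simp add: lat_def vec_eq_iff fun_eq_iff)
qed

end

context generic_data
begin

text \<open>Pair the relation with the series at a b0 minimizing the valuation of c b minus
  \<open>hgt b\<close>. Every other term starts at strictly higher order, by the integrality
  argument within the cell of b0 and by strict convexity of the height in other cells, so the b0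
  term cannot cancel.\<close>

theorem standard_points_independent:
  assumes mem: "(\<Sum>b\<in>standard_points a w v. U_scale (c b) (monom_op b)) \<in> U_H_A A"
    and b: "b \<in> standard_points a w v"
  shows "c b = 0"
proof (rule ccontr)
  assume "c b \<noteq> 0"
  let ?B = "{b \<in> standard_points a w v. c b \<noteq> 0}"
  define \<psi> where "\<psi> b = real_of_int (wval \<omega> (c b)) - hgt b" for b
  have fin: "finite (standard_points a w v)" by (rule finite_standard_points)
  then have finB: "finite ?B" by simp
  have neB: "?B \<noteq> {}" using b \<open>c b \<noteq> 0\<close> by blast
  have "\<exists>b0\<in>?B. \<forall>b\<in>?B. \<psi> b0 \<le> \<psi> b"
    by (rule finite_ex_minimizer[OF finB neB, where f = \<psi>], rule bexI, rule ballI) assumption+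
  then obtain b0 where b0B: "b0 \<in> ?B" and minB: "\<And>b. b \<in> ?B \<Longrightarrow> \<psi> b0 \<le> \<psi> b" by blast
  have b0: "b0 \<in> standard_points a w v" "c b0 \<noteq> 0" using b0B by blast+
  have min: "\<psi> b0 \<le> \<psi> b" if "b \<in> standard_points a w v" "c b \<noteq> 0" for b using minB that by blast
  define \<sigma> where "\<sigma> = cell b0"
  note cov0 = standard_points_covered[OF b0(1), folded \<sigma>_def]
  interpret series_solution A \<omega> v \<sigma> b0
    by unfold_locales (use cell(4)[OF cov0(1)] in \<open>simp add: \<sigma>_def\<close>)
  have \<sigma>T: "\<sigma> \<in> T" using cell(1)[OF cov0(1)] by (simp add: \<sigma>_def)
  let ?\<iota> = "weight_embedding \<omega>"
  have "pairing A ?\<iota> \<Phi> (\<Sum>b\<in>standard_points a w v. U_scale (c b) (monom_op b)) = 0"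
    by (rule pairing_U_H_A[OF ring_map_weight_embedding \<Phi>_solution mem])
  then have "(\<Sum>b\<in>standard_points a w v. ?\<iota> (c b) * \<Phi> b) = 0"
    by (simp add: pairing_sum[OF ring_map_weight_embedding] pairing_scale[OF ring_map_weight_embedding]
        pairing_monom_op[OF ring_map_weight_embedding])
  moreover have "(\<Sum>b\<in>standard_points a w v. ?\<iota> (c b) * \<Phi> b)
      = (\<Sum>b\<in>standard_points a w v - {b0}. ?\<iota> (c b) * \<Phi> b) + ?\<iota> (c b0) * \<Phi> b0"
    by (subst add.commute, rule sum.remove[OF fin b0(1)])
  ultimately have "(\<Sum>b\<in>standard_points a w v - {b0}. ?\<iota> (c b) * \<Phi> b) + ?\<iota> (c b0) * \<Phi> b0 = 0"
    by (simp only:)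
  then have e1: "(\<Sum>b\<in>standard_points a w v - {b0}. - (?\<iota> (c b) * \<Phi> b)) = ?\<iota> (c b0) * \<Phi> b0"
    unfolding sum_negf by (rule minus_unique)
  have e2: "?\<iota> (c b0) * \<Phi> b0 \<noteq> 0" using \<Phi>_b0(1) b0(2) by simp
  have "finite (standard_points a w v - {b0})" using fin by simp
  from fls_sum_nonzero_term[OF this e1 e2] obtain b where b: "b \<in> standard_points a w v - {b0}"
    "- (?\<iota> (c b) * \<Phi> b) \<noteq> 0"
    "fls_subdegree (- (?\<iota> (c b) * \<Phi> b)) \<le> fls_subdegree (?\<iota> (c b0) * \<Phi> b0)" by blast
  have nz: "c b \<noteq> 0" "\<Phi> b \<noteq> 0" using b(2) by auto
  have bs: "b \<in> standard_points a w v" "b \<noteq> b0" using b(1) by auto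
  have le: "wval \<omega> (c b) + fls_subdegree (\<Phi> b) \<le> wval \<omega> (c b0)"
    using b(3) nz b0(2) \<Phi>_b0 by (simp add: wval_def)
  note covb = standard_points_covered[OF bs(1)]
  have h: "height a w \<sigma> (lat b0 - lat b) = hgt b0 - height a w \<sigma> (pt b)"
  proof -
    have "lat b0 - lat b = pt b0 - pt b" by simp
    then show ?thesis using height_simps(2)[OF basis, of w "pt b0" "pt b"] by (simp only: hgt_def \<sigma>_def[symmetric])
  qed
  have "hgt b0 - hgt b < real_of_int (fls_subdegree (\<Phi> b))"
  proof (cases "cell b = \<sigma>")
    case True
    then show ?thesis using \<Phi>_subdegree_gt[OF nz(2) bs(2)] covb(2) cov0(2) h by (simp add: hgt_def[of b])
  next
    case False
    then have "height a w \<sigma> (pt b) < hgt b" using height_less_hgt[OF \<sigma>T covb(1)] by blast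
    then show ?thesis using \<Phi>_subdegree_ge[OF nz(2)] h by simp
  qed
  then have "\<psi> b < \<psi> b0" using le by (simp add: \<psi>_def)
  then show False using min[OF bs(1) nz(1)] by simp
qed

theorem quot_dim_eq_standard_points: "quot_dim_eq (U_H_A A) (card (standard_points a w v))"
proof (rule quot_dim_eqI[OF finite_standard_points])
  show "u \<in> U.span (U_H_A A \<union> monom_op ` standard_points a w v)" for u
    by (rule span_monom_op_eq_UNIV) (use solution_zero in blast)
  show "c b = 0" if "(\<Sum>b\<in>standard_points a w v. U_scale (c b) (monom_op b)) \<in> U_H_A A" "b \<in> standard_points a w v" for c b
    using standard_points_independent[OF that] .
qed

end

section \<open>Counting the standard points\<close>

text \<open>The exceptions lie in finitely many sets: images of coordinate hyperplanes under
  invertible maps, and ranges of singular maps.\<close>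

lemma negligible_not_generic_point:
  fixes a :: "'n::finite \<Rightarrow> real^'d::finite"
  shows "negligible {x. \<not> generic_point a x}"
proof -
  let ?N = "\<lambda>\<sigma>. if is_basis a \<sigma> then \<Union>i. cmap a \<sigma> ` {c. c$i = 0} else range (cmap a \<sigma>)"
  have "negligible (?N \<sigma>)" for \<sigma> :: "'d \<Rightarrow> 'n"
  proof (cases "is_basis a \<sigma>")
    case True
    have "cmap a \<sigma> differentiable_on {c. c$i = 0}" for i
      by (intro linear_imp_differentiable_on linear_cmap)
    then have "negligible (cmap a \<sigma> ` {c. c$i = 0})" for i
      by (intro negligible_differentiable_image_negligible negligible_standard_hyperplane_cart) auto
    then show ?thesis using True by (auto intro!: negligible_Union)
  next
    case False
    then have "\<not> inj (cmap a \<sigma>)"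
      unfolding is_basis_def using linear_injective_imp_surjective[OF linear_cmap] by blast
    then show ?thesis using False by (simp add: negligible_linear_singular_image[OF linear_cmap])
  qed
  then have "negligible t" if "t \<in> range ?N" for t using that by blast
  then have "negligible (\<Union>\<sigma>. ?N \<sigma>)" by (intro negligible_Union) simp_all
  moreover have "{x. \<not> generic_point a x} \<subseteq> (\<Union>\<sigma>. ?N \<sigma>)"
  proof
    fix x assume "x \<in> {x. \<not> generic_point a x}"
    then obtain \<sigma> c where c: "cmap a \<sigma> c = x" "\<not> is_basis a \<sigma> \<or> (\<exists>i. c$i = 0)"
      by (auto simp: generic_point_def)
    then have "x \<in> ?N \<sigma>" by auto
    then show "x \<in> (\<Union>\<sigma>. ?N \<sigma>)" by blast
  qed
  ultimately show ?thesis by (rule negligible_subset)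
qed

text \<open>Countably many lattice translates of a null set cannot fill the space.\<close>

lemma ex_generic_translation:
  fixes a :: "'n::finite \<Rightarrow> real^'d::finite"
  obtains v where "\<And>m. generic_point a (lat m + v)"
proof -
  let ?N = "\<lambda>m. (\<lambda>x. - lat m + x) ` {x. \<not> generic_point a x}"
  have "negligible (?N m)" for m by (rule negligible_translation[OF negligible_not_generic_point])
  then have "negligible (\<Union>(range ?N))" by (intro negligible_countable_Union) blast+
  then have "(\<Union>m\<in>UNIV. ?N m) \<noteq> UNIV" by (intro notI) simp
  then obtain v where v: "v \<notin> (\<Union>m\<in>UNIV. ?N m)" by blast
  have "generic_point a (lat m + v)" for m
  proof (rule ccontr)
    assume "\<not> generic_point a (lat m + v)"
    then have "v \<in> ?N m" by (intro image_eqI[of _ _ "lat m + v"]) auto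
    then show False using v by blast
  qed
  then show thesis by (rule that)
qed

section \<open>Volumes of parallelepipeds and simplices\<close>

lemma nn_integral_lborel_translation:
  fixes c :: "'a::euclidean_space"
  assumes "f \<in> borel_measurable borel"
  shows "(\<integral>\<^sup>+x. f (c + x) \<partial>lborel) = (\<integral>\<^sup>+x. f x \<partial>lborel)"
  by (subst (2) lborel_distr_plus[of c, symmetric]) (use assms in \<open>simp add: nn_integral_distr\<close>)

text \<open>Both sides compute \<open>\<integral>\<integral> 1_A(g y) 1_B(x - g y)\<close>, once in either order of integration.\<close>

lemma emeasure_linear_vimage:
  fixes f g :: "'a::euclidean_space \<Rightarrow> 'a"
  assumes lin: "linear f" "linear g" and gf: "\<And>x. g (f x) = x"
    and A: "A \<in> sets borel" and B: "B \<in> sets borel"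
  shows "emeasure lborel (g -` A) * emeasure lborel B = emeasure lborel A * emeasure lborel (g -` uminus -` B)"
proof -
  have [measurable]: "g \<in> borel_measurable borel"
    using lin(2) by (intro borel_measurable_continuous_onI linear_continuous_on) (simp add: linear_conv_bounded_linear)
  note [measurable] = A B
  have vA: "g -` A \<in> sets borel" using measurable_sets_borel[of g borel A] A by simp
  have "(\<lambda>y. - g y) \<in> borel_measurable borel" by measurable
  then have vB: "g -` uminus -` B \<in> sets borel"
    using measurable_sets_borel[of "\<lambda>y. - g y" borel B] B by (simp add: vimage_def)
  let ?F = "\<lambda>x y. indicator A (g y) * indicator B (x - g y) :: ennreal"
  have "(\<integral>\<^sup>+y. \<integral>\<^sup>+x. ?F x y \<partial>lborel \<partial>lborel) = (\<integral>\<^sup>+y. indicator (g -` A) y * emeasure lborel B \<partial>lborel)"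
  proof (rule nn_integral_cong)
    fix y
    have "(\<integral>\<^sup>+x. ?F x y \<partial>lborel) = indicator A (g y) * (\<integral>\<^sup>+x. indicator B (- g y + x) \<partial>lborel)"
      by (subst nn_integral_cmult) (auto simp: add.commute)
    also have "(\<integral>\<^sup>+x. indicator B (- g y + x) \<partial>lborel) = emeasure lborel B"
      by (subst nn_integral_lborel_translation) (use B in \<open>auto simp: nn_integral_indicator\<close>)
    finally show "(\<integral>\<^sup>+x. ?F x y \<partial>lborel) = indicator (g -` A) y * emeasure lborel B" by (simp add: indicator_def)
  qed
  also have "\<dots> = emeasure lborel (g -` A) * emeasure lborel B"
    using vA by (subst nn_integral_multc) auto
  finally have 1: "(\<integral>\<^sup>+y. \<integral>\<^sup>+x. ?F x y \<partial>lborel \<partial>lborel) = emeasure lborel (g -` A) * emeasure lborel B" .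
  have "(\<integral>\<^sup>+y. \<integral>\<^sup>+x. ?F x y \<partial>lborel \<partial>lborel) = (\<integral>\<^sup>+x. \<integral>\<^sup>+y. ?F x y \<partial>lborel \<partial>lborel)"
    by (rule lborel_pair.Fubini') measurable
  also have "\<dots> = (\<integral>\<^sup>+x. \<integral>\<^sup>+y. indicator A (x + g y) * indicator B (- g y) \<partial>lborel \<partial>lborel)"
  proof (rule nn_integral_cong)
    fix x
    have "(\<integral>\<^sup>+y. ?F x y \<partial>lborel) = (\<integral>\<^sup>+y. ?F x (f x + y) \<partial>lborel)"
      by (rule nn_integral_lborel_translation[symmetric]) measurable
    then show "(\<integral>\<^sup>+y. ?F x y \<partial>lborel) = (\<integral>\<^sup>+y. indicator A (x + g y) * indicator B (- g y) \<partial>lborel)"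
      by (simp add: linear_add[OF lin(2)] gf)
  qed
  also have "\<dots> = (\<integral>\<^sup>+y. \<integral>\<^sup>+x. indicator A (x + g y) * indicator B (- g y) \<partial>lborel \<partial>lborel)"
    by (rule lborel_pair.Fubini'[symmetric]) measurable
  also have "\<dots> = (\<integral>\<^sup>+y. emeasure lborel A * indicator (g -` uminus -` B) y \<partial>lborel)"
  proof (rule nn_integral_cong)
    fix y
    have "(\<integral>\<^sup>+x. indicator A (x + g y) * indicator B (- g y) \<partial>lborel) = (\<integral>\<^sup>+x. indicator A (g y + x) \<partial>lborel) * indicator B (- g y)"
      by (subst nn_integral_multc) (auto simp: add.commute)
    also have "(\<integral>\<^sup>+x. indicator A (g y + x) \<partial>lborel) = emeasure lborel A"
      by (subst nn_integral_lborel_translation) (use A in \<open>auto simp: nn_integral_indicator\<close>)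
    finally show "(\<integral>\<^sup>+x. indicator A (x + g y) * indicator B (- g y) \<partial>lborel) = emeasure lborel A * indicator (g -` uminus -` B) y"
      by (simp add: indicator_def)
  qed
  also have "\<dots> = emeasure lborel A * emeasure lborel (g -` uminus -` B)"
    using vB by (subst nn_integral_cmult) auto
  finally show ?thesis using 1 by simp
qed

definition unit_cube :: "(real^'d::finite) set" where
  "unit_cube = {c. \<forall>i. 0 \<le> c$i \<and> c$i < 1}"

lemma unit_cube_borel [measurable]: "unit_cube \<in> sets borel"
  unfolding unit_cube_def by measurable

lemma emeasure_unit_cube: "emeasure lborel (unit_cube :: (real^'d::finite) set) = 1"
proof (rule antisym)
  have one: "(1 :: real^'d) \<bullet> b = 1" if "b \<in> Basis" for b
    using that by (auto simp: Basis_vec_def inner_axis)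
  have "emeasure lborel (unit_cube :: (real^'d) set) \<le> emeasure lborel (cbox 0 (1 :: real^'d))"
    by (intro emeasure_mono) (auto simp: unit_cube_def mem_box_cart less_imp_le)
  also have "\<dots> = 1" by (simp add: emeasure_lborel_cbox_eq one)
  finally show "emeasure lborel (unit_cube :: (real^'d) set) \<le> 1" .
  have "1 = emeasure lborel (box 0 (1 :: real^'d))" by (simp add: emeasure_lborel_box_eq one)
  also have "\<dots> \<le> emeasure lborel (unit_cube :: (real^'d) set)"
    by (intro emeasure_mono) (auto simp: unit_cube_def mem_box_cart less_imp_le)
  finally show "1 \<le> emeasure lborel (unit_cube :: (real^'d) set)" .
qed

lemma cmap_image: "is_basis a \<sigma> \<Longrightarrow> cmap a \<sigma> ` X = coords a \<sigma> -` X"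
  by (auto simp: coords_cmap) (metis cmap_coords image_eqI)

lemma coords_measurable: "is_basis a \<sigma> \<Longrightarrow> coords a \<sigma> \<in> borel_measurable borel"
  by (intro borel_measurable_continuous_onI linear_continuous_on)
     (simp add: linear_coords flip: linear_conv_bounded_linear)

lemma cmap_image_borel:
  assumes "is_basis a \<sigma>" "X \<in> sets borel"
  shows "cmap a \<sigma> ` X \<in> sets borel"
  using measurable_sets_borel[OF coords_measurable[OF assms(1)] assms(2)] by (simp add: cmap_image[OF assms(1)])

lemma bounded_cmap_unit_cube: "bounded (cmap a \<sigma> ` unit_cube)"
proof (rule bounded_linear_image)
  show "bounded (unit_cube :: (real^'a) set)"
    by (rule bounded_subset[OF bounded_cbox[of 0 1]]) (auto simp: unit_cube_def mem_box_cart less_imp_le)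
  show "bounded_linear (cmap a \<sigma>)" using linear_cmap linear_conv_bounded_linear by blast
qed

definition cell_simplex :: "('n \<Rightarrow> real^'d) \<Rightarrow> ('d::finite \<Rightarrow> 'n) \<Rightarrow> (real^'d) set" where
  "cell_simplex a \<sigma> = cmap a \<sigma> ` (convex hull (insert 0 Basis))"

lemma std_simplex_borel: "convex hull (insert 0 Basis :: 'a::euclidean_space set) \<in> sets borel"
  by (intro borel_closed compact_imp_closed finite_imp_compact_convex_hull) simp

lemma cell_simplex_borel: "is_basis a \<sigma> \<Longrightarrow> cell_simplex a \<sigma> \<in> sets borel"
  unfolding cell_simplex_def by (intro cmap_image_borel std_simplex_borel)

text \<open>Preimages under \<open>coords\<close> scale all Borel volumes by one common factor,
  identified on the unit cube; the standard simplex has volume 1/d!. No determinant is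
  involved.\<close>

lemma measure_cell_simplex:
  fixes a :: "'n \<Rightarrow> real^'d::finite"
  assumes b: "is_basis a \<sigma>"
  shows "measure lborel (cell_simplex a \<sigma>) = measure lborel (cmap a \<sigma> ` unit_cube) / fact CARD('d)"
proof -
  let ?S = "convex hull (insert 0 Basis) :: (real^'d) set" and ?Q = "unit_cube :: (real^'d) set"
  let ?r = "emeasure lborel (coords a \<sigma> -` uminus -` ?Q)"
  have *: "emeasure lborel (coords a \<sigma> -` A) * emeasure lborel ?Q = emeasure lborel A * ?r" if "A \<in> sets borel" for A
    using emeasure_linear_vimage[OF linear_cmap linear_coords[OF b] coords_cmap[OF b] that unit_cube_borel] .
  have "emeasure lborel (cmap a \<sigma> ` ?Q) = ?r"
    using *[of ?Q] by (simp add: cmap_image[OF b] emeasure_unit_cube)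
  moreover have "emeasure lborel (cell_simplex a \<sigma>) = ennreal (1 / fact CARD('d)) * ?r"
    using *[OF std_simplex_borel] by (simp add: cell_simplex_def cmap_image[OF b] emeasure_unit_cube emeasure_std_simplex)
  ultimately show ?thesis by (simp add: measure_def enn2real_mult)
qed

text \<open>Subtracting integer multiples of the columns reduces the coordinates of m + v' modulo 1
  and so maps one cell into the other. The map is injective because an integer in (-1, 1) is 0.
  Exchanging v and v' gives equality.\<close>

lemma card_cell_points_le:
  fixes A :: "int^'n::finite^'d::finite"
  assumes b: "is_basis (col_real A) \<sigma>"
  shows "card (cell_points (col_real A) v \<sigma>) \<le> card (cell_points (col_real A) v' \<sigma>)"
proof -
  let ?a = "col_real A"
  let ?n = "\<lambda>m k. \<lfloor>coords ?a \<sigma> (lat m + v') $ k\<rfloor>"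
  define \<rho> where "\<rho> m = (\<lambda>i. m i - (\<Sum>k\<in>UNIV. ?n m k * A$i$(\<sigma> k)))" for m
  have lat\<rho>: "lat (\<rho> m) = lat m - cmap ?a \<sigma> (\<chi> k. real_of_int (?n m k))" for m
    by (simp add: \<rho>_def lat_def cmap_def col_real_def vec_eq_iff)
  have coords\<rho>: "coords ?a \<sigma> (lat (\<rho> m) + x) = coords ?a \<sigma> (lat m + x) - (\<chi> k. real_of_int (?n m k))" for m x
  proof -
    have "lat (\<rho> m) + x = (lat m + x) - cmap ?a \<sigma> (\<chi> k. real_of_int (?n m k))" by (simp add: lat\<rho>)
    then show ?thesis by (simp only: linear_diff[OF linear_coords[OF b]] coords_cmap[OF b])
  qed
  have "inj_on \<rho> (cell_points ?a v \<sigma>)"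
  proof (rule inj_onI)
    fix m m' assume m: "m \<in> cell_points ?a v \<sigma>" "m' \<in> cell_points ?a v \<sigma>" "\<rho> m = \<rho> m'"
    have "coords ?a \<sigma> (lat m + v) - (\<chi> k. real_of_int (?n m k)) = coords ?a \<sigma> (lat m' + v) - (\<chi> k. real_of_int (?n m' k))"
      using coords\<rho>[of m v] coords\<rho>[of m' v] m(3) by simp
    then have e: "coords ?a \<sigma> (lat m + v) $ k - real_of_int (?n m k) = coords ?a \<sigma> (lat m' + v) $ k - real_of_int (?n m' k)" for k
      by (simp add: vec_eq_iff)
    have "coords ?a \<sigma> (lat m + v) $ k = coords ?a \<sigma> (lat m' + v) $ k" for k
    proof -
      have bnd: "0 \<le> coords ?a \<sigma> (lat m + v) $ k" "coords ?a \<sigma> (lat m + v) $ k < 1"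
        "0 \<le> coords ?a \<sigma> (lat m' + v) $ k" "coords ?a \<sigma> (lat m' + v) $ k < 1"
        using m(1,2) unfolding cell_points_def by blast+
      have "real_of_int (?n m k - ?n m' k) < 1" "- 1 < real_of_int (?n m k - ?n m' k)"
        unfolding of_int_diff using e[of k] bnd by linarith+
      then have "?n m k = ?n m' k" by linarith
      then show ?thesis using e[of k] by simp
    qed
    then have "coords ?a \<sigma> (lat m + v) = coords ?a \<sigma> (lat m' + v)" by (simp add: vec_eq_iff)
    then have "lat m + v = lat m' + v" by (metis cmap_coords[OF b])
    then show "m = m'" by (simp add: lat_def vec_eq_iff fun_eq_iff)
  qed
  moreover have "\<rho> ` cell_points ?a v \<sigma> \<subseteq> cell_points ?a v' \<sigma>"
  proof
    fix r assume "r \<in> \<rho> ` cell_points ?a v \<sigma>"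
    then obtain m where r: "r = \<rho> m" by blast
    have "0 \<le> coords ?a \<sigma> (lat r + v') $ k \<and> coords ?a \<sigma> (lat r + v') $ k < 1" for k
      unfolding r coords\<rho> by (simp, linarith)
    then show "r \<in> cell_points ?a v' \<sigma>" by (simp add: cell_points_def)
  qed
  ultimately show ?thesis by (rule card_inj_on_le) (rule finite_cell_points[OF b])
qed

text \<open>The count is the same for all translations \<open>v\<close>; averaging it over the unit cube gives the volume.\<close>

lemma card_cell_points:
  fixes A :: "int^'n::finite^'d::finite"
  assumes b: "is_basis (col_real A) \<sigma>"
  shows "real (card (cell_points (col_real A) v \<sigma>)) = measure lborel (cmap (col_real A) \<sigma> ` unit_cube)"
proof -
  let ?a = "col_real A" and ?Q = "unit_cube :: (real^'d) set"
  let ?P = "cmap ?a \<sigma> ` ?Q"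
  let ?N = "card (cell_points ?a v \<sigma>)"
  have P [measurable]: "?P \<in> sets borel" by (rule cmap_image_borel[OF b unit_cube_borel])
  have bQ: "bounded ?Q"
    by (rule bounded_subset[OF bounded_cbox[of 0 1]]) (auto simp: unit_cube_def mem_box_cart less_imp_le)
  have N: "card (cell_points ?a x \<sigma>) = ?N" for x
    by (intro antisym card_cell_points_le[OF b])
  have cp: "{m. lat m + x \<in> ?P} = cell_points ?a x \<sigma>" for x
    by (auto simp: cell_points_def cmap_image[OF b] unit_cube_def)
  \<comment> \<open>Lattice points whose unit cell meets the parallelepiped; x is the translation
    over which the count is averaged.\<close>
  define M where "M = {m. \<exists>x\<in>?Q. lat m + x \<in> ?P}"
  have "bounded ((\<lambda>(p, q). p - q) ` (?P \<times> ?Q))"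
    by (intro bounded_minus_comp bounded_cmap_unit_cube bQ bounded_fst bounded_snd bounded_Times | simp add: case_prod_beta)+
  from finite_lattice_points_bounded[OF this, of 0] have "finite M"
  proof (rule rev_finite_subset, intro subsetI CollectI)
    fix m assume "m \<in> M"
    then obtain x where x: "x \<in> ?Q" "lat m + x \<in> ?P" unfolding M_def by blast
    have "lat m + 0 = (\<lambda>(p, q). p - q) (lat m + x, x)" by simp
    then show "lat m + 0 \<in> (\<lambda>(p, q). p - q) ` (?P \<times> ?Q)" using x by blast
  qed
  \<comment> \<open>The part of the parallelepiped inside the unit cell at m, moved back to the unit
    cube.\<close>
  define E where "E m = {x \<in> ?Q. lat m + x \<in> ?P}" for m
  have E [measurable]: "E m \<in> sets borel" for m
  proof -
    have "E m = ?Q \<inter> (\<lambda>x. lat m + x) -` ?P" by (auto simp: E_def)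
    moreover have "(\<lambda>x. lat m + x) -` ?P \<in> sets borel"
      using measurable_sets_borel[of "\<lambda>x. lat m + x" borel ?P] P by simp
    ultimately show ?thesis by (simp add: sets.Int)
  qed
  have bE: "bounded (E m)" for m using bQ by (rule bounded_subset) (auto simp: E_def)
  have fmE: "E m \<in> fmeasurable lborel" for m
    using E emeasure_bounded_finite[OF bE] by (auto simp: fmeasurable_def)
  have trans: "measure lborel ((\<lambda>x. lat m + x) ` E m) = measure lborel (E m)" for m
  proof -
    have "(\<lambda>x. lat m + x) ` E m = (\<lambda>x. - lat m + x) -` E m"
      by (auto intro: image_eqI[where x = "_ - lat m"])
    moreover have "emeasure lborel ((\<lambda>x. - lat m + x) -` E m) = emeasure lborel (E m)"
      by (subst (2) lborel_distr_plus[of "- lat m", symmetric]) (simp add: emeasure_distr E)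
    ultimately show ?thesis by (simp add: measure_def)
  qed
  have P_eq: "?P = (\<Union>m\<in>M. (\<lambda>x. lat m + x) ` E m)"
  proof (intro equalityI subsetI)
    fix p assume p: "p \<in> ?P"
    define m where "m = (\<lambda>i. \<lfloor>p$i\<rfloor>)"
    define x where "x = p - lat m"
    have "x \<in> ?Q" unfolding unit_cube_def x_def m_def lat_def by (simp, linarith)
    moreover have px: "p = lat m + x" by (simp add: x_def)
    ultimately have "m \<in> M" "x \<in> E m" using p by (auto simp: M_def E_def)
    then show "p \<in> (\<Union>m\<in>M. (\<lambda>x. lat m + x) ` E m)" using px by blast
  qed (auto simp: E_def)
  have disj: "disjoint_family_on (\<lambda>m. (\<lambda>x. lat m + x) ` E m) M"
    unfolding disjoint_family_on_def
  proof (intro ballI impI)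
    fix m m' :: "'d \<Rightarrow> int" assume "m \<noteq> m'"
    have False if x: "x \<in> ?Q" "x' \<in> ?Q" "lat m + x = lat m' + x'" for x x'
    proof -
      have "m i = m' i" for i
      proof -
        have "real_of_int (m i) + x$i = real_of_int (m' i) + x'$i" using x(3) by (simp add: lat_def vec_eq_iff)
        moreover have "0 \<le> x$i" "x$i < 1" "0 \<le> x'$i" "x'$i < 1" using x(1,2) by (auto simp: unit_cube_def)
        ultimately have "real_of_int (m i - m' i) < 1" "- 1 < real_of_int (m i - m' i)" by simp_all
        then show ?thesis by linarith
      qed
      then show False using \<open>m \<noteq> m'\<close> by (simp add: fun_eq_iff)
    qed
    then show "(\<lambda>x. lat m + x) ` E m \<inter> (\<lambda>x. lat m' + x) ` E m' = {}" by (auto simp: E_def)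
  qed
  have fmT: "(\<lambda>x. lat m + x) ` E m \<in> fmeasurable lborel" for m
  proof -
    have "(\<lambda>x. lat m + x) ` E m = (\<lambda>x. - lat m + x) -` E m"
      by (auto intro: image_eqI[where x = "_ - lat m"])
    moreover have "(\<lambda>x. - lat m + x) -` E m \<in> sets borel"
      using measurable_sets_borel[of "\<lambda>x. - lat m + x" borel "E m"] E by simp
    moreover have "bounded ((\<lambda>x. lat m + x) ` E m)" by (rule bounded_translation[OF bE])
    ultimately show ?thesis using emeasure_bounded_finite[of "(\<lambda>x. lat m + x) ` E m"]
      by (auto simp: fmeasurable_def)
  qed
  have "measure lborel ?P = (\<Sum>m\<in>M. measure lborel ((\<lambda>x. lat m + x) ` E m))"
    unfolding P_eq using fmT disj \<open>finite M\<close>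
    by (intro measure_finite_Union) (auto simp: fmeasurable_def less_top)
  also have "\<dots> = (\<Sum>m\<in>M. integral\<^sup>L lborel (indicator (E m)))"
    by (simp add: trans)
  also have "\<dots> = (\<integral>x. (\<Sum>m\<in>M. indicator (E m) x) \<partial>lborel)"
    using fmE by (intro Bochner_Integration.integral_sum[symmetric] integrable_real_indicator) (auto simp: fmeasurable_def)
  \<comment> \<open>For x in the cube, the m with x in \<open>E m\<close> are exactly the cell
    points for translation x.\<close>
  also have "\<dots> = (\<integral>x. real ?N * indicator ?Q x \<partial>lborel)"
  proof (intro Bochner_Integration.integral_cong refl)
    fix x :: "real^'d"
    show "(\<Sum>m\<in>M. indicator (E m) x) = real ?N * indicator ?Q x"
    proof (cases "x \<in> ?Q")
      case True
      have "(\<Sum>m\<in>M. indicator (E m) x) = (\<Sum>m\<in>{m\<in>M. lat m + x \<in> ?P}. 1 :: real)"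
        using True \<open>finite M\<close> by (intro sum.mono_neutral_cong_right) (auto simp: E_def indicator_def)
      also have "{m\<in>M. lat m + x \<in> ?P} = {m. lat m + x \<in> ?P}" unfolding M_def using True by blast
      also have "\<dots> = cell_points ?a x \<sigma>" by (rule cp)
      finally show ?thesis using True N[of x] by simp
    qed (auto simp: E_def indicator_def)
  qed
  also have "\<dots> = real ?N * measure lborel ?Q" by simp
  also have "measure lborel ?Q = 1" by (simp add: measure_def emeasure_unit_cube)
  finally show ?thesis by simp
qed

section \<open>Decomposition of the polytope into simplices\<close>

lemma convex_hull_insert_0_range:
  fixes a :: "'n::finite \<Rightarrow> 'a::real_vector"
  assumes "p \<in> convex hull (insert 0 (range a))"
  obtains u where "\<And>j. u j \<ge> 0" "sum u UNIV \<le> 1" "p = (\<Sum>j\<in>UNIV. u j *\<^sub>R a j)"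
proof -
  let ?D = "{p. \<exists>u. (\<forall>j. u j \<ge> 0) \<and> sum u UNIV \<le> 1 \<and> p = (\<Sum>j\<in>UNIV. u j *\<^sub>R a j)}"
  have "convex ?D"
  proof (rule convexI)
    fix x y and s t :: real
    assume "x \<in> ?D" "y \<in> ?D" and st: "0 \<le> s" "0 \<le> t" "s + t = 1"
    then obtain u u' where u: "\<forall>j. u j \<ge> 0" "sum u UNIV \<le> 1" "x = (\<Sum>j\<in>UNIV. u j *\<^sub>R a j)"
      and u': "\<forall>j. u' j \<ge> 0" "sum u' UNIV \<le> 1" "y = (\<Sum>j\<in>UNIV. u' j *\<^sub>R a j)" by blast
    let ?u = "\<lambda>j. s * u j + t * u' j"
    have "sum ?u UNIV = s * sum u UNIV + t * sum u' UNIV" by (simp add: sum.distrib sum_distrib_left)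
    also have "\<dots> \<le> s * 1 + t * 1" using st u u' by (intro add_mono mult_left_mono) auto
    finally have "sum ?u UNIV \<le> 1" using st by simp
    moreover have "s *\<^sub>R x + t *\<^sub>R y = (\<Sum>j\<in>UNIV. ?u j *\<^sub>R a j)"
      by (simp add: u u' scaleR_sum_right scaleR_left_distrib sum.distrib)
    moreover have "\<forall>j. ?u j \<ge> 0" using st u u' by simp
    ultimately show "s *\<^sub>R x + t *\<^sub>R y \<in> ?D"
      unfolding mem_Collect_eq by (intro exI[of _ ?u] conjI)
  qed
  moreover have "insert 0 (range a) \<subseteq> ?D"
  proof -
    have "0 \<in> ?D" unfolding mem_Collect_eq by (intro exI[of _ "\<lambda>_. 0"]) simp
    moreover have "a k \<in> ?D" for k
    proof -
      let ?u = "\<lambda>j. if j = k then 1 else 0 :: real"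
      have "(\<Sum>j\<in>UNIV. ?u j *\<^sub>R a j) = (\<Sum>j\<in>UNIV. if j = k then a k else 0)" by (intro sum.cong) auto
      then have "a k = (\<Sum>j\<in>UNIV. ?u j *\<^sub>R a j)" by simp
      moreover have "sum ?u UNIV \<le> 1" "\<forall>j. ?u j \<ge> 0" by simp_all
      ultimately show ?thesis unfolding mem_Collect_eq by (intro exI[of _ ?u] conjI)
    qed
    ultimately show ?thesis by (metis (no_types, lifting) image_subset_iff insert_subset)
  qed
  ultimately have "convex hull (insert 0 (range a)) \<subseteq> ?D" by (rule hull_minimal[rotated])
  then have "p \<in> ?D" using assms by (rule subsetD)
  then show thesis using that unfolding mem_Collect_eq by blast
qed

lemma mem_cell_simplex:
  fixes a :: "'a \<Rightarrow> real^'b::finite"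
  assumes b: "is_basis a \<sigma>"
  shows "p \<in> cell_simplex a \<sigma> \<longleftrightarrow> (\<forall>i. 0 \<le> coords a \<sigma> p $ i) \<and> height a (\<lambda>_. 1) \<sigma> p \<le> 1"
proof -
  have basis: "(Basis :: (real^'b) set) = range (\<lambda>i. axis i 1)" by (auto simp: Basis_vec_def)
  have "inj (\<lambda>i::'b. axis i (1::real))" by (simp add: inj_on_def axis_eq_axis)
  then have "(\<Sum>i\<in>Basis. x \<bullet> i) = (\<Sum>i\<in>UNIV. x $ i)" for x :: "real^'b"
    unfolding basis by (simp add: sum.reindex inner_axis)
  moreover have "(\<forall>i\<in>Basis. 0 \<le> x \<bullet> i) \<longleftrightarrow> (\<forall>i. 0 \<le> x $ i)" for x :: "real^'b"
    unfolding basis by (simp add: inner_axis)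
  ultimately show ?thesis
    unfolding cell_simplex_def cmap_image[OF b] std_simplex height_def by simp
qed

text \<open>Up to nongeneric points the hull is the union of the cell simplices. A generic point of
  the hull lies in some cone of the triangulation; for that cell all columns have constant-weight
  height at most 1, hence so has the point, and it belongs to the simplex.\<close>

lemma measure_hull_eq_sum_simplices:
  fixes a :: "'n::finite \<Rightarrow> real^'d::finite"
  assumes \<omega>: "generic_weight a \<omega>"
  shows "measure lebesgue (convex hull (insert 0 (range a))) = (\<Sum>\<sigma>\<in>triangulation a \<omega>. measure lebesgue (cell_simplex a \<sigma>))"
proof -
  let ?T = "triangulation a \<omega>" and ?H = "convex hull (insert 0 (range a))"
  have cone: "in_cone a \<sigma> p" if "\<sigma> \<in> ?T" "p \<in> cell_simplex a \<sigma>" "generic_point a p" for \<sigma> p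
  proof -
    have b: "is_basis a \<sigma>" using that triangulation_is_basis by blast
    have "cmap a \<sigma> (coords a \<sigma> p) = p" by (rule cmap_coords[OF b])
    then have "coords a \<sigma> p $ i \<noteq> 0" for i using that(3) unfolding generic_point_def by blast
    then show ?thesis using that(2) b by (simp add: mem_cell_simplex in_cone_def less_le)
  qed
  have lm: "cell_simplex a \<sigma> \<in> lmeasurable" if "\<sigma> \<in> ?T" for \<sigma>
  proof (rule bounded_set_imp_lmeasurable)
    show "bounded (cell_simplex a \<sigma>)" unfolding cell_simplex_def
      by (intro bounded_linear_image bounded_convex_hull linear_conv_bounded_linear[THEN iffD1] linear_cmap) (simp add: finite_imp_bounded)
    show "cell_simplex a \<sigma> \<in> sets lebesgue"
      using cell_simplex_borel[OF triangulation_is_basis[OF that]] by simp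
  qed
  have "pairwise (\<lambda>\<sigma> \<tau>. negligible (cell_simplex a \<sigma> \<inter> cell_simplex a \<tau>)) ?T"
  proof (rule pairwiseI)
    fix \<sigma> \<tau> assume "\<sigma> \<in> ?T" "\<tau> \<in> ?T" "\<sigma> \<noteq> \<tau>"
    then have "cell_simplex a \<sigma> \<inter> cell_simplex a \<tau> \<subseteq> {x. \<not> generic_point a x}"
      using cone triangulation_unique by blast
    then show "negligible (cell_simplex a \<sigma> \<inter> cell_simplex a \<tau>)"
      by (rule negligible_subset[OF negligible_not_generic_point])
  qed
  then have sum: "measure lebesgue (\<Union>(cell_simplex a ` ?T)) = (\<Sum>\<sigma>\<in>?T. measure lebesgue (cell_simplex a \<sigma>))"
    using lm by (intro measure_negligible_finite_Union_image) auto
  have sub: "\<Union>(cell_simplex a ` ?T) \<subseteq> ?H"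
  proof (rule UN_least)
    fix \<sigma>
    have "cell_simplex a \<sigma> = convex hull (cmap a \<sigma> ` insert 0 Basis)"
      unfolding cell_simplex_def by (rule convex_hull_linear_image[OF linear_cmap])
    also have "\<dots> \<subseteq> ?H"
      by (rule hull_mono) (auto simp: Basis_vec_def cmap_axis linear_0[OF linear_cmap])
    finally show "cell_simplex a \<sigma> \<subseteq> ?H" .
  qed
  have "?H - \<Union>(cell_simplex a ` ?T) \<subseteq> {x. \<not> generic_point a x}"
  proof
    fix p assume p: "p \<in> ?H - \<Union>(cell_simplex a ` ?T)"
    show "p \<in> {x. \<not> generic_point a x}"
    proof (rule ccontr)
      assume "p \<notin> {x. \<not> generic_point a x}"
      then have g: "generic_point a p" by blast
      obtain u where u: "\<And>j. u j \<ge> 0" "sum u UNIV \<le> 1" "p = (\<Sum>j\<in>UNIV. u j *\<^sub>R a j)"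
        using convex_hull_insert_0_range[of p a] p by blast
      obtain \<sigma> where \<sigma>: "\<sigma> \<in> ?T" "in_cone a \<sigma> p" using ex_triangulation_cone[OF \<omega> g u(1) u(3)] by blast
      have b: "is_basis a \<sigma>" using \<sigma>(2) by (simp add: in_cone_def)
      have "height a (\<lambda>_. 1) \<sigma> p = (\<Sum>j\<in>UNIV. u j * height a (\<lambda>_. 1) \<sigma> (a j))"
        by (simp add: u(3) height_simps[OF b])
      also have "\<dots> \<le> (\<Sum>j\<in>UNIV. u j * 1)"
        using u(1) feasible_height_one_le[OF \<omega> triangulation_feasible[OF \<sigma>(1)]] by (intro sum_mono mult_left_mono)
      also have "\<dots> \<le> 1" using u(2) by simp
      finally have "p \<in> cell_simplex a \<sigma>" using \<sigma>(2) b by (simp add: mem_cell_simplex in_cone_def less_imp_le)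
      then show False using p \<sigma>(1) by blast
    qed
  qed
  then have "negligible (?H - \<Union>(cell_simplex a ` ?T))" by (rule negligible_subset[OF negligible_not_generic_point])
  moreover have "\<Union>(cell_simplex a ` ?T) - ?H = {}" using sub by blast
  moreover have "\<Union>(cell_simplex a ` ?T) \<in> lmeasurable" using lm by (intro fmeasurable.finite_UN) auto
  ultimately have "measure lebesgue ?H = measure lebesgue (\<Union>(cell_simplex a ` ?T))"
    by (intro measure_negligible_symdiff) simp_all
  then show ?thesis using sum by simp
qed

theorem (in generic_data) card_standard_points: "real (card (standard_points a w v)) = normalized_volume A"
proof -
  have "card (standard_points a w v) = (\<Sum>\<sigma>\<in>T. card (cell_points a v \<sigma>))"
    unfolding standard_points_def
  proof (rule card_UN_disjoint)
    show "\<forall>\<sigma>\<in>T. finite (cell_points a v \<sigma>)" using finite_cell_points triangulation_is_basis by blast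
    \<comment> \<open>Genericity turns the half-open condition into membership in the open cone, so
      different cells share no points.\<close>
    have cone: "in_cone a \<sigma> (pt m)" if "\<sigma> \<in> T" "m \<in> cell_points a v \<sigma>" for \<sigma> m
    proof -
      have b: "is_basis a \<sigma>" using that triangulation_is_basis by blast
      have "cmap a \<sigma> (coords a \<sigma> (pt m)) = pt m" by (rule cmap_coords[OF b])
      then have "coords a \<sigma> (pt m) $ i \<noteq> 0" for i using point[of m] unfolding generic_point_def by blast
      then show ?thesis using that(2) b by (simp add: cell_points_def in_cone_def less_le)
    qed
    show "\<forall>\<sigma>\<in>T. \<forall>\<tau>\<in>T. \<sigma> \<noteq> \<tau> \<longrightarrow> cell_points a v \<sigma> \<inter> cell_points a v \<tau> = {}"
      using cone triangulation_unique by blast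
  qed simp
  then have "real (card (standard_points a w v)) = (\<Sum>\<sigma>\<in>T. real (card (cell_points a v \<sigma>)))"
    by simp
  also have "\<dots> = (\<Sum>\<sigma>\<in>T. fact CARD('d) * measure lebesgue (cell_simplex a \<sigma>))"
  proof (rule sum.cong[OF refl])
    fix \<sigma> assume "\<sigma> \<in> T"
    then have b: "is_basis a \<sigma>" by (rule triangulation_is_basis)
    have "measure lebesgue (cell_simplex a \<sigma>) = measure lborel (cell_simplex a \<sigma>)"
      by (rule measure_completion) (simp add: cell_simplex_borel[OF b])
    then show "real (card (cell_points a v \<sigma>)) = fact CARD('d) * measure lebesgue (cell_simplex a \<sigma>)"
      by (simp add: card_cell_points[OF b] measure_cell_simplex[OF b])
  qed
  also have "\<dots> = normalized_volume A"
    by (simp add: normalized_volume_def measure_hull_eq_sum_simplices[OF weight] sum_distrib_left)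
  finally show ?thesis .
qed

theorem theorem3:
  fixes A :: "int^('n::{finite,linorder})^('d::{finite,linorder})"
  assumes rank_d: "rank (\<chi> i j. real_of_int (A$i$j)) = CARD('d)"
    and generate: "\<forall>v :: int^('d::{finite,linorder}). \<exists>c :: 'n \<Rightarrow> int. \<forall>i. v$i = (\<Sum>j\<in>UNIV. c j * A$i$j)"
    and nonzero: "\<forall>j. \<exists>i. A$i$j \<noteq> 0"
  shows "\<exists>r. quot_dim_eq (U_H_A A) r \<and> real r = normalized_volume A"
proof -
  obtain \<omega> :: "'n \<Rightarrow> int" where \<omega>: "generic_weight (col_real A) (\<lambda>j. real_of_int (\<omega> j))"
    by (rule ex_generic_weight)
  obtain v where v: "\<And>m. generic_point (col_real A) (lat m + v)"
    by (rule ex_generic_translation[of "col_real A"]) blast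
  interpret generic_data A \<omega> v by unfold_locales (fact \<omega> v)+
  show ?thesis using quot_dim_eq_standard_points card_standard_points by blast
qed

end
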